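(* Let $r\ge 2$ and $1\le s\le r-1$ be fixed integers, let $\epsilon>0$ be a small fixed constant, and let $H=H^r(n,p)$, with $n\to\infty$. Put $m=\binom{r}{s}-1$. \begin{enumerate} \item (Subcritical phase) If $p<\frac{1-\epsilon}{\left(\binom{r}{s}-1\right)\binom{n}{r-s}}$, then almost surely every $s$-th-order connected component of $H$ has size $O(\ln n)$. \item (Supercritical phase) If $p>\frac{1+\epsilon}{\left(\binom{r}{s}-1\right)\binom{n}{r-s}}$, then almost surely $H$ has a unique giant $s$-th-order connected component, of size $\Theta\big(\binom{n}{s}\big)$, and all other $s$-th-order connected components of $H$ have size $O(\ln n)$. Moreover, if $p=\frac{c}{\binom{n}{r-s}}$ with $c=\frac{1+\epsilon}{\binom{r}{s}-1}$, then almost surely the giant $s$-th-order connected component has size $(z+o(1))\binom{n}{s}$, where $0<z<1$ is a solution of the equation $$1-x=e^{c\left((1-x)^{\binom{r}{s}-1}-1\right)}.$$ \end{enumerate}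
   Context: $H^r(n,p)$ denotes the random $r$-uniform hypergraph on vertex set $[n]=\{1,\dots,n\}$ in which each $r$-subset of $[n]$ is an edge independently with probability $p$. For $1\le s\le r-1$, two $s$-subsets $S,S'$ of $[n]$ are ($s$-th-order) connected if there is a sequence $S_0,F_1,S_1,F_2,\dots,F_k,S_k$ ($k\ge 0$) with $S_0,\dots,S_k$ $s$-subsets of $[n]$, $S_0=S$, $S_k=S'$, $F_1,\dots,F_k$ edges of the hypergraph, and $S_{i-1}\cup S_i\subseteq F_i$ for $1\le i\le k$. This is an equivalence relation on $\binom{[n]}{s}$; its equivalence classes are the $s$-th-order connected components, and the size of a component is the number of $s$-sets in it. A component is giant if its size is $\Theta(n^s)$. "Almost surely" means with probability tending to $1$ as $n\to\infty$; asymptotic notation $O,\Theta,o$ refers to $n\to\infty$ with $r,s,\epsilon$ fixed. *)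

theory Defs
  imports Complex_Main
begin

definition ksets :: "nat \<Rightarrow> nat \<Rightarrow> nat set set" where
  "ksets n k = {S. S \<subseteq> {1..n} \<and> card S = k}"

text \<open>Probability that the random r-uniform hypergraph H^r(n,p) (a set of edges,
  each r-subset of [n] present independently with probability p) satisfies P.\<close>
definition prob_hg :: "nat \<Rightarrow> nat \<Rightarrow> real \<Rightarrow> (nat set set \<Rightarrow> bool) \<Rightarrow> real" where
  "prob_hg n r p P =
     (\<Sum>H\<in>Pow (ksets n r).
        if P H then p ^ card H * (1 - p) ^ (card (ksets n r) - card H) else 0)"

definition s_step :: "nat \<Rightarrow> nat \<Rightarrow> nat set set \<Rightarrow> nat set \<Rightarrow> nat set \<Rightarrow> bool" where
  "s_step n s H S S' \<longleftrightarrow> S \<in> ksets n s \<and> S' \<in> ksets n s \<and> (\<exists>F\<in>H. S \<union> S' \<subseteq> F)"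

definition s_connected :: "nat \<Rightarrow> nat \<Rightarrow> nat set set \<Rightarrow> nat set \<Rightarrow> nat set \<Rightarrow> bool" where
  "s_connected n s H S S' \<longleftrightarrow> S \<in> ksets n s \<and> S' \<in> ksets n s \<and> (s_step n s H)\<^sup>*\<^sup>* S S'"

definition s_component :: "nat \<Rightarrow> nat \<Rightarrow> nat set set \<Rightarrow> nat set \<Rightarrow> nat set set" where
  "s_component n s H S = {S'. s_connected n s H S S'}"

definition s_components :: "nat \<Rightarrow> nat \<Rightarrow> nat set set \<Rightarrow> nat set set set" where
  "s_components n s H = s_component n s H ` ksets n s"

end

theory Submission
  imports Defs "HOL-Real_Asymp.Real_Asymp"
begin

text \<open>Components are explored by revealing, for one \<open>s\<close>-set \<open>S\<close> at a time, the edges through \<open>S\<close> that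
  contain no explored set. With \<open>E\<close> explored and \<open>A\<close> active sets, a potential \<open>t ^ card A * l ^ (k - card E)\<close>
  is a supermartingale whenever \<open>t\<close> is chosen on the right side of the roots of \<open>x = exp (c * (x ^ m - 1))\<close>.
  With \<open>t > 1\<close> this bounds all components in the subcritical phase. With \<open>t < 1\<close> it shows that a set lies in
  a component of bounded size with probability close to the smallest root, and approximately independently for
  two sets, so Chebyshev's inequality gives the number of sets in components of size at least \<open>k\<close>, \<open>k\<close> a constant.

  Two components of large size need not have any \<open>r\<close>-set in common, so they are merged by \<open>s\<close> rounds of
  sprinkling, which exchange one element of a set per round: if \<open>B\<close> has positive density, then \<open>A\<close> fails to
  get connected to \<open>B\<close> with probability at most \<open>exp (- c * card A)\<close>. There are at most \<open>2 ^ (N / k)\<close> ways to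
  divide the components of size at least \<open>k\<close> into two groups, where \<open>N\<close> is the number of \<open>s\<close>-sets, so for large
  \<open>k\<close> a union bound merges nearly all of them into one component. The same estimate with \<open>A\<close> of
  logarithmic size attaches every component of more than logarithmic size to it.\<close>

section \<open>Expectation over a random subset\<close>

text \<open>One step from \<open>S\<close> reveals about Poisson(c) edges, each with
  \<open>m = (r choose s) - 1\<close> further s-sets, so the number of new sets has generating
  function about \<open>exp (c * (t ^ m - 1))\<close>; the removal of \<open>S\<close> divides by
  \<open>t\<close>. Edges already revealed through explored sets and coinciding new sets disturb
  this, but only by a relative order of (known sets) / n, so the approximation holds while at most
  \<open>sqrt n\<close> sets are known.

  The obstacle in attaching components is that a component of \<open>H0 \<union> H1\<close> depends
  on the sprinkled \<open>H1\<close>, so \<open>H1\<close> is not fresh randomness for it. Such a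
  component must be shown to contain a large component of \<open>H0\<close> already.
  \<open>explore_two_layers\<close> does this: a long joint exploration produces many active sets,
  and all of them lie in small components of \<open>H0\<close> only with exponentially small
  probability.

  Sprinkling costs density, so \<open>H0\<close> uses a constant \<open>c0 < c\<close> that is still
  above \<open>1 / m\<close>; \<open>root_perturb\<close> keeps the resulting loss in the size of
  the giant arbitrarily small.\<close>

definition bexp :: "'a set \<Rightarrow> real \<Rightarrow> ('a set \<Rightarrow> real) \<Rightarrow> real" where
  "bexp X p f = (\<Sum>H\<in>Pow X. p ^ card H * (1 - p) ^ (card X - card H) * f H)"

lemma prob_hg_bexp: "prob_hg n r p P = bexp (ksets n r) p (\<lambda>H. of_bool (P H))"
  unfolding prob_hg_def bexp_def by (rule sum.cong) auto

lemma bexp_empty [simp]: "bexp {} p f = f {}"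
  by (simp add: bexp_def)

text \<open>Conditioning on whether \<open>x\<close> is chosen. \<open>bexp_power\<close>,
  \<open>bexp_zero\<close>, \<open>bexp_Un\<close> and \<open>bexp_union\<close> follow from it by
  induction on the ground set.\<close>

lemma bexp_insert:
  assumes "finite X" "x \<notin> X"
  shows "bexp (insert x X) p f = p * bexp X p (\<lambda>H. f (insert x H)) + (1 - p) * bexp X p f"
proof -
  have disj: "Pow X \<inter> insert x ` Pow X = {}" using assms(2) by auto
  have inj: "inj_on (insert x) (Pow X)"
    using assms(2) by (intro inj_onI) (metis PowD insert_ident subsetD)
  let ?g = "\<lambda>H. p ^ card H * (1 - p) ^ (card (insert x X) - card H) * f H"
  have 1: "?g (insert x H) = p * (p ^ card H * (1 - p) ^ (card X - card H) * f (insert x H))"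
    if "H \<in> Pow X" for H
  proof -
    have "finite H" "x \<notin> H" using that assms finite_subset by auto
    then show ?thesis using assms by simp
  qed
  have 2: "?g H = (1 - p) * (p ^ card H * (1 - p) ^ (card X - card H) * f H)"
    if "H \<in> Pow X" for H
  proof -
    have "card H \<le> card X" using that assms by (simp add: card_mono)
    then show ?thesis using assms by (simp add: Suc_diff_le)
  qed
  have "bexp (insert x X) p f = sum ?g (Pow X) + sum ?g (insert x ` Pow X)"
    unfolding bexp_def Pow_insert using disj assms by (subst sum.union_disjoint) auto
  also have "sum ?g (insert x ` Pow X) = (\<Sum>H\<in>Pow X. ?g (insert x H))"
    by (subst sum.reindex[OF inj]) simp
  also have "\<dots> = p * bexp X p (\<lambda>H. f (insert x H))"
    unfolding bexp_def sum_distrib_left by (rule sum.cong[OF refl 1])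
  also have "sum ?g (Pow X) = (1 - p) * bexp X p f"
    unfolding bexp_def sum_distrib_left by (rule sum.cong[OF refl 2])
  finally show ?thesis by simp
qed

lemma bexp_cong:
  assumes "X = Y" "\<And>H. H \<subseteq> Y \<Longrightarrow> f H = g H"
  shows "bexp X p f = bexp Y p g"
  unfolding bexp_def assms(1) using assms(2) by (intro sum.cong) auto

lemma bexp_add: "bexp X p (\<lambda>H. f H + g H) = bexp X p f + bexp X p g"
  by (simp add: bexp_def algebra_simps sum.distrib)

lemma bexp_diff: "bexp X p (\<lambda>H. f H - g H) = bexp X p f - bexp X p g"
  by (simp add: bexp_def algebra_simps sum_subtractf)

lemma bexp_cmult: "bexp X p (\<lambda>H. a * f H) = a * bexp X p f"
  by (simp add: bexp_def sum_distrib_left mult_ac)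

lemma bexp_cmult_right: "bexp X p (\<lambda>H. f H * a) = bexp X p f * a"
  using bexp_cmult[of X p a f] by (simp add: mult.commute)

lemma bexp_sum: "bexp X p (\<lambda>H. \<Sum>i\<in>I. f i H) = (\<Sum>i\<in>I. bexp X p (f i))"
  unfolding bexp_def sum_distrib_left by (rule sum.swap)

lemma bexp_mono:
  assumes "0 \<le> p" "p \<le> 1" "\<And>H. H \<subseteq> X \<Longrightarrow> f H \<le> g H"
  shows "bexp X p f \<le> bexp X p g"
  unfolding bexp_def using assms by (intro sum_mono mult_left_mono) auto

text \<open>The generating function of a binomial variable. \<open>t = 1\<close> yields total mass 1
  (\<open>bexp_const\<close>), \<open>t = 0\<close> the probability of choosing nothing
  (\<open>bexp_exp_nonempty\<close>), and general \<open>t\<close> controls the number of edges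
  revealed in one exploration step.\<close>

lemma bexp_power:
  assumes "finite X"
  shows "bexp X p (\<lambda>H. t ^ card H) = (1 - p + p * t) ^ card X"
  using assms
proof (induction X)
  case (insert x X)
  have "bexp X p (\<lambda>H. t ^ card (insert x H)) = bexp X p (\<lambda>H. t * t ^ card H)"
  proof (rule bexp_cong[OF refl])
    fix H assume "H \<subseteq> X"
    then have "finite H" "x \<notin> H" using insert finite_subset by auto
    then show "t ^ card (insert x H) = t * t ^ card H" by simp
  qed
  then show ?case using insert by (simp add: bexp_insert bexp_cmult algebra_simps)
qed simp

lemma bexp_const:
  assumes "finite X"
  shows "bexp X p (\<lambda>_. a) = a"
  using bexp_power[OF assms, of p 1] bexp_cmult[of X p a "\<lambda>_. 1"] by simp

lemma bexp_nonneg: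
  assumes "0 \<le> p" "p \<le> 1" "\<And>H. H \<subseteq> X \<Longrightarrow> 0 \<le> f H"
  shows "0 \<le> bexp X p f"
  unfolding bexp_def using assms by (intro sum_nonneg) auto

lemma bexp_le_const:
  assumes "finite X" "0 \<le> p" "p \<le> 1" "\<And>H. H \<subseteq> X \<Longrightarrow> f H \<le> a"
  shows "bexp X p f \<le> a"
  using bexp_mono[OF assms(2,3), of X f "\<lambda>_. a"] assms(4) by (simp add: bexp_const assms(1))

lemma bexp_compl:
  assumes "finite X"
  shows "bexp X p (\<lambda>H. of_bool (\<not> P H)) = 1 - bexp X p (\<lambda>H. of_bool (P H))"
proof -
  have "bexp X p (\<lambda>H. of_bool (\<not> P H)) = bexp X p (\<lambda>H. 1 - of_bool (P H))"
    by (rule bexp_cong) auto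
  then show ?thesis by (simp add: bexp_diff bexp_const assms)
qed

lemma bexp_zero: "bexp X 0 f = f {}" if "finite X"
  using that by (induction X arbitrary: f) (simp_all add: bexp_insert)

lemma bexp_Un:
  assumes "finite X" "finite Y" "X \<inter> Y = {}"
  shows "bexp (X \<union> Y) p f = bexp X p (\<lambda>R. bexp Y p (\<lambda>H. f (R \<union> H)))"
  using assms
proof (induction X arbitrary: f)
  case (insert x X)
  then show ?case by (simp add: bexp_insert)
qed simp

text \<open>The basis of sprinkling: an element is missed by both independent rounds with
  probability \<open>(1 - p) * (1 - q)\<close>, so the union of the rounds is again a random set of
  the same kind.\<close>

lemma bexp_union:
  assumes "finite X"
  shows "bexp X p (\<lambda>R. bexp X q (\<lambda>H. f (R \<union> H))) = bexp X (p + q - p * q) f"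
  using assms
proof (induction X arbitrary: f)
  case (insert x X)
  let ?B = "bexp X (p + q - p * q)"
  have *: "bexp X p (\<lambda>R. bexp (insert x X) q (\<lambda>H. g (R \<union> H))) =
     q * ?B (\<lambda>H. g (insert x H)) + (1 - q) * ?B g" for g
    using insert by (simp add: bexp_insert bexp_add bexp_cmult flip: insert.IH)
  have "bexp (insert x X) p (\<lambda>R. bexp (insert x X) q (\<lambda>H. f (R \<union> H))) =
      p * ?B (\<lambda>H. f (insert x H)) + (1 - p) * (q * ?B (\<lambda>H. f (insert x H)) + (1 - q) * ?B f)"
    unfolding bexp_insert[OF insert.hyps, of p]
    by (simp only: Un_insert_left insert_absorb2 *[of f] *[of "\<lambda>H. f (insert x H)"])
      (simp add: algebra_simps)
  also have "\<dots> = bexp (insert x X) (p + q - p * q) f"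
    unfolding bexp_insert[OF insert.hyps] by (simp add: algebra_simps)
  finally show ?case .
qed simp

lemma bexp_swap:
  "bexp X p (\<lambda>H. bexp Y q (\<lambda>G. f H G)) = bexp Y q (\<lambda>G. bexp X p (\<lambda>H. f H G))"
  unfolding bexp_def sum_distrib_left by (subst sum.swap) (simp add: mult_ac)

text \<open>Monotone coupling: a \<open>q\<close>-random set is a \<open>p\<close>-random set with
  further elements sprinkled onto it.\<close>

lemma bexp_antimono:
  assumes "finite X" "0 \<le> p" "p \<le> q" "q \<le> 1"
    and mono: "\<And>H G. H \<subseteq> G \<Longrightarrow> G \<subseteq> X \<Longrightarrow> f G \<le> f H"
  shows "bexp X q f \<le> bexp X p f"
proof (cases "p = 1")
  case True
  then show ?thesis using assms by simp
next
  case False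
  \<comment> \<open>Solves \<open>p + p' - p * p' = q\<close>; the division is why
    \<open>p = 1\<close> is treated apart.\<close>
  define p' where "p' = (q - p) / (1 - p)"
  have p': "0 \<le> p'" "p' \<le> 1" using assms False by (auto simp: p'_def divide_simps)
  have "p + p' - p * p' = p + p' * (1 - p)" by (simp add: algebra_simps)
  also have "\<dots> = q" using False by (simp add: p'_def)
  finally have q: "q = p + p' - p * p'" by simp
  have "bexp X q f = bexp X p (\<lambda>R. bexp X p' (\<lambda>H. f (R \<union> H)))"
    unfolding q by (rule bexp_union[symmetric]) (rule assms)
  also have "\<dots> \<le> bexp X p f"
    using assms p' by (intro bexp_mono bexp_le_const mono) auto
  finally show ?thesis .
qed

lemma bexp_subset:
  assumes "finite X" "Y \<subseteq> X"
  shows "bexp X p (\<lambda>H. f (H \<inter> Y)) = bexp Y p f"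
proof -
  have X: "X = Y \<union> (X - Y)" using assms by auto
  have fin: "finite Y" "finite (X - Y)" using assms finite_subset by auto
  have "bexp X p (\<lambda>H. f (H \<inter> Y)) =
      bexp Y p (\<lambda>R. bexp (X - Y) p (\<lambda>H. f ((R \<union> H) \<inter> Y)))"
    by (subst X, subst bexp_Un) (use fin in auto)
  also have "\<dots> = bexp Y p (\<lambda>R. bexp (X - Y) p (\<lambda>H. f R))"
  proof (intro bexp_cong refl)
    fix R H assume "R \<subseteq> Y" "H \<subseteq> X - Y"
    then have "(R \<union> H) \<inter> Y = R" by auto
    then show "f ((R \<union> H) \<inter> Y) = f R" by simp
  qed
  also have "\<dots> = bexp Y p f" by (simp add: bexp_const fin)
  finally show ?thesis .
qed

text \<open>Independence over the disjoint blocks \<open>C i\<close>: the elements of one block are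
  split off by \<open>bexp_Un\<close>, and the other factors do not see them.\<close>

lemma bexp_prod:
  assumes "finite X" "finite I" "\<And>i. i \<in> I \<Longrightarrow> C i \<subseteq> X"
    "\<And>i j. i \<in> I \<Longrightarrow> j \<in> I \<Longrightarrow> i \<noteq> j \<Longrightarrow> C i \<inter> C j = {}"
  shows "bexp X p (\<lambda>H. \<Prod>i\<in>I. g i (H \<inter> C i)) = (\<Prod>i\<in>I. bexp (C i) p (g i))"
  using assms(2,1,3,4)
proof (induction I arbitrary: X)
  case empty
  then show ?case by (simp add: bexp_const)
next
  case (insert i I)
  have X: "X = C i \<union> (X - C i)" using insert by auto
  have fin: "finite (C i)" "finite (X - C i)" using insert finite_subset[of "C i" X] by auto
  have Cj: "C j \<subseteq> X - C i" if "j \<in> I" for j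
    using insert.prems(2)[of j] insert.prems(3)[of i j] insert.hyps that by auto
  have "bexp X p (\<lambda>H. \<Prod>i\<in>insert i I. g i (H \<inter> C i)) =
      bexp (C i) p (\<lambda>R. bexp (X - C i) p (\<lambda>H. \<Prod>i\<in>insert i I. g i ((R \<union> H) \<inter> C i)))"
    by (subst X, subst bexp_Un) (use fin in auto)
  also have "\<dots> = bexp (C i) p (\<lambda>R. bexp (X - C i) p (\<lambda>H. g i R * (\<Prod>i\<in>I. g i (H \<inter> C i))))"
  proof (intro bexp_cong refl)
    fix R H assume RH: "R \<subseteq> C i" "H \<subseteq> X - C i"
    then have 1: "(R \<union> H) \<inter> C i = R" by auto
    have "(R \<union> H) \<inter> C j = H \<inter> C j" if "j \<in> I" for j
      using Cj[OF that] RH by auto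
    then show "(\<Prod>i\<in>insert i I. g i ((R \<union> H) \<inter> C i)) = g i R * (\<Prod>i\<in>I. g i (H \<inter> C i))"
      using insert.hyps 1 by simp
  qed
  also have "\<dots> = bexp (C i) p (g i) * bexp (X - C i) p (\<lambda>H. \<Prod>i\<in>I. g i (H \<inter> C i))"
    by (simp add: bexp_cmult bexp_cmult_right)
  also have "bexp (X - C i) p (\<lambda>H. \<Prod>i\<in>I. g i (H \<inter> C i)) = (\<Prod>i\<in>I. bexp (C i) p (g i))"
    using fin Cj insert.prems insert.hyps by (intro insert.IH) auto
  finally show ?case using insert.hyps by simp
qed

lemma bexp_supset:
  assumes "finite X" "Y \<subseteq> X"
  shows "bexp X p (\<lambda>H. of_bool (Y \<subseteq> H)) = p ^ card Y"
proof -
  have fin: "finite Y" using assms finite_subset by auto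
  have Y: "bexp Y p (\<lambda>H. of_bool (Y \<subseteq> H)) = p ^ card Y"
  proof -
    have "bexp Y p (\<lambda>H. of_bool (Y \<subseteq> H)) =
       (\<Sum>H\<in>Pow Y. if H = Y then p ^ card Y else 0)"
      unfolding bexp_def by (rule sum.cong) auto
    then show ?thesis using fin by simp
  qed
  have "bexp X p (\<lambda>H. of_bool (Y \<subseteq> H)) = bexp X p (\<lambda>H. of_bool (Y \<subseteq> H \<inter> Y))"
    by (rule bexp_cong) auto
  then show ?thesis using bexp_subset[OF assms, of p "\<lambda>H. of_bool (Y \<subseteq> H)"] Y by simp
qed

section \<open>Exploring one set\<close>

definition reach :: "nat \<Rightarrow> nat \<Rightarrow> nat set set \<Rightarrow> nat set set \<Rightarrow> nat set set" where
  "reach n s A H = {S'. \<exists>S\<in>A. s_connected n s H S S'}"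

text \<open>After the sets in \<open>E\<close> have been explored, the revealed r-sets are those
  containing one of them; the ones left here are still independent of the past.
  \<open>through\<close> picks those that exploring \<open>S\<close> reveals next.\<close>

definition unexplored :: "nat \<Rightarrow> nat \<Rightarrow> nat set set \<Rightarrow> nat set set" where
  "unexplored n r E = {F \<in> ksets n r. \<forall>S\<in>E. \<not> S \<subseteq> F}"

definition through :: "nat \<Rightarrow> nat \<Rightarrow> nat set set \<Rightarrow> nat set \<Rightarrow> nat set set" where
  "through n r E S = {F \<in> unexplored n r E. S \<subseteq> F}"

definition newsets :: "nat \<Rightarrow> nat \<Rightarrow> nat set set \<Rightarrow> nat set set \<Rightarrow> nat set set" where
  "newsets n s W R = {S' \<in> ksets n s. S' \<notin> W \<and> (\<exists>F\<in>R. S' \<subseteq> F)}"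

lemma finite_ksets [simp]: "finite (ksets n k)"
  by (rule finite_subset[of _ "Pow {1..n}"]) (auto simp: ksets_def)

lemma card_ksets: "card (ksets n k) = n choose k"
  unfolding ksets_def using n_subsets[of "{1..n}" k] by simp

lemma finite_ksets_elem: "S \<in> ksets n k \<Longrightarrow> finite S"
  unfolding ksets_def using finite_subset[of S "{1..n}"] by auto

lemma unexplored_subset: "unexplored n r E \<subseteq> ksets n r"
  and through_subset: "through n r E S \<subseteq> ksets n r"
  by (auto simp: unexplored_def through_def)

lemma finite_unexplored [simp]: "finite (unexplored n r E)"
  and finite_through [simp]: "finite (through n r E S)"
  by (rule finite_subset[OF unexplored_subset finite_ksets],
      rule finite_subset[OF through_subset finite_ksets])

lemma finite_newsets [simp]: "finite (newsets n s W R)"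
  by (simp add: newsets_def)

lemma newsets_subset: "newsets n s W R \<subseteq> ksets n s"
  by (auto simp: newsets_def)

lemma newsets_mono: "R \<subseteq> R' \<Longrightarrow> newsets n s W R \<subseteq> newsets n s W R'"
  by (auto simp: newsets_def)

lemma unexplored_empty [simp]: "unexplored n r {} = ksets n r"
  by (simp add: unexplored_def)

lemma unexplored_split:
  "unexplored n r E = through n r E S \<union> unexplored n r (insert S E)"
  "through n r E S \<inter> unexplored n r (insert S E) = {}"
  by (auto simp: unexplored_def through_def)

lemma bexp_unexplored:
  "bexp (unexplored n r E) p f =
     bexp (through n r E S) p (\<lambda>R. bexp (unexplored n r (insert S E)) p (\<lambda>H. f (R \<union> H)))"
  by (subst unexplored_split(1)[of n r E S]) (simp add: bexp_Un unexplored_split(2))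

lemma reach_subset: "reach n s A H \<subseteq> ksets n s"
  by (auto simp: reach_def s_connected_def)

lemma finite_reach [simp]: "finite (reach n s A H)"
  using reach_subset finite_ksets by (rule finite_subset)

lemma reach_refl: "A \<subseteq> ksets n s \<Longrightarrow> A \<subseteq> reach n s A H"
  by (auto simp: reach_def s_connected_def)

lemma s_connected_mono: "H \<subseteq> H' \<Longrightarrow> s_connected n s H S S' \<Longrightarrow> s_connected n s H' S S'"
  unfolding s_connected_def
  using rtranclp_mono[of "s_step n s H" "s_step n s H'"] by (auto simp: s_step_def le_fun_def)

lemma reach_mono: "H \<subseteq> H' \<Longrightarrow> reach n s A H \<subseteq> reach n s A H'"
  unfolding reach_def using s_connected_mono by blast

lemma s_connected_trans:
  "s_connected n s H S S' \<Longrightarrow> s_connected n s H S' S'' \<Longrightarrow> s_connected n s H S S''"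
  unfolding s_connected_def by auto

lemma s_connected_sym: "s_connected n s H S S' \<Longrightarrow> s_connected n s H S' S"
proof -
  have "symp (s_step n s H)" by (auto simp: symp_def s_step_def Un_commute)
  then show "s_connected n s H S S' \<Longrightarrow> s_connected n s H S' S"
    unfolding s_connected_def using symp_rtranclp sympD by metis
qed

lemma reach_step:
  assumes "S \<in> reach n s A H" "S' \<in> ksets n s" "F \<in> H" "S \<subseteq> F" "S' \<subseteq> F"
  shows "S' \<in> reach n s A H"
proof -
  obtain S0 where S0: "S0 \<in> A" "s_connected n s H S0 S" using assms by (auto simp: reach_def)
  have "s_step n s H S S'" using assms S0 by (auto simp: s_step_def s_connected_def)
  then have "s_connected n s H S0 S'"
    using S0 assms(2) unfolding s_connected_def by (meson rtranclp.rtrancl_into_rtrancl)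
  then show ?thesis using S0 by (auto simp: reach_def)
qed

lemma reach_induct [consumes 1, case_names base step]:
  assumes "S' \<in> reach n s A H" "\<And>S. S \<in> A \<Longrightarrow> S \<in> ksets n s \<Longrightarrow> P S"
    "\<And>S S' F. P S \<Longrightarrow> S' \<in> ksets n s \<Longrightarrow> F \<in> H \<Longrightarrow> S \<subseteq> F \<Longrightarrow> S' \<subseteq> F \<Longrightarrow> P S'"
  shows "P S'"
proof -
  obtain S0 where S0: "S0 \<in> A" "S0 \<in> ksets n s" "(s_step n s H)\<^sup>*\<^sup>* S0 S'"
    using assms(1) by (auto simp: reach_def s_connected_def)
  from S0(3) show ?thesis
    by (induction) (use S0 assms in \<open>auto simp: s_step_def\<close>)
qed

lemma s_component_reach: "s_component n s H S = reach n s {S} H"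
  by (simp add: s_component_def reach_def)

text \<open>Induction along a path. An edge of \<open>R\<close> leads to a known or a new set; an
  edge of \<open>H\<close> contains no member of \<open>insert S E\<close>, so a step along it
  starts in the reach of the new active sets and stays there.\<close>

lemma reach_explore_subset:
  assumes "S \<in> A" "A \<subseteq> ksets n s" "R \<subseteq> through n r E S" "H \<subseteq> unexplored n r (insert S E)"
  shows "E \<union> reach n s A (R \<union> H) \<subseteq>
    insert S E \<union> reach n s (A - {S} \<union> newsets n s (A \<union> E) R) H" (is "_ \<subseteq> insert S E \<union> ?Q")
proof -
  have "S' \<in> insert S E \<union> ?Q" if "S' \<in> reach n s A (R \<union> H)" for S'
    using that
  proof (induction rule: reach_induct)
    case (base S')
    then show ?case
      using reach_refl[of "A - {S} \<union> newsets n s (A \<union> E) R" n s H] assms(2) newsets_subset by blast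
  next
    case (step S1 S2 F)
    show ?case
    proof (cases "F \<in> R")
      case True
      then have "S2 \<in> A \<union> E \<or> S2 \<in> newsets n s (A \<union> E) R"
        using step by (auto simp: newsets_def)
      then show ?thesis
        using reach_refl[of "A - {S} \<union> newsets n s (A \<union> E) R" n s H] assms(2) newsets_subset by blast
    next
      case False
      then have F: "F \<in> H" using step by auto
      then have "S1 \<notin> insert S E" using assms(4) step by (auto simp: unexplored_def)
      then have "S1 \<in> ?Q" using step by auto
      then have "S2 \<in> ?Q" using reach_step step F by metis
      then show ?thesis by simp
    qed
  qed
  then show ?thesis by auto
qed

lemma reach_explore_supset:
  assumes "S \<in> A" "A \<subseteq> ksets n s" "R \<subseteq> through n r E S"
  shows "reach n s (A - {S} \<union> newsets n s W R) H \<subseteq> reach n s A (R \<union> H)" (is "?L \<subseteq> ?Q")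
proof
  fix S' assume "S' \<in> ?L"
  then show "S' \<in> ?Q"
  proof (induction rule: reach_induct)
    case (base S')
    show ?case
    proof (cases "S' \<in> A")
      case True
      then show ?thesis using reach_refl[OF assms(2)] by auto
    next
      case False
      then obtain F where "F \<in> R" "S' \<subseteq> F" using base by (auto simp: newsets_def)
      then show ?thesis
        using reach_step[of S n s A "R \<union> H" S' F] assms base
          subsetD[OF reach_refl[OF assms(2), of "R \<union> H"] assms(1)]
        by (auto simp: through_def)
    qed
  next
    case (step S1 S2 F)
    then show ?case using reach_step[of S1 n s A "R \<union> H" S2 F] by auto
  qed
qed

text \<open>The invariant of the exploration: \<open>S\<close> moves from the reach of the active
  sets to the explored ones, and the union stays the same. Hence any function of
  \<open>E \<union> reach n s A H\<close> can be followed step by step.\<close>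

lemma card_explore_eq:
  assumes "S \<in> A" "A \<subseteq> ksets n s" "R \<subseteq> through n r E S" "H \<subseteq> unexplored n r (insert S E)"
  shows "E \<union> reach n s A (R \<union> H) =
    insert S E \<union> reach n s (A - {S} \<union> newsets n s (A \<union> E) R) H"
  using reach_explore_subset[OF assms] reach_explore_supset[OF assms(1-3), of "A \<union> E" H]
    reach_refl[OF assms(2), of "R \<union> H"] assms(1) by blast

section \<open>Counting edges through a set and the new sets they contain\<close>

lemma card_ksets_superset:
  assumes "T \<subseteq> {1..n}" "card T \<le> r"
  shows "card {F \<in> ksets n r. T \<subseteq> F} = (n - card T) choose (r - card T)"
proof -
  have fT: "finite T" using assms finite_subset by auto
  have "bij_betw (\<lambda>F. F - T) {F \<in> ksets n r. T \<subseteq> F} {G. G \<subseteq> {1..n} - T \<and> card G = r - card T}"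
  proof (rule bij_betw_byWitness[where f' = "\<lambda>G. G \<union> T"])
    show "(\<lambda>F. F - T) ` {F \<in> ksets n r. T \<subseteq> F} \<subseteq> {G. G \<subseteq> {1..n} - T \<and> card G = r - card T}"
      using fT by (auto simp: ksets_def card_Diff_subset)
    have "card (G \<union> T) = r" if "G \<subseteq> {1..n} - T" "card G = r - card T" for G
    proof -
      have "finite G" using that finite_subset by auto
      then show ?thesis using that fT assms by (subst card_Un_disjoint) auto
    qed
    then show "(\<lambda>G. G \<union> T) ` {G. G \<subseteq> {1..n} - T \<and> card G = r - card T} \<subseteq> {F \<in> ksets n r. T \<subseteq> F}"
      using assms by (auto simp: ksets_def)
  qed auto
  then have "card {F \<in> ksets n r. T \<subseteq> F} = card {G. G \<subseteq> {1..n} - T \<and> card G = r - card T}"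
    by (rule bij_betw_same_card)
  also have "\<dots> = (n - card T) choose (r - card T)"
    using n_subsets[of "{1..n} - T" "r - card T"] assms fT by (simp add: card_Diff_subset)
  finally show ?thesis .
qed

text \<open>Applied to the union of two different s-sets, or to an s-set with one more element:
  these lie in fewer edges than a single s-set by a factor of order \<open>n\<close>, which is what
  makes lost edges and collisions negligible.\<close>

lemma card_ksets_superset_le:
  assumes "T \<subseteq> {1..n}" "s < card T" "s < r"
  shows "card {F \<in> ksets n r. T \<subseteq> F} \<le> (n - Suc s) choose (r - Suc s)"
proof -
  obtain T0 where T0: "T0 \<subseteq> T" "card T0 = Suc s"
    using assms(2) by (metis Suc_leI obtain_subset_with_card_n)
  have "card {F \<in> ksets n r. T \<subseteq> F} \<le> card {F \<in> ksets n r. T0 \<subseteq> F}"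
    using T0 by (intro card_mono) auto
  also have "\<dots> = (n - Suc s) choose (r - Suc s)"
    using T0 assms by (subst card_ksets_superset) auto
  finally show ?thesis .
qed

lemma card_Un_ksets_gt:
  assumes "S \<in> ksets n s" "S' \<in> ksets n s" "S \<noteq> S'"
  shows "s < card (S \<union> S')"
proof -
  have "\<not> S' \<subseteq> S"
    using assms card_subset_eq[of S S'] finite_ksets_elem[of S] by (auto simp: ksets_def)
  then have "S \<subset> S \<union> S'" by auto
  then have "card S < card (S \<union> S')"
    using finite_ksets_elem[OF assms(1)] finite_ksets_elem[OF assms(2)] by (intro psubset_card_mono) auto
  then show ?thesis using assms by (simp add: ksets_def)
qed

lemma card_through_le:
  assumes "S \<in> ksets n s" "s \<le> r"
  shows "card (through n r E S) \<le> (n - s) choose (r - s)"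
proof -
  have "card (through n r E S) \<le> card {F \<in> ksets n r. S \<subseteq> F}"
    by (intro card_mono) (auto simp: through_def unexplored_def)
  also have "\<dots> = (n - s) choose (r - s)"
    using assms by (subst card_ksets_superset) (auto simp: ksets_def)
  finally show ?thesis .
qed

text \<open>The edges through \<open>S\<close> that are missing from \<open>through n r E S\<close>
  contain \<open>S \<union> S'\<close> for some explored \<open>S'\<close>, and this union is larger
  than \<open>S\<close> because \<open>S\<close> is itself unexplored.\<close>

lemma card_through_ge:
  assumes "S \<in> ksets n s" "s < r" "E \<subseteq> ksets n s" "S \<notin> E"
  shows "(n - s) choose (r - s) \<le> card (through n r E S) + card E * ((n - Suc s) choose (r - Suc s))"
proof -
  have fE: "finite E" using assms finite_subset[of E "ksets n s"] by simp
  let ?X = "{F \<in> ksets n r. S \<subseteq> F}"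
  let ?Y = "\<Union>S'\<in>E. {F \<in> ksets n r. S \<union> S' \<subseteq> F}"
  have "(n - s) choose (r - s) = card ?X"
    using assms by (subst card_ksets_superset) (auto simp: ksets_def)
  also have "\<dots> \<le> card (through n r E S \<union> ?Y)"
    using fE by (intro card_mono) (auto simp: through_def unexplored_def)
  also have "\<dots> \<le> card (through n r E S) + card ?Y" by (rule card_Un_le)
  also have "card ?Y \<le> (\<Sum>S'\<in>E. card {F \<in> ksets n r. S \<union> S' \<subseteq> F})"
    by (rule card_UN_le[OF fE])
  also have "\<dots> \<le> (\<Sum>S'\<in>E. (n - Suc s) choose (r - Suc s))"
  proof (rule sum_mono)
    fix S' assume S': "S' \<in> E"
    then have "s < card (S \<union> S')" using assms card_Un_ksets_gt[of S n s S'] by auto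
    then show "card {F \<in> ksets n r. S \<union> S' \<subseteq> F} \<le> (n - Suc s) choose (r - Suc s)"
      using S' assms by (intro card_ksets_superset_le) (auto simp: ksets_def)
  qed
  finally show ?thesis by simp
qed

lemma newsets_eq_UN:
  assumes "R \<subseteq> ksets n r"
  shows "newsets n s W R = (\<Union>F\<in>R. {S'. S' \<subseteq> F \<and> card S' = s} - W)"
  using assms by (auto simp: newsets_def ksets_def)

lemma card_subsets_minus:
  assumes "F \<in> ksets n r" "S \<subseteq> F" "S \<in> ksets n s"
  shows "card ({S'. S' \<subseteq> F \<and> card S' = s} - {S}) = (r choose s) - 1"
proof -
  have "card {S'. S' \<subseteq> F \<and> card S' = s} = r choose s"
    using assms finite_ksets_elem[OF assms(1)] n_subsets[of F s] by (auto simp: ksets_def)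
  then show ?thesis using assms by (subst card_Diff_singleton) (auto simp: ksets_def)
qed

lemma finite_subsets_card: "finite F \<Longrightarrow> finite {S'. S' \<subseteq> F \<and> card S' = s}"
  by (rule finite_subset[of _ "Pow F"]) auto

lemma subset_throughD:
  assumes "R \<subseteq> through n r E S"
  shows "R \<subseteq> ksets n r" "finite R" "F \<in> R \<Longrightarrow> S \<subseteq> F"
  using order_trans[OF assms through_subset] finite_subset[OF assms finite_through] assms
  by (auto simp: through_def)

lemma card_newsets_le:
  assumes "S \<in> W" "S \<in> ksets n s" "R \<subseteq> through n r E S"
  shows "card (newsets n s W R) \<le> ((r choose s) - 1) * card R"
proof -
  note R = subset_throughD(1,2)[OF assms(3)] and SF = subset_throughD(3)[OF assms(3)]
  have "card (newsets n s W R) \<le> card (\<Union>F\<in>R. {S'. S' \<subseteq> F \<and> card S' = s} - {S})"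
    unfolding newsets_eq_UN[OF R(1)] using assms(1) R
    by (intro card_mono finite_UN_I finite_Diff finite_subsets_card) (auto intro: finite_ksets_elem)
  also have "\<dots> \<le> (\<Sum>F\<in>R. card ({S'. S' \<subseteq> F \<and> card S' = s} - {S}))"
    by (rule card_UN_le[OF R(2)])
  also have "\<dots> = (\<Sum>F\<in>R. (r choose s) - 1)"
    using R SF assms by (intro sum.cong card_subsets_minus) auto
  finally show ?thesis by (simp add: mult.commute)
qed

text \<open>The two ways in which the s-subsets other than \<open>S\<close> of the revealed edges
  can fail to be new and pairwise different: an edge contains another known set, or two edges share
  more than \<open>S\<close>. Edges through \<open>S\<close> always share the \<open>s\<close>
  elements of \<open>S\<close>.\<close>

definition collision :: "nat \<Rightarrow> nat set set \<Rightarrow> nat set \<Rightarrow> nat set set \<Rightarrow> bool" where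
  "collision s W S R \<longleftrightarrow> (\<exists>S0\<in>W - {S}. \<exists>F\<in>R. S0 \<subseteq> F) \<or>
     (\<exists>F\<in>R. \<exists>F'\<in>R. F \<noteq> F' \<and> s < card (F \<inter> F'))"

lemma card_newsets_eq:
  assumes "S \<in> W" "S \<in> ksets n s" "R \<subseteq> through n r E S" "\<not> collision s W S R"
  shows "card (newsets n s W R) = ((r choose s) - 1) * card R"
proof -
  note R = subset_throughD(1,2)[OF assms(3)] and SF = subset_throughD(3)[OF assms(3)]
  let ?g = "\<lambda>F. {S'. S' \<subseteq> F \<and> card S' = s} - {S}"
  have "newsets n s W R = (\<Union>F\<in>R. ?g F)"
    unfolding newsets_eq_UN[OF R(1)] using assms by (auto simp: collision_def)
  also have "card \<dots> = (\<Sum>F\<in>R. card (?g F))"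
  proof (rule card_UN_disjoint[OF R(2)])
    show "\<forall>F\<in>R. finite (?g F)"
      using R by (auto intro!: finite_Diff finite_subsets_card finite_ksets_elem)
    show "\<forall>F\<in>R. \<forall>F'\<in>R. F \<noteq> F' \<longrightarrow> ?g F \<inter> ?g F' = {}"
    proof (intro ballI impI)
      fix F F' assume F: "F \<in> R" "F' \<in> R" "F \<noteq> F'"
      then have le: "card (F \<inter> F') \<le> s" using assms(4) by (auto simp: collision_def not_less)
      have fin: "finite (F \<inter> F')" using F R finite_ksets_elem[of F n r] by auto
      \<comment> \<open>Both edges contain \<open>S\<close>, so an intersection of at most
        \<open>s\<close> elements is \<open>S\<close> itself and has no other s-subset.\<close>
      have "S' = F \<inter> F'" if "S' \<subseteq> F \<inter> F'" "card S' = s" for S'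
        using that le fin card_seteq[OF fin] by auto
      moreover have "S \<subseteq> F \<inter> F'" "card S = s" using SF F assms by (auto simp: ksets_def)
      ultimately have "S' = S" if "S' \<subseteq> F" "S' \<subseteq> F'" "card S' = s" for S'
        using that by (metis Int_subset_iff)
      then show "?g F \<inter> ?g F' = {}" by auto
    qed
  qed
  also have "\<dots> = (\<Sum>F\<in>R. (r choose s) - 1)"
    using R SF assms by (intro sum.cong card_subsets_minus) auto
  finally show ?thesis by (simp add: mult.commute)
qed

text \<open>A first-moment bound over witnesses. \<open>?f1\<close> counts a known \<open>S0\<close>
  with an edge containing \<open>S \<union> S0\<close>. \<open>?f2\<close> counts two edges
  \<open>F\<close>, \<open>F'\<close> with a common element \<open>y\<close> outside
  \<open>S\<close>: at most \<open>D\<close> choices of \<open>F\<close>, \<open>r - s\<close> of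
  \<open>y\<close> and \<open>D'\<close> of \<open>F'\<close>.\<close>

lemma bexp_collision_le:
  assumes p: "0 \<le> p" "p \<le> 1" and S: "S \<in> ksets n s" and W: "W \<subseteq> ksets n s" and sr: "s < r"
    and D': "D' = (n - Suc s) choose (r - Suc s)" and D: "D = (n - s) choose (r - s)"
  shows "bexp (through n r E S) p (\<lambda>R. of_bool (collision s W S R)) \<le>
    p * real (card W) * real D' + p\<^sup>2 * real D * real (r - s) * real D'"
proof -
  let ?X = "through n r E S"
  have fW: "finite W" using W finite_subset[of W "ksets n s"] by simp
  let ?f1 = "\<lambda>R. (\<Sum>S0\<in>W - {S}. \<Sum>F\<in>{F\<in>?X. S0 \<subseteq> F}. of_bool ({F} \<subseteq> R) :: real)"
  let ?P = "\<lambda>F y. {F'\<in>?X. F' \<noteq> F \<and> insert y S \<subseteq> F'}"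
  let ?f2 = "\<lambda>R. (\<Sum>F\<in>?X. \<Sum>y\<in>F - S. \<Sum>F'\<in>?P F y. of_bool ({F, F'} \<subseteq> R) :: real)"
  have le: "of_bool (collision s W S R) \<le> ?f1 R + ?f2 R" if R: "R \<subseteq> ?X" for R
  proof (cases "collision s W S R")
    case True
    have nn: "0 \<le> ?f1 R" "0 \<le> ?f2 R" by (intro sum_nonneg; simp)+
    consider S0 F where "S0 \<in> W - {S}" "F \<in> R" "S0 \<subseteq> F"
      | F F' where "F \<in> R" "F' \<in> R" "F \<noteq> F'" "s < card (F \<inter> F')"
      using True unfolding collision_def by blast
    then show ?thesis
    proof cases
      case 1
      have "1 \<le> (\<Sum>F\<in>{F\<in>?X. S0 \<subseteq> F}. of_bool ({F} \<subseteq> R) :: real)"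
        using member_le_sum[of F "{F\<in>?X. S0 \<subseteq> F}" "\<lambda>F. of_bool ({F} \<subseteq> R) :: real"] 1 R by auto
      also have "\<dots> \<le> ?f1 R"
        using 1 fW by (intro member_le_sum) (auto intro: sum_nonneg)
      finally show ?thesis using nn True by simp
    next
      case 2
      have "\<not> F \<inter> F' \<subseteq> S"
        using 2 S card_mono[of S "F \<inter> F'"] finite_ksets_elem[of S] by (auto simp: ksets_def)
      then obtain y where y: "y \<in> F" "y \<in> F'" "y \<notin> S" by auto
      have FX: "F \<in> ?X" "F' \<in> ?X" "S \<subseteq> F'" using 2 R by (auto simp: through_def)
      then have finF: "finite F" using through_subset finite_ksets_elem[of F n r] by blast
      have "1 \<le> (\<Sum>F'\<in>?P F y. of_bool ({F, F'} \<subseteq> R) :: real)"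
        using member_le_sum[of F' "?P F y" "\<lambda>F'. of_bool ({F, F'} \<subseteq> R) :: real"] 2 FX y by auto
      also have "\<dots> \<le> (\<Sum>y\<in>F - S. \<Sum>F'\<in>?P F y. of_bool ({F, F'} \<subseteq> R) :: real)"
        using y finF by (intro member_le_sum[where i = y and A = "F - S"]) (auto intro: sum_nonneg)
      also have "\<dots> \<le> ?f2 R"
        using FX by (intro member_le_sum[where i = F and A = ?X]) (auto intro!: sum_nonneg)
      finally show ?thesis using nn True by simp
    qed
  qed (auto intro!: sum_nonneg add_nonneg_nonneg)
  have e1: "bexp ?X p ?f1 \<le> p * real (card W) * real D'"
  proof -
    have "bexp ?X p ?f1 = (\<Sum>S0\<in>W - {S}. \<Sum>F\<in>{F\<in>?X. S0 \<subseteq> F}. p)"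
    proof -
      have "bexp ?X p (\<lambda>R. of_bool ({F} \<subseteq> R)) = p" if "F \<in> ?X" for F
        using bexp_supset[of ?X "{F}" p] that by simp
      then show ?thesis unfolding bexp_sum by (intro sum.cong refl) auto
    qed
    also have "\<dots> \<le> (\<Sum>S0\<in>W - {S}. p * real D')"
    proof (rule sum_mono)
      fix S0 assume S0: "S0 \<in> W - {S}"
      have "card {F\<in>?X. S0 \<subseteq> F} \<le> card {F \<in> ksets n r. S \<union> S0 \<subseteq> F}"
        by (intro card_mono) (auto simp: through_def unexplored_def)
      also have "\<dots> \<le> D'"
        unfolding D' using S0 S W sr card_Un_ksets_gt[of S n s S0]
        by (intro card_ksets_superset_le) (auto simp: ksets_def)
      finally show "(\<Sum>F\<in>{F\<in>?X. S0 \<subseteq> F}. p) \<le> p * real D'"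
        using p by (simp add: mult.commute mult_left_mono)
    qed
    also have "\<dots> = real (card (W - {S})) * (p * real D')" by simp
    also have "\<dots> \<le> real (card W) * (p * real D')"
      using p fW card_mono[of W "W - {S}"] by (intro mult_right_mono) auto
    finally show ?thesis by (simp add: mult_ac)
  qed
  have e2: "bexp ?X p ?f2 \<le> p\<^sup>2 * real D * real (r - s) * real D'"
  proof -
    have pr: "bexp ?X p (\<lambda>R. of_bool ({F, F'} \<subseteq> R)) = p\<^sup>2" if "F \<in> ?X" "F' \<in> ?X" "F' \<noteq> F" for F F'
      using bexp_supset[of ?X "{F, F'}" p] that by (auto simp: power2_eq_square)
    have "bexp ?X p ?f2 = (\<Sum>F\<in>?X. \<Sum>y\<in>F - S. \<Sum>F'\<in>?P F y. p\<^sup>2)"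
      unfolding bexp_sum by (intro sum.cong refl pr) auto
    also have "\<dots> \<le> (\<Sum>F\<in>?X. real (r - s) * (p\<^sup>2 * real D'))"
    proof (rule sum_mono)
      fix F assume F: "F \<in> ?X"
      then have FF: "F \<in> ksets n r" "S \<subseteq> F" by (auto simp: through_def unexplored_def)
      have cFS: "card (F - S) = r - s"
        using FF S finite_ksets_elem[OF S] by (simp add: card_Diff_subset ksets_def)
      have "(\<Sum>y\<in>F - S. \<Sum>F'\<in>?P F y. p\<^sup>2) \<le> (\<Sum>y\<in>F - S. p\<^sup>2 * real D')"
      proof (rule sum_mono)
        fix y assume y: "y \<in> F - S"
        have "card (?P F y) \<le> card {F \<in> ksets n r. insert y S \<subseteq> F}"
          by (intro card_mono) (auto simp: through_def unexplored_def)
        also have "\<dots> \<le> D'"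
          unfolding D' using y S FF sr finite_ksets_elem[OF S]
          by (intro card_ksets_superset_le) (auto simp: ksets_def)
        finally show "(\<Sum>F'\<in>?P F y. p\<^sup>2) \<le> p\<^sup>2 * real D'"
          by (simp add: mult.commute[of "p\<^sup>2"] mult_right_mono)
      qed
      then show "(\<Sum>y\<in>F - S. \<Sum>F'\<in>?P F y. p\<^sup>2) \<le> real (r - s) * (p\<^sup>2 * real D')"
        by (simp add: cFS)
    qed
    also have "\<dots> = real (card ?X) * (real (r - s) * (p\<^sup>2 * real D'))" by simp
    also have "\<dots> \<le> real D * (real (r - s) * (p\<^sup>2 * real D'))"
      using card_through_le[OF S, of r E] sr D by (intro mult_right_mono) auto
    finally show ?thesis by (simp add: mult_ac)
  qed
  have "bexp ?X p (\<lambda>R. of_bool (collision s W S R)) \<le> bexp ?X p (\<lambda>R. ?f1 R + ?f2 R)"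
    by (rule bexp_mono[OF p le])
  then show ?thesis using e1 e2 unfolding bexp_add by linarith
qed

text \<open>With \<open>t \<le> 1\<close> the danger is too few new sets. Edges lost to explored
  sets weaken the exponent through \<open>card W * D'\<close>, and in case of a collision the power
  of \<open>t\<close> is bounded trivially by 1.\<close>

lemma bexp_newsets_le:
  assumes p: "0 \<le> p" "p \<le> 1" and t: "0 \<le> t" "t \<le> 1"
    and S: "S \<in> W" and W: "W \<subseteq> ksets n s" "E \<subseteq> W" "S \<notin> E" and sr: "s < r"
    and D': "D' = (n - Suc s) choose (r - Suc s)" and D: "D = (n - s) choose (r - s)"
  shows "bexp (through n r E S) p (\<lambda>R. t ^ card (newsets n s W R)) \<le>
    exp (- (p * (1 - t ^ ((r choose s) - 1)) * (real D - real (card W) * real D'))) +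
    (p * real (card W) * real D' + p\<^sup>2 * real D * real (r - s) * real D')"
proof -
  let ?X = "through n r E S" and ?m = "(r choose s) - 1"
  have Sk: "S \<in> ksets n s" using S W by auto
  have fW: "finite W" using W finite_subset[of W "ksets n s"] by simp
  have "bexp ?X p (\<lambda>R. t ^ card (newsets n s W R)) \<le>
      bexp ?X p (\<lambda>R. (t ^ ?m) ^ card R + of_bool (collision s W S R))"
  proof (rule bexp_mono[OF p])
    fix R assume R: "R \<subseteq> ?X"
    show "t ^ card (newsets n s W R) \<le> (t ^ ?m) ^ card R + of_bool (collision s W S R)"
    proof (cases "collision s W S R")
      case True
      have "t ^ card (newsets n s W R) \<le> 1" using t by (simp add: power_le_one)
      moreover have "0 \<le> (t ^ ?m) ^ card R" using t by simp
      ultimately show ?thesis using True by simp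
    next
      case False
      then show ?thesis using card_newsets_eq[OF S Sk R False] by (simp add: power_mult)
    qed
  qed
  also have "\<dots> = (1 - p + p * t ^ ?m) ^ card ?X + bexp ?X p (\<lambda>R. of_bool (collision s W S R))"
    by (simp add: bexp_add bexp_power)
  also have "\<dots> \<le> exp (- (p * (1 - t ^ ?m) * (real D - real (card W) * real D'))) +
    (p * real (card W) * real D' + p\<^sup>2 * real D * real (r - s) * real D')"
  proof (rule add_mono)
    have tm: "0 \<le> t ^ ?m" "t ^ ?m \<le> 1" using t by (auto simp: power_le_one)
    have q: "0 \<le> p * (1 - t ^ ?m)" "p * (1 - t ^ ?m) \<le> 1"
      using p tm by (auto intro: mult_le_one)
    have "real D \<le> real (card ?X) + real (card E) * real D'"
      using card_through_ge[OF Sk sr, of E] W D D' by (simp flip: of_nat_mult of_nat_add)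
    moreover have "real (card E) * real D' \<le> real (card W) * real D'"
      using W fW by (intro mult_right_mono) (auto intro: card_mono)
    ultimately have cX: "real D - real (card W) * real D' \<le> real (card ?X)" by linarith
    have "(1 - p + p * t ^ ?m) ^ card ?X = (1 - p * (1 - t ^ ?m)) ^ card ?X"
      by (simp add: algebra_simps)
    also have "\<dots> \<le> exp (- (p * (1 - t ^ ?m))) ^ card ?X"
      using q exp_ge_add_one_self[of "- (p * (1 - t ^ ?m))"] by (intro power_mono) auto
    also have "\<dots> = exp (- (p * (1 - t ^ ?m) * real (card ?X)))"
      by (simp add: exp_of_nat_mult[symmetric] mult_ac)
    also have "\<dots> \<le> exp (- (p * (1 - t ^ ?m) * (real D - real (card W) * real D')))"
      using q cX by (simp add: mult_left_mono)
    finally show "(1 - p + p * t ^ ?m) ^ card ?X \<le> exp (- (p * (1 - t ^ ?m) * (real D - real (card W) * real D')))" .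
    show "bexp ?X p (\<lambda>R. of_bool (collision s W S R)) \<le>
       p * real (card W) * real D' + p\<^sup>2 * real D * real (r - s) * real D'"
      by (rule bexp_collision_le[OF p Sk W(1) sr D' D])
  qed
  finally show ?thesis .
qed

text \<open>With \<open>t \<ge> 1\<close> overcounting is safe, so
  \<open>((r choose s) - 1) * card R\<close> replaces the number of new sets and collisions need no
  estimate. \<open>bexp_newsets_ge\<close> rests on the same count, with a base at most 1 and the
  inequality reversed.\<close>

lemma bexp_newsets_le_upper:
  assumes p: "0 \<le> p" "p \<le> 1" and t: "1 \<le> t"
    and S: "S \<in> W" "S \<in> ksets n s" and sr: "s \<le> r"
  shows "bexp (through n r E S) p (\<lambda>R. t ^ card (newsets n s W R)) \<le>
    exp (p * real ((n - s) choose (r - s)) * (t ^ ((r choose s) - 1) - 1))"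
proof -
  let ?X = "through n r E S" and ?m = "(r choose s) - 1"
  have "bexp ?X p (\<lambda>R. t ^ card (newsets n s W R)) \<le> bexp ?X p (\<lambda>R. (t ^ ?m) ^ card R)"
    using t card_newsets_le[OF S]
    by (intro bexp_mono[OF p]) (simp add: power_increasing flip: power_mult)
  also have "\<dots> = (1 + p * (t ^ ?m - 1)) ^ card ?X"
    by (simp add: bexp_power algebra_simps)
  also have "\<dots> \<le> exp (p * (t ^ ?m - 1)) ^ card ?X"
    using p t by (intro power_mono exp_ge_add_one_self) auto
  also have "\<dots> = exp (real (card ?X) * (p * (t ^ ?m - 1)))"
    by (simp add: exp_of_nat_mult[symmetric])
  also have "\<dots> \<le> exp (real ((n - s) choose (r - s)) * (p * (t ^ ?m - 1)))"
    using p t card_through_le[OF S(2) sr, of E] by (simp add: mult_right_mono)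
  finally show ?thesis by (simp add: mult_ac)
qed

lemma bexp_newsets_ge:
  assumes p: "0 \<le> p" "p \<le> 1" and u: "0 \<le> u" "u \<le> 1"
    and S: "S \<in> W" "S \<in> ksets n s" and sr: "s \<le> r"
  shows "bexp (through n r E S) p (\<lambda>R. u ^ card (newsets n s W R)) \<ge>
    (1 - p * (1 - u ^ ((r choose s) - 1))) ^ ((n - s) choose (r - s))"
proof -
  let ?X = "through n r E S" and ?m = "(r choose s) - 1"
  have um: "0 \<le> u ^ ?m" "u ^ ?m \<le> 1" using u by (auto simp: power_le_one)
  have "(1 - p * (1 - u ^ ?m)) ^ ((n - s) choose (r - s)) \<le> (1 - p * (1 - u ^ ?m)) ^ card ?X"
    using p um card_through_le[OF S(2) sr, of E] by (intro power_decreasing) (auto intro: mult_le_one)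
  also have "\<dots> = bexp ?X p (\<lambda>R. (u ^ ?m) ^ card R)"
    by (simp add: bexp_power algebra_simps)
  also have "\<dots> \<le> bexp ?X p (\<lambda>R. u ^ card (newsets n s W R))"
    using u card_newsets_le[OF S]
    by (intro bexp_mono[OF p]) (simp add: power_decreasing flip: power_mult)
  finally show ?thesis .
qed

section \<open>Potential bounds for the exploration\<close>

text \<open>The supermartingale condition for one step, uniform over all states with at most
  \<open>w\<close> known sets. It is used with \<open>q = t\<close> (no decay) and with
  \<open>q = l * t\<close> (a factor \<open>l\<close> per explored set).\<close>

definition step_le :: "nat \<Rightarrow> nat \<Rightarrow> nat \<Rightarrow> real \<Rightarrow> real \<Rightarrow> real \<Rightarrow> nat \<Rightarrow> bool" where
  "step_le n r s p t q w \<longleftrightarrow> (\<forall>E A S. S \<in> A \<longrightarrow> A \<inter> E = {} \<longrightarrow> A \<union> E \<subseteq> ksets n s \<longrightarrow>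
     card (A \<union> E) \<le> w \<longrightarrow>
     bexp (through n r E S) p (\<lambda>R. t ^ card (newsets n s (A \<union> E) R)) \<le> q)"

lemma bexp_explore:
  assumes "S \<in> A" "A \<subseteq> ksets n s"
  shows "bexp (unexplored n r E) p (\<lambda>H. g (E \<union> reach n s A H)) =
    bexp (through n r E S) p (\<lambda>R. bexp (unexplored n r (insert S E)) p
      (\<lambda>H. g (insert S E \<union> reach n s (A - {S} \<union> newsets n s (A \<union> E) R) H)))"
  unfolding bexp_unexplored[of n r E p _ S]
  by (intro bexp_cong refl) (simp only: card_explore_eq[OF assms])

lemma explore_next:
  assumes "S \<in> A" "A \<inter> E = {}" "A \<union> E \<subseteq> ksets n s"
  shows "(A - {S} \<union> newsets n s (A \<union> E) R) \<inter> insert S E = {}"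
    "(A - {S} \<union> newsets n s (A \<union> E) R) \<union> insert S E \<subseteq> ksets n s"
    "card (A - {S} \<union> newsets n s (A \<union> E) R) = card A - 1 + card (newsets n s (A \<union> E) R)"
    "card (insert S E) = Suc (card E)"
proof -
  have fin: "finite A" "finite E" using assms(3) finite_subset[OF _ finite_ksets[of n s]] by auto
  show "(A - {S} \<union> newsets n s (A \<union> E) R) \<inter> insert S E = {}"
    using assms by (auto simp: newsets_def)
  show "(A - {S} \<union> newsets n s (A \<union> E) R) \<union> insert S E \<subseteq> ksets n s"
    using assms by (auto simp: newsets_def)
  have "(A - {S}) \<inter> newsets n s (A \<union> E) R = {}" by (auto simp: newsets_def)
  then show "card (A - {S} \<union> newsets n s (A \<union> E) R) = card A - 1 + card (newsets n s (A \<union> E) R)"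
    using assms(1) fin by (subst card_Un_disjoint) (auto simp: newsets_def)
  have "S \<notin> E" using assms by auto
  then show "card (insert S E) = Suc (card E)" using fin by simp
qed

lemma reach_empty [simp]: "reach n s {} H = {}"
  by (simp add: reach_def)

text \<open>Induction on the number \<open>k - card E\<close> of sets still to be explored. Each
  step trades the factor \<open>t\<close> of \<open>S\<close> for at most \<open>l * t\<close> on
  average. At \<open>card E = k\<close> the potential is at least 1; if \<open>A\<close> runs empty
  earlier, the event is impossible.\<close>

lemma explore_subcritical:
  assumes p: "0 \<le> p" "p \<le> 1" and t: "1 \<le> t" and l: "0 \<le> l" "l \<le> 1"
    and step: "\<And>E A S. S \<in> A \<Longrightarrow> A \<inter> E = {} \<Longrightarrow> A \<union> E \<subseteq> ksets n s \<Longrightarrow>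
       bexp (through n r E S) p (\<lambda>R. t ^ card (newsets n s (A \<union> E) R)) \<le> l * t"
    and "A \<inter> E = {}" "A \<union> E \<subseteq> ksets n s" "card E \<le> k"
  shows "bexp (unexplored n r E) p (\<lambda>H. of_bool (k \<le> card (E \<union> reach n s A H))) \<le>
    t ^ card A * l ^ (k - card E)"
  using assms(7-9)
proof (induction "k - card E" arbitrary: E A)
  case 0
  have "bexp (unexplored n r E) p (\<lambda>H. of_bool (k \<le> card (E \<union> reach n s A H))) \<le> 1"
    using p by (intro bexp_le_const) auto
  also have "\<dots> \<le> t ^ card A" using t by simp
  finally show ?case using 0 by simp
next
  case (Suc d)
  have fin: "finite A" using Suc.prems finite_subset[OF _ finite_ksets[of n s]] by auto
  show ?case
  proof (cases "A = {}")
    case True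
    have "\<not> k \<le> card E" using Suc.hyps by simp
    then show ?thesis using True t l by (simp add: bexp_const)
  next
    case False
    then obtain S where S: "S \<in> A" by auto
    note nxt = explore_next[OF S Suc.prems(1,2)]
    let ?A' = "\<lambda>R. A - {S} \<union> newsets n s (A \<union> E) R"
    have d: "d = k - card (insert S E)" "card (insert S E) \<le> k"
      using Suc.hyps(2) nxt(4) by auto
    have A: "A \<subseteq> ksets n s" using Suc.prems by auto
    have "bexp (unexplored n r E) p (\<lambda>H. of_bool (k \<le> card (E \<union> reach n s A H))) =
      bexp (through n r E S) p (\<lambda>R. bexp (unexplored n r (insert S E)) p
        (\<lambda>H. of_bool (k \<le> card (insert S E \<union> reach n s (?A' R) H))))"
      by (rule bexp_explore[OF S A])
    also have "\<dots> \<le> bexp (through n r E S) p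
        (\<lambda>R. (t ^ (card A - 1) * l ^ d) * t ^ card (newsets n s (A \<union> E) R))"
    proof (rule bexp_mono[OF p])
      fix R
      have "bexp (unexplored n r (insert S E)) p
          (\<lambda>H. of_bool (k \<le> card (insert S E \<union> reach n s (?A' R) H)))
        \<le> t ^ card (?A' R) * l ^ (k - card (insert S E))"
        by (rule Suc.hyps(1)[OF d(1) nxt(1,2) d(2)])
      then show "bexp (unexplored n r (insert S E)) p
          (\<lambda>H. of_bool (k \<le> card (insert S E \<union> reach n s (?A' R) H)))
        \<le> (t ^ (card A - 1) * l ^ d) * t ^ card (newsets n s (A \<union> E) R)"
        unfolding nxt(3) d(1)[symmetric] by (simp add: power_add mult_ac)
    qed
    also have "\<dots> \<le> (t ^ (card A - 1) * l ^ d) * (l * t)"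
      unfolding bexp_cmult using step[OF S Suc.prems(1,2)] t l by (intro mult_left_mono) auto
    also have "\<dots> = t ^ Suc (card A - 1) * l ^ Suc d" by simp
    also have "Suc (card A - 1) = card A" using False fin by (simp add: card_gt_0_iff)
    finally show ?thesis using Suc.hyps(2) by simp
  qed
qed

text \<open>Active sets are reached anyway, so the exploration may stop as soon as \<open>k\<close>
  sets are known; every state from which a step is made thus has fewer than \<open>k \<le> w\<close>
  known sets. If \<open>A\<close> runs empty, the bound is \<open>t ^ 0 = 1\<close>.\<close>

lemma explore_survival:
  assumes p: "0 \<le> p" "p \<le> 1" and t: "0 \<le> t" "t \<le> 1"
    and step: "step_le n r s p t t w" and kw: "k \<le> w"
    and "A \<inter> E = {}" "A \<union> E \<subseteq> ksets n s"
  shows "bexp (unexplored n r E) p (\<lambda>H. of_bool (card (E \<union> reach n s A H) < k)) \<le> t ^ card A"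
  using assms(7-8)
proof (induction "k - card E" arbitrary: E A rule: less_induct)
  case less
  have fin: "finite A" "finite E" using less.prems finite_subset[OF _ finite_ksets[of n s]] by auto
  have A: "A \<subseteq> ksets n s" using less.prems by auto
  consider "k \<le> card (A \<union> E)" | "A = {}" | "card (A \<union> E) < k" "A \<noteq> {}" by linarith
  then show ?case
  proof cases
    case 1
    have "k \<le> card (E \<union> reach n s A H)" for H
      using 1 card_mono[of "E \<union> reach n s A H" "A \<union> E"] reach_refl[OF A, of H] fin by force
    then have "\<not> card (E \<union> reach n s A H) < k" for H by (simp add: not_less)
    then show ?thesis using t by (simp add: bexp_const)
  next
    case 2
    then show ?thesis using p by (auto intro: bexp_le_const)
  next
    case 3
    then obtain S where S: "S \<in> A" by auto
    note nxt = explore_next[OF S less.prems]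
    let ?A' = "\<lambda>R. A - {S} \<union> newsets n s (A \<union> E) R"
    have "card E \<le> card (A \<union> E)" using fin by (intro card_mono) auto
    then have d: "k - card (insert S E) < k - card E" using 3 nxt(4) by simp
    have "bexp (unexplored n r E) p (\<lambda>H. of_bool (card (E \<union> reach n s A H) < k)) =
      bexp (through n r E S) p (\<lambda>R. bexp (unexplored n r (insert S E)) p
        (\<lambda>H. of_bool (card (insert S E \<union> reach n s (?A' R) H) < k)))"
      by (rule bexp_explore[OF S A])
    also have "\<dots> \<le> bexp (through n r E S) p
        (\<lambda>R. t ^ (card A - 1) * t ^ card (newsets n s (A \<union> E) R))"
      using less.hyps[OF d nxt(1,2)] unfolding nxt(3) power_add by (intro bexp_mono[OF p])
    also have "\<dots> \<le> t ^ (card A - 1) * t"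
      unfolding bexp_cmult using step S less.prems 3 kw t
      by (intro mult_left_mono) (auto simp: step_le_def)
    also have "\<dots> = t ^ Suc (card A - 1)" by simp
    also have "Suc (card A - 1) = card A" using 3 fin by (simp add: card_gt_0_iff)
    finally show ?thesis .
  qed
qed

text \<open>\<open>u ^ card A\<close> is a submartingale, and the subtracted supermartingale pays
  for the explorations that do not die out: at \<open>card E = k\<close> it outweighs
  \<open>u ^ card A\<close> because \<open>u \<le> t\<close>. \<open>cap\<close> does the same for
  states with more than \<open>w\<close> known sets, where \<open>step\<close> says nothing.\<close>

lemma explore_extinction:
  assumes p: "0 \<le> p" "p \<le> 1" and u: "0 \<le> u" "u \<le> t" and t: "t \<le> 1" and l: "0 \<le> l" "l \<le> 1"
    and step: "step_le n r s p t (l * t) w"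
    and stepu: "\<And>E A S. S \<in> A \<Longrightarrow> A \<inter> E = {} \<Longrightarrow> A \<union> E \<subseteq> ksets n s \<Longrightarrow>
       u \<le> bexp (through n r E S) p (\<lambda>R. u ^ card (newsets n s (A \<union> E) R))"
    and cap: "\<And>a. w < a + k \<Longrightarrow> u ^ a \<le> t ^ a * l ^ k"
    and "A \<inter> E = {}" "A \<union> E \<subseteq> ksets n s" "card E \<le> k"
  shows "u ^ card A - t ^ card A * l ^ (k - card E) \<le>
    bexp (unexplored n r E) p (\<lambda>H. of_bool (card (E \<union> reach n s A H) < k))"
  using assms(11-13)
proof (induction "k - card E" arbitrary: E A)
  case 0
  have "u ^ card A - t ^ card A * l ^ (k - card E) \<le> 0"
    using 0 u by (simp add: power_mono)
  also have "\<dots> \<le> bexp (unexplored n r E) p (\<lambda>H. of_bool (card (E \<union> reach n s A H) < k))"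
    using p by (intro bexp_nonneg) auto
  finally show ?case .
next
  case (Suc d)
  have t0: "0 \<le> t" using u by simp
  have fin: "finite A" "finite E" using Suc.prems finite_subset[OF _ finite_ksets[of n s]] by auto
  have A: "A \<subseteq> ksets n s" using Suc.prems by auto
  consider "w < card (A \<union> E)" | "A = {}" | "card (A \<union> E) \<le> w" "A \<noteq> {}" by linarith
  then show ?case
  proof cases
    case 1
    have "card (A \<union> E) = card A + card E" using fin Suc.prems by (intro card_Un_disjoint) auto
    then have "u ^ card A \<le> t ^ card A * l ^ k" using 1 Suc.prems by (intro cap) simp
    also have "\<dots> \<le> t ^ card A * l ^ (k - card E)"
      using l t0 by (intro mult_left_mono power_decreasing) auto
    finally have "u ^ card A - t ^ card A * l ^ (k - card E) \<le> 0" by simp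
    also have "\<dots> \<le> bexp (unexplored n r E) p (\<lambda>H. of_bool (card (E \<union> reach n s A H) < k))"
      using p by (intro bexp_nonneg) auto
    finally show ?thesis .
  next
    case 2
    have "card E < k" using Suc.hyps by simp
    then show ?thesis using 2 l by (simp add: bexp_const)
  next
    case 3
    then obtain S where S: "S \<in> A" by auto
    note nxt = explore_next[OF S Suc.prems(1,2)]
    let ?A' = "\<lambda>R. A - {S} \<union> newsets n s (A \<union> E) R"
    let ?N = "\<lambda>R. card (newsets n s (A \<union> E) R)"
    have d: "d = k - card (insert S E)" "card (insert S E) \<le> k"
      using Suc.hyps(2) nxt(4) by auto
    have cA: "Suc (card A - 1) = card A" using 3 fin by (simp add: card_gt_0_iff)
    have "u ^ card A - t ^ card A * l ^ (k - card E) =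
       u ^ (card A - 1) * u - (t ^ (card A - 1) * l ^ d) * (l * t)"
      using Suc.hyps(2) by (subst (1 2) cA[symmetric]) (simp flip: Suc.hyps(2))
    also have "\<dots> \<le> u ^ (card A - 1) * bexp (through n r E S) p (\<lambda>R. u ^ ?N R) -
       (t ^ (card A - 1) * l ^ d) * bexp (through n r E S) p (\<lambda>R. t ^ ?N R)"
      using stepu[OF S Suc.prems(1,2)] step S Suc.prems 3 t0 l u
      by (intro diff_mono mult_left_mono) (auto simp: step_le_def)
    also have "\<dots> = bexp (through n r E S) p
        (\<lambda>R. u ^ (card A - 1) * u ^ ?N R - (t ^ (card A - 1) * l ^ d) * t ^ ?N R)"
      by (simp only: bexp_diff bexp_cmult)
    also have "\<dots> \<le> bexp (through n r E S) p (\<lambda>R. bexp (unexplored n r (insert S E)) p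
        (\<lambda>H. of_bool (card (insert S E \<union> reach n s (?A' R) H) < k)))"
    proof (rule bexp_mono[OF p])
      fix R
      have "u ^ card (?A' R) - t ^ card (?A' R) * l ^ (k - card (insert S E)) \<le>
        bexp (unexplored n r (insert S E)) p
          (\<lambda>H. of_bool (card (insert S E \<union> reach n s (?A' R) H) < k))"
        by (rule Suc.hyps(1)[OF d(1) nxt(1,2) d(2)])
      then show "u ^ (card A - 1) * u ^ ?N R - (t ^ (card A - 1) * l ^ d) * t ^ ?N R \<le>
        bexp (unexplored n r (insert S E)) p
          (\<lambda>H. of_bool (card (insert S E \<union> reach n s (?A' R) H) < k))"
        unfolding nxt(3) d(1)[symmetric] by (simp add: power_add mult_ac)
    qed
    also have "\<dots> = bexp (unexplored n r E) p (\<lambda>H. of_bool (card (E \<union> reach n s A H) < k))"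
      by (rule bexp_explore[OF S A, symmetric])
    finally show ?thesis .
  qed
qed

lemma reach_UN: "reach n s A H = (\<Union>S\<in>A. reach n s {S} H)"
  by (auto simp: reach_def)

text \<open>\<open>H0 \<union> H1\<close> is explored while few active sets are around; once there are many
  (or \<open>k\<close> sets have been explored), the active sets are explored in the unrevealed part of \<open>H0\<close> alone.\<close>

lemma explore_two_layers:
  assumes p0: "0 \<le> p0" "p0 \<le> 1" and p1: "0 \<le> p1" "p1 \<le> 1"
    and t: "0 \<le> t" "t \<le> 1" and l: "0 \<le> l" "l \<le> 1"
    and step0: "step_le n r s p0 t t w" and step: "step_le n r s (p0 + p1 - p0 * p1) t (l * t) w"
    and kw: "k + a * k' < w" "a + k \<le> w"
    and "A \<inter> E = {}" "A \<union> E \<subseteq> ksets n s" "card E \<le> k"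
  shows "bexp (unexplored n r E) p0 (\<lambda>H0. bexp (unexplored n r E) p1 (\<lambda>H1.
      of_bool (k \<le> card (E \<union> reach n s A (H0 \<union> H1)) \<and>
        (\<forall>S\<in>reach n s A (H0 \<union> H1). card (reach n s {S} H0) < k')))) \<le>
    t ^ card A * l ^ (k - card E) + t ^ a"
  using assms(13-15)
proof (induction "k - card E" arbitrary: E A rule: less_induct)
  case less
  let ?bad = "\<lambda>E A H0 H1. k \<le> card (E \<union> reach n s A (H0 \<union> H1)) \<and>
        (\<forall>S\<in>reach n s A (H0 \<union> H1). card (reach n s {S} H0) < k')"
  have fin: "finite A" "finite E" using less.prems finite_subset[OF _ finite_ksets[of n s]] by auto
  have A: "A \<subseteq> ksets n s" using less.prems by auto
  have pos: "0 \<le> t ^ card A * l ^ (k - card E)" using t l by simp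
  \<comment> \<open>In the bad event every active set lies in an \<open>H0\<close>-component below
    \<open>k'\<close>, so \<open>E\<close> and the sets reached from \<open>B\<close> in
    \<open>H0\<close> number at most \<open>k + a * k'\<close> in all. By
    \<open>explore_survival\<close> in \<open>H0\<close> alone this has probability at most
    \<open>t ^ card B\<close>.\<close>
  have sub: "bexp (unexplored n r E) p0 (\<lambda>H0. bexp (unexplored n r E) p1 (\<lambda>H1.
      of_bool (?bad E A H0 H1))) \<le> t ^ card B" if B: "B \<subseteq> A" "card B \<le> a" for B
  proof -
    have fB: "finite B" using B fin finite_subset by auto
    have "card (E \<union> reach n s B H0) < Suc (k + a * k')" if "?bad E A H0 H1" for H0 H1
    proof -
      have "card (reach n s B H0) \<le> (\<Sum>S\<in>B. card (reach n s {S} H0))"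
        by (subst reach_UN) (rule card_UN_le[OF fB])
      also have "\<dots> \<le> (\<Sum>S\<in>B. k')"
      proof (rule sum_mono)
        fix S assume "S \<in> B"
        then have "S \<in> reach n s A (H0 \<union> H1)" using B reach_refl[OF A] by auto
        then show "card (reach n s {S} H0) \<le> k'" using that by auto
      qed
      also have "\<dots> \<le> a * k'" using B by simp
      finally show ?thesis using card_Un_le[of E "reach n s B H0"] less.prems(3) by linarith
    qed
    then have "bexp (unexplored n r E) p0 (\<lambda>H0. bexp (unexplored n r E) p1 (\<lambda>H1.
      of_bool (?bad E A H0 H1))) \<le>
      bexp (unexplored n r E) p0 (\<lambda>H0. of_bool (card (E \<union> reach n s B H0) < Suc (k + a * k')))"
      by (intro bexp_mono[OF p0] bexp_le_const[OF _ p1]) (auto split: split_of_bool)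
    also have "\<dots> \<le> t ^ card B"
      using less.prems B kw by (intro explore_survival[OF p0 t step0]) auto
    finally show ?thesis .
  qed
  consider "a \<le> card A" | "card A < a" "card E = k" | "card E < k" "A = {}"
    | "card E < k" "card A < a" "A \<noteq> {}" using less.prems(3) by linarith
  then show ?case
  proof cases
    case 1
    then obtain B where "B \<subseteq> A" "card B = a" by (meson obtain_subset_with_card_n)
    then show ?thesis using sub[of B] pos by auto
  next
    case 2
    then show ?thesis using sub[of A] t by (simp add: add_increasing2)
  next
    case 3
    then have "\<not> k \<le> card (E \<union> reach n s A H)" for H by simp
    then show ?thesis using pos t by (simp add: bexp_const)
  next
    case 4
    then obtain S where S: "S \<in> A" by auto
    let ?p = "p0 + p1 - p0 * p1"
    have p: "0 \<le> ?p" "?p \<le> 1"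
    proof -
      have 1: "?p = p0 + p1 * (1 - p0)" and 2: "?p = 1 - (1 - p0) * (1 - p1)"
        by (simp_all add: algebra_simps)
      show "0 \<le> ?p" unfolding 1 using p0 p1 by (intro add_nonneg_nonneg mult_nonneg_nonneg) auto
      show "?p \<le> 1" unfolding 2 using p0 p1 by simp
    qed
    note nxt = explore_next[OF S less.prems(1,2)]
    let ?X = "through n r E S" and ?Y = "unexplored n r (insert S E)"
    let ?A' = "\<lambda>R. A - {S} \<union> newsets n s (A \<union> E) R"
    let ?N = "\<lambda>R. card (newsets n s (A \<union> E) R)"
    let ?d = "k - card (insert S E)"
    have d: "?d < k - card E" "card (insert S E) \<le> k" "Suc ?d = k - card E"
      using 4 nxt(4) by auto
    \<comment> \<open>The bad event passes to the next state: the reach only shrinks, and dropping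
      the revealed \<open>R0\<close> only makes \<open>H0\<close>-components smaller.\<close>
    have bad: "?bad (insert S E) (?A' (R0 \<union> R1)) H0 H1" 
      if "?bad E A (R0 \<union> H0) (R1 \<union> H1)" "R0 \<subseteq> ?X" "R1 \<subseteq> ?X" "H0 \<subseteq> ?Y" "H1 \<subseteq> ?Y" for R0 R1 H0 H1
    proof -
      have eq: "(R0 \<union> H0) \<union> (R1 \<union> H1) = (R0 \<union> R1) \<union> (H0 \<union> H1)" by auto
      have 1: "E \<union> reach n s A ((R0 \<union> R1) \<union> (H0 \<union> H1)) =
          insert S E \<union> reach n s (?A' (R0 \<union> R1)) (H0 \<union> H1)"
        using that by (intro card_explore_eq[OF S A]) auto
      have 2: "reach n s (?A' (R0 \<union> R1)) (H0 \<union> H1) \<subseteq> reach n s A ((R0 \<union> R1) \<union> (H0 \<union> H1))"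
        using that by (intro reach_explore_supset[OF S A]) auto
      have 3: "card (reach n s {S'} H0) < k'"
        if S': "S' \<in> reach n s (?A' (R0 \<union> R1)) (H0 \<union> H1)" for S'
      proof -
        have "S' \<in> reach n s A ((R0 \<union> H0) \<union> (R1 \<union> H1))" using S' 2 eq by auto
        then have "card (reach n s {S'} (R0 \<union> H0)) < k'" using \<open>?bad E A (R0 \<union> H0) (R1 \<union> H1)\<close> by blast
        moreover have "card (reach n s {S'} H0) \<le> card (reach n s {S'} (R0 \<union> H0))"
          by (intro card_mono finite_reach reach_mono) auto
        ultimately show ?thesis by linarith
      qed
      show ?thesis using that(1) 1 3 by (simp only: eq) blast
    qed
    have "bexp (unexplored n r E) p0 (\<lambda>H0. bexp (unexplored n r E) p1 (\<lambda>H1. of_bool (?bad E A H0 H1))) =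
      bexp ?X p0 (\<lambda>R0. bexp ?Y p0 (\<lambda>H0. bexp ?X p1 (\<lambda>R1. bexp ?Y p1 (\<lambda>H1.
        of_bool (?bad E A (R0 \<union> H0) (R1 \<union> H1))))))"
      unfolding bexp_unexplored[of n r E _ _ S] ..
    also have "\<dots> \<le> bexp ?X p0 (\<lambda>R0. bexp ?Y p0 (\<lambda>H0. bexp ?X p1 (\<lambda>R1. bexp ?Y p1 (\<lambda>H1.
        of_bool (?bad (insert S E) (?A' (R0 \<union> R1)) H0 H1)))))"
      using bad by (intro bexp_mono p0 p1) (auto split: split_of_bool)
    \<comment> \<open>Exchanging the order reveals both layers through \<open>S\<close> together;
      their union is \<open>?p\<close>-random, which is the density that \<open>step\<close> speaks
      of.\<close>
    also have "\<dots> = bexp ?X p0 (\<lambda>R0. bexp ?X p1 (\<lambda>R1. bexp ?Y p0 (\<lambda>H0. bexp ?Y p1 (\<lambda>H1.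
        of_bool (?bad (insert S E) (?A' (R0 \<union> R1)) H0 H1)))))"
      by (subst bexp_swap) (rule refl)
    also have "\<dots> \<le> bexp ?X p0 (\<lambda>R0. bexp ?X p1 (\<lambda>R1.
        (t ^ (card A - 1) * l ^ ?d) * t ^ ?N (R0 \<union> R1) + t ^ a))"
    proof (intro bexp_mono p0 p1)
      fix R0 R1
      have "bexp ?Y p0 (\<lambda>H0. bexp ?Y p1 (\<lambda>H1. of_bool (?bad (insert S E) (?A' (R0 \<union> R1)) H0 H1)))
        \<le> t ^ card (?A' (R0 \<union> R1)) * l ^ ?d + t ^ a"
        by (rule less.hyps[OF d(1) nxt(1,2) d(2)])
      then show "bexp ?Y p0 (\<lambda>H0. bexp ?Y p1 (\<lambda>H1. of_bool (?bad (insert S E) (?A' (R0 \<union> R1)) H0 H1)))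
        \<le> (t ^ (card A - 1) * l ^ ?d) * t ^ ?N (R0 \<union> R1) + t ^ a"
        unfolding nxt(3) by (simp add: power_add mult_ac)
    qed
    also have "\<dots> = (t ^ (card A - 1) * l ^ ?d) * bexp ?X ?p (\<lambda>R. t ^ ?N R) + t ^ a"
      unfolding bexp_add bexp_cmult by (simp add: bexp_const bexp_union[of ?X p0 p1 "\<lambda>R. t ^ ?N R"])
    also have "\<dots> \<le> (t ^ (card A - 1) * l ^ ?d) * (l * t) + t ^ a"
    proof -
      have "card (A \<union> E) \<le> w" using card_Un_le[of A E] 4 kw by linarith
      then have "bexp ?X ?p (\<lambda>R. t ^ ?N R) \<le> l * t"
        using step S less.prems by (auto simp: step_le_def)
      then show ?thesis using t l by (intro add_mono mult_left_mono) auto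
    qed
    also have "\<dots> = t ^ Suc (card A - 1) * l ^ Suc ?d + t ^ a" by simp
    also have "Suc (card A - 1) = card A" using 4 fin by (simp add: card_gt_0_iff)
    finally show ?thesis unfolding d(3) .
  qed
qed

section \<open>Sprinkling\<close>

lemma tendsto_choose_ratio:
  "(\<lambda>n. real ((n - a) choose k) / real n ^ k) \<longlonglongrightarrow> 1 / fact k"
proof -
  have "(\<lambda>n. (\<Prod>i<k. (real n - real a - real i) / real n) / fact k) \<longlonglongrightarrow> (\<Prod>i<k. 1) / fact k"
    by (intro tendsto_intros) (auto, real_asymp)
  moreover have "\<forall>\<^sub>F n in sequentially. (\<Prod>i<k. (real n - real a - real i) / real n) / fact k =
      real ((n - a) choose k) / real n ^ k"
    using eventually_ge_at_top[of a]
  proof eventually_elim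
    case (elim n)
    then have "real ((n - a) choose k) = (\<Prod>i<k. real n - real a - real i) / fact k"
      by (simp add: binomial_gbinomial gbinomial_prod_rev atLeast0LessThan of_nat_diff)
    then show ?case by (simp add: prod_dividef)
  qed
  ultimately show ?thesis by (simp add: tendsto_cong)
qed

lemma tendsto_choose_ratio_1:
  "(\<lambda>n. real ((n - a) choose k) / real (n choose k)) \<longlonglongrightarrow> 1"
proof -
  have "(\<lambda>n. (real ((n - a) choose k) / real n ^ k) / (real ((n - 0) choose k) / real n ^ k))
      \<longlonglongrightarrow> (1 / fact k) / (1 / fact k)"
    by (intro tendsto_divide tendsto_choose_ratio) auto
  then have *: "(\<lambda>n. (real ((n - a) choose k) / real n ^ k) / (real (n choose k) / real n ^ k)) \<longlonglongrightarrow> 1"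
    by simp
  show ?thesis
    by (rule Lim_transform_eventually[OF *])
      (use eventually_gt_at_top[of 0] in eventually_elim, simp)
qed

lemma one_minus_exp_ge:
  assumes "0 \<le> (x::real)"
  shows "x / (1 + x) \<le> 1 - exp (- x)"
proof -
  have "exp (- x) \<le> 1 / (1 + x)"
    using assms exp_ge_add_one_self[of x] by (simp add: exp_minus field_simps)
  then show ?thesis using assms by (simp add: field_simps)
qed

text \<open>\<open>avg w S\<close> is the mean of \<open>w\<close> after one step from \<open>S\<close> to a uniform \<open>r\<close>-set containing it
  and on to a uniform \<open>s\<close>-subset of that \<open>r\<close>-set.\<close>

definition avg :: "nat \<Rightarrow> nat \<Rightarrow> nat \<Rightarrow> (nat set \<Rightarrow> real) \<Rightarrow> nat set \<Rightarrow> real" where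
  "avg n r s w S = (\<Sum>F\<in>{F\<in>ksets n r. S \<subseteq> F}. \<Sum>S'\<in>{S'\<in>ksets n s. S' \<subseteq> F}. w S') /
     (real (r choose s) * real ((n - s) choose (r - s)))"

definition neighbours :: "nat \<Rightarrow> nat \<Rightarrow> nat set set \<Rightarrow> nat set set \<Rightarrow> nat set set" where
  "neighbours n s A R = {S'\<in>ksets n s. \<exists>S\<in>A. \<exists>F\<in>R. S \<subseteq> F \<and> S' \<subseteq> F}"

lemma neighbours_subset: "neighbours n s A R \<subseteq> ksets n s"
  by (auto simp: neighbours_def)

lemma card_subsets_in:
  assumes "F \<in> ksets n r"
  shows "card {S'\<in>ksets n s. S' \<subseteq> F} = r choose s"
proof -
  have "{S'\<in>ksets n s. S' \<subseteq> F} = {S'. S' \<subseteq> F \<and> card S' = s}"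
    using assms by (auto simp: ksets_def)
  then show ?thesis
    using assms finite_ksets_elem[OF assms] n_subsets[of F s] by (auto simp: ksets_def)
qed

text \<open>The Laplace transform of an indicator. The constants come from
  \<open>1 - exp (- x) \<ge> x / 2\<close> on the unit interval and from
  \<open>1 - exp (- y) \<ge> y / (1 + y)\<close> with \<open>y = p * card C \<le> k\<close>.\<close>

lemma bexp_exp_nonempty:
  assumes fin: "finite C" and p: "0 \<le> p" "p \<le> 1" and x: "0 \<le> x" "x \<le> 1" and k: "p * real (card C) \<le> k"
  shows "bexp C p (\<lambda>R. exp (- (x * of_bool (R \<noteq> {})))) \<le> exp (- (x / 2 * (p * real (card C) / (1 + k))))"
proof -
  let ?a = "real (card C)"
  have k0: "0 \<le> k" using p k by (meson mult_nonneg_nonneg of_nat_0_le_iff order_trans)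
  have "bexp C p (\<lambda>R. exp (- (x * of_bool (R \<noteq> {})))) =
    bexp C p (\<lambda>R. exp (- x) + (1 - exp (- x)) * 0 ^ card R)"
  proof (rule bexp_cong[OF refl])
    fix R assume "R \<subseteq> C"
    then have "finite R" using fin finite_subset by auto
    then show "exp (- (x * of_bool (R \<noteq> {}))) = exp (- x) + (1 - exp (- x)) * 0 ^ card R"
      by (cases "R = {}") auto
  qed
  also have "\<dots> = exp (- x) + (1 - exp (- x)) * (1 - p) ^ card C"
    using fin by (simp add: bexp_add bexp_cmult bexp_const bexp_power)
  also have "\<dots> = 1 - (1 - exp (- x)) * (1 - (1 - p) ^ card C)"
    by (simp add: algebra_simps)
  also have "\<dots> \<le> exp (- ((1 - exp (- x)) * (1 - (1 - p) ^ card C)))"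
    using exp_ge_add_one_self[of "- ((1 - exp (- x)) * (1 - (1 - p) ^ card C))"] by simp
  also have "\<dots> \<le> exp (- (x / 2 * (p * ?a / (1 + k))))"
  proof -
    have "x / 2 \<le> x / (1 + x)" using x by (intro divide_left_mono) auto
    then have 1: "x / 2 \<le> 1 - exp (- x)" using one_minus_exp_ge[OF x(1)] by linarith
    have "(1 - p) ^ card C \<le> exp (- p) ^ card C"
      using p exp_ge_add_one_self[of "- p"] by (intro power_mono) auto
    also have "\<dots> = exp (- (p * ?a))" by (simp add: exp_of_nat_mult[symmetric] mult.commute)
    finally have "1 - exp (- (p * ?a)) \<le> 1 - (1 - p) ^ card C" by simp
    moreover have "p * ?a / (1 + p * ?a) \<le> 1 - exp (- (p * ?a))"
      using p by (intro one_minus_exp_ge) auto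
    moreover have "p * ?a / (1 + k) \<le> p * ?a / (1 + p * ?a)"
      using p k k0 by (intro divide_left_mono mult_pos_pos add_pos_nonneg) auto
    ultimately have 2: "p * ?a / (1 + k) \<le> 1 - (1 - p) ^ card C" by linarith
    have "x / 2 * (p * ?a / (1 + k)) \<le> (1 - exp (- x)) * (1 - (1 - p) ^ card C)"
      using x p k0 1 2 by (intro mult_mono) auto
    then show ?thesis by simp
  qed
  finally show ?thesis .
qed

text \<open>To make the contributions of different \<open>s\<close>-sets independent, every \<open>r\<close>-set \<open>F\<close> is
  charged to a single \<open>s\<close>-subset \<open>top F\<close> of maximal weight.\<close>

lemma bexp_neighbours_le:
  assumes sr: "s \<le> r" and D: "D = (n - s) choose (r - s)" "0 < D" and K: "K = r choose s"
    and p: "0 \<le> p" "p \<le> 1" and k: "p * real D = k" and th: "0 \<le> th" "th \<le> 1"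
    and w: "\<And>S. S \<in> ksets n s \<Longrightarrow> 0 \<le> w S \<and> w S \<le> 1" and A: "A \<subseteq> ksets n s"
  shows "bexp (ksets n r) p (\<lambda>R. exp (- (th * (\<Sum>S\<in>neighbours n s A R. w S)))) \<le>
    exp (- (th * (k / (2 * real K * (1 + k))) * (\<Sum>S\<in>A. avg n r s w S)))"
proof -
  let ?X = "ksets n r" and ?N = "ksets n s"
  let ?sub = "\<lambda>F. {S'\<in>?N. S' \<subseteq> F}"
  have K0: "0 < K" using K sr by simp
  have k0: "0 \<le> k" using p k by auto
  have ex: "\<exists>S. S \<in> ?sub F \<and> (\<forall>S'\<in>?sub F. w S' \<le> w S)" if "F \<in> ?X" for F
  proof -
    have "card (?sub F) > 0" using card_subsets_in[OF that] K0 K by auto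
    then have ne: "?sub F \<noteq> {}" "finite (?sub F)" by (auto simp: card_gt_0_iff)
    then have "Max (w ` ?sub F) \<in> w ` ?sub F" by (intro Max_in) auto
    then obtain S where S: "S \<in> ?sub F" "w S = Max (w ` ?sub F)" by auto
    have "\<forall>S'\<in>?sub F. w S' \<le> w S"
      unfolding S(2) using ne(2) by (intro ballI Max_ge) auto
    then show "\<exists>S. S \<in> ?sub F \<and> (\<forall>S'\<in>?sub F. w S' \<le> w S)" using S(1) by (intro exI conjI)
  qed
  define top where "top = (\<lambda>F. SOME S. S \<in> ?sub F \<and> (\<forall>S'\<in>?sub F. w S' \<le> w S))"
  have top_props: "top F \<in> ?sub F \<and> (\<forall>S'\<in>?sub F. w S' \<le> w (top F))" if "F \<in> ?X" for F
    unfolding top_def by (rule someI_ex[OF ex[OF that]])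
  have top: "top F \<in> ?sub F" if "F \<in> ?X" for F
    using top_props[OF that] by (rule conjunct1)
  have top_max: "w S' \<le> w (top F)" if "F \<in> ?X" "S' \<in> ?sub F" for F S'
    using conjunct2[OF top_props[OF that(1)]] that(2) by (rule bspec)
  define XA where "XA = {F\<in>?X. \<exists>S\<in>A. S \<subseteq> F}"
  have fXA: "finite XA" by (simp add: XA_def)
  \<comment> \<open>The blocks \<open>C S'\<close> are disjoint, whence independence; and if
    \<open>R\<close> meets \<open>C S'\<close>, then \<open>S'\<close> is a neighbour of
    \<open>A\<close>.\<close>
  define C where "C = (\<lambda>S'. {F\<in>XA. top F = S'})"
  have cC: "p * real (card (C S')) \<le> k" if "S' \<in> ?N" for S'
  proof -
    have "card (C S') \<le> card {F\<in>?X. S' \<subseteq> F}"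
      using top by (intro card_mono) (auto simp: C_def XA_def)
    also have "\<dots> = D" using that D sr by (subst card_ksets_superset) (auto simp: ksets_def)
    finally show ?thesis using p k by (metis mult_left_mono of_nat_le_iff)
  qed
  have "bexp ?X p (\<lambda>R. exp (- (th * (\<Sum>S\<in>neighbours n s A R. w S)))) \<le>
    bexp ?X p (\<lambda>R. \<Prod>S'\<in>?N. exp (- ((th * w S') * of_bool (R \<inter> C S' \<noteq> {}))))"
  proof (rule bexp_mono[OF p])
    fix R assume R: "R \<subseteq> ?X"
    have "(\<Sum>S'\<in>?N. w S' * of_bool (R \<inter> C S' \<noteq> {})) = (\<Sum>S'\<in>{S'\<in>?N. R \<inter> C S' \<noteq> {}}. w S')"
      by (simp add: sum.inter_filter if_distrib[of "\<lambda>x. _ * x"] of_bool_def cong: if_cong)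
    also have "\<dots> \<le> (\<Sum>S\<in>neighbours n s A R. w S)"
    proof (rule sum_mono2)
      show "finite (neighbours n s A R)" using neighbours_subset finite_ksets by (rule finite_subset)
      show "{S'\<in>?N. R \<inter> C S' \<noteq> {}} \<subseteq> neighbours n s A R"
      proof
        fix S' assume S': "S' \<in> {S'\<in>?N. R \<inter> C S' \<noteq> {}}"
        then obtain F where F: "F \<in> R" "F \<in> XA" "top F = S'" by (auto simp: C_def)
        then have "F \<in> ?X" by (auto simp: XA_def)
        then have "S' \<subseteq> F" using top[of F] F by auto
        then show "S' \<in> neighbours n s A R" using S' F by (auto simp: neighbours_def XA_def)
      qed
    qed (use w in \<open>auto simp: neighbours_def\<close>)
    finally have "th * (\<Sum>S'\<in>?N. w S' * of_bool (R \<inter> C S' \<noteq> {})) \<le> th * (\<Sum>S\<in>neighbours n s A R. w S)"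
      using th by (intro mult_left_mono)
    moreover have "(\<Prod>S'\<in>?N. exp (- ((th * w S') * of_bool (R \<inter> C S' \<noteq> {})))) =
        exp (- (th * (\<Sum>S'\<in>?N. w S' * of_bool (R \<inter> C S' \<noteq> {}))))"
      by (simp only: exp_sum[symmetric] finite_ksets sum_negf sum_distrib_left mult.assoc)
    ultimately show "exp (- (th * (\<Sum>S\<in>neighbours n s A R. w S))) \<le>
      (\<Prod>S'\<in>?N. exp (- ((th * w S') * of_bool (R \<inter> C S' \<noteq> {}))))"
      by simp
  qed
  also have "\<dots> = (\<Prod>S'\<in>?N. bexp (C S') p (\<lambda>R. exp (- ((th * w S') * of_bool (R \<noteq> {})))))"
    by (rule bexp_prod) (auto simp: C_def XA_def)
  also have "\<dots> \<le> (\<Prod>S'\<in>?N. exp (- ((th * w S') / 2 * (p * real (card (C S')) / (1 + k)))))"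
  proof (rule prod_mono)
    fix S' assume S': "S' \<in> ?N"
    have "finite (C S')" using fXA by (simp add: C_def)
    then show "0 \<le> bexp (C S') p (\<lambda>R. exp (- ((th * w S') * of_bool (R \<noteq> {})))) \<and>
       bexp (C S') p (\<lambda>R. exp (- ((th * w S') * of_bool (R \<noteq> {})))) \<le>
       exp (- ((th * w S') / 2 * (p * real (card (C S')) / (1 + k))))"
      using p th w[OF S'] cC[OF S']
      by (intro conjI bexp_nonneg bexp_exp_nonempty) (auto intro: mult_le_one)
  qed
  also have "\<dots> = exp (- (th * p / (2 * (1 + k)) * (\<Sum>S'\<in>?N. w S' * real (card (C S')))))"
    by (simp add: exp_sum[symmetric] sum_negf sum_distrib_left sum_divide_distrib mult_ac)
  also have "\<dots> \<le> exp (- (th * (k / (2 * real K * (1 + k))) * (\<Sum>S\<in>A. avg n r s w S)))"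
  proof -
    have fA: "finite A" using A finite_subset finite_ksets by blast
    have "(\<Sum>S'\<in>?N. w S' * real (card (C S'))) = (\<Sum>S'\<in>?N. \<Sum>F\<in>{F\<in>XA. top F = S'}. w (top F))"
      by (simp add: C_def mult.commute)
    also have "\<dots> = (\<Sum>F\<in>XA. w (top F))"
      using top fXA by (intro sum.group) (auto simp: XA_def)
    finally have 1: "(\<Sum>S'\<in>?N. w S' * real (card (C S'))) = (\<Sum>F\<in>XA. w (top F))" .
    \<comment> \<open>Two factors \<open>K\<close> are lost, one for replacing all subsets of
      \<open>F\<close> by \<open>top F\<close>, one for the sets of \<open>A\<close> inside the same
      \<open>F\<close>. One of them cancels against the normalization \<open>K * D\<close> of
      \<open>avg\<close>.\<close>
    have "(\<Sum>S\<in>A. avg n r s w S) * (real K * real D) =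
       (\<Sum>S\<in>A. \<Sum>F\<in>{F\<in>?X. S \<subseteq> F}. \<Sum>S'\<in>?sub F. w S')"
      unfolding avg_def sum_divide_distrib[symmetric] using K0 D K by simp
    also have "\<dots> \<le> (\<Sum>S\<in>A. \<Sum>F\<in>{F\<in>?X. S \<subseteq> F}. real K * w (top F))"
    proof (intro sum_mono)
      fix S F assume F: "F \<in> {F\<in>?X. S \<subseteq> F}"
      have "(\<Sum>S'\<in>?sub F. w S') \<le> (\<Sum>S'\<in>?sub F. w (top F))"
        using F top_max by (intro sum_mono) auto
      then show "(\<Sum>S'\<in>?sub F. w S') \<le> real K * w (top F)"
        using F card_subsets_in[of F n r s] by (simp add: K)
    qed
    also have "\<dots> = (\<Sum>S\<in>A. \<Sum>F\<in>{F\<in>XA. S \<subseteq> F}. real K * w (top F))"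
      by (intro sum.cong) (auto simp: XA_def)
    also have "\<dots> = (\<Sum>F\<in>XA. \<Sum>S\<in>{S\<in>A. S \<subseteq> F}. real K * w (top F))"
      using fA fXA by (rule sum.swap_restrict)
    also have "\<dots> \<le> (\<Sum>F\<in>XA. real K * (real K * w (top F)))"
    proof (rule sum_mono)
      fix F assume F: "F \<in> XA"
      then have FX: "F \<in> ?X" by (auto simp: XA_def)
      have "card {S\<in>A. S \<subseteq> F} \<le> card (?sub F)" using A by (intro card_mono) auto
      also have "\<dots> = K" using FX K by (simp add: card_subsets_in)
      finally have "real (card {S\<in>A. S \<subseteq> F}) * (real K * w (top F)) \<le> real K * (real K * w (top F))"
        using w top[OF FX] by (intro mult_right_mono) auto
      then show "(\<Sum>S\<in>{S\<in>A. S \<subseteq> F}. real K * w (top F)) \<le> real K * (real K * w (top F))" by simp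
    qed
    also have "\<dots> = real K * real K * (\<Sum>F\<in>XA. w (top F))"
      by (simp add: sum_distrib_left mult_ac)
    finally have "(\<Sum>S\<in>A. avg n r s w S) * real D * real K \<le> (real K * (\<Sum>F\<in>XA. w (top F))) * real K"
      by (simp add: mult_ac)
    then have 2: "(\<Sum>S\<in>A. avg n r s w S) * real D \<le> real K * (\<Sum>F\<in>XA. w (top F))"
      using K0 mult_right_le_imp_le by (metis of_nat_0_less_iff)
    have "th * (k / (2 * real K * (1 + k))) * (\<Sum>S\<in>A. avg n r s w S) =
       (th * p / (2 * real K * (1 + k))) * ((\<Sum>S\<in>A. avg n r s w S) * real D)"
      by (simp add: k[symmetric] mult_ac)
    also have "\<dots> \<le> (th * p / (2 * real K * (1 + k))) * (real K * (\<Sum>F\<in>XA. w (top F)))"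
      using th p k0 2 by (intro mult_left_mono) auto
    also have "\<dots> = th * p / (2 * (1 + k)) * (\<Sum>F\<in>XA. w (top F))"
      using K0 by simp
    finally show ?thesis unfolding 1 by simp
  qed
  finally show ?thesis .
qed

text \<open>The probability that \<open>j\<close> steps of the random walk behind \<open>avg\<close>
  lead from \<open>S\<close> into \<open>B\<close>.\<close>

primrec hit :: "nat \<Rightarrow> nat \<Rightarrow> nat \<Rightarrow> nat set set \<Rightarrow> nat \<Rightarrow> nat set \<Rightarrow> real" where
  "hit n r s B 0 = (\<lambda>S. of_bool (S \<in> B))"
| "hit n r s B (Suc j) = avg n r s (hit n r s B j)"

lemma hit_bounds:
  assumes "s \<le> r" "S \<in> ksets n s"
  shows "0 \<le> hit n r s B j S \<and> hit n r s B j S \<le> 1"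
  using assms(2)
proof (induction j arbitrary: S)
  case (Suc j)
  have nn: "0 \<le> (\<Sum>F\<in>{F\<in>ksets n r. S \<subseteq> F}. \<Sum>S'\<in>{S'\<in>ksets n s. S' \<subseteq> F}. hit n r s B j S')"
    using Suc.IH by (intro sum_nonneg) auto
  have "(\<Sum>F\<in>{F\<in>ksets n r. S \<subseteq> F}. \<Sum>S'\<in>{S'\<in>ksets n s. S' \<subseteq> F}. hit n r s B j S') \<le>
    (\<Sum>F\<in>{F\<in>ksets n r. S \<subseteq> F}. \<Sum>S'\<in>{S'\<in>ksets n s. S' \<subseteq> F}. 1)"
    using Suc.IH by (intro sum_mono) auto
  also have "\<dots> = real (r choose s) * real (card {F\<in>ksets n r. S \<subseteq> F})"
  proof -
    have "(\<Sum>F\<in>{F\<in>ksets n r. S \<subseteq> F}. \<Sum>S'\<in>{S'\<in>ksets n s. S' \<subseteq> F}. 1) =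
        (\<Sum>F\<in>{F\<in>ksets n r. S \<subseteq> F}. real (r choose s))"
      by (intro sum.cong refl) (simp add: card_subsets_in)
    then show ?thesis by simp
  qed
  also have "card {F\<in>ksets n r. S \<subseteq> F} = (n - s) choose (r - s)"
    using assms(1) Suc.prems by (subst card_ksets_superset) (auto simp: ksets_def)
  finally have le: "(\<Sum>F\<in>{F\<in>ksets n r. S \<subseteq> F}. \<Sum>S'\<in>{S'\<in>ksets n s. S' \<subseteq> F}. hit n r s B j S') \<le>
    real (r choose s) * real ((n - s) choose (r - s))" .
  \<comment> \<open>For \<open>n < r\<close> the denominator vanishes and division returns
    0.\<close>
  have "x / y \<le> 1" if "x \<le> y" "0 \<le> x" for x y :: real
    using that by (cases "y = 0") (auto simp: divide_le_eq_1)
  from this[OF le nn] nn show ?case by (simp add: avg_def)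
qed auto

text \<open>If \<open>S\<close> misses \<open>Suc j\<close> elements of itself in \<open>S'\<close>,
  exchanging one of them for an element of \<open>S'\<close> gives some \<open>S1\<close> in
  \<open>Nb\<close> that misses only \<open>j\<close>. The walk steps to a given \<open>S1\<close>
  in \<open>Nb\<close> with probability \<open>D' / (K * D)\<close>, where
  \<open>K = r choose s\<close>, and this is at least \<open>1 / (K * n)\<close>; so each exchange
  costs a factor \<open>K * n\<close>.\<close>

lemma card_disjoint_le_hit:
  assumes sr: "s < r" and rn: "r \<le> n" and "S \<in> ksets n s" and B: "B \<subseteq> ksets n s"
  shows "real (card {S'\<in>B. card (S - S') = j}) \<le> (real (r choose s) * real n) ^ j * hit n r s B j S"
  using assms(3)
proof (induction j arbitrary: S)
  case 0
  have fS: "finite S" using finite_ksets_elem[OF 0] .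
  have "{S'\<in>B. card (S - S') = 0} \<subseteq> (if S \<in> B then {S} else {})"
  proof
    fix S' assume S': "S' \<in> {S'\<in>B. card (S - S') = 0}"
    then have "S \<subseteq> S'" "S' \<in> ksets n s" using fS B by auto
    then have "S = S'" using 0 finite_ksets_elem[of S' n s] card_subset_eq[of S' S] by (auto simp: ksets_def)
    then show "S' \<in> (if S \<in> B then {S} else {})" using S' by auto
  qed
  then have "card {S'\<in>B. card (S - S') = 0} \<le> card (if S \<in> B then {S} else {})"
    by (intro card_mono) auto
  then show ?case by (auto split: if_splits)
next
  case (Suc j)
  let ?K = "real (r choose s)" and ?D = "(n - s) choose (r - s)" and ?D' = "(n - Suc s) choose (r - Suc s)"
  let ?h = "hit n r s B j"
  define Nb where "Nb = {S1\<in>ksets n s. card (S \<union> S1) = Suc s}"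
  have fS: "finite S" "card S = s" "S \<subseteq> {1..n}" using finite_ksets_elem[OF Suc.prems] Suc.prems by (auto simp: ksets_def)
  have fB: "finite B" using B finite_subset finite_ksets by blast
  have K0: "0 < ?K" and D0: "0 < ?D" using sr rn by (auto intro!: zero_less_binomial)
  have "(n - s) * ?D' = (r - s) * ?D"
    using binomial_absorption[of "r - Suc s" "n - s"] sr rn by (simp add: Suc_diff_Suc)
  moreover have "1 * ?D \<le> (r - s) * ?D" using sr by (intro mult_right_mono) auto
  moreover have "(n - s) * ?D' \<le> n * ?D'" by simp
  ultimately have "?D \<le> n * ?D'" by linarith
  then have DD: "real ?D \<le> real n * real ?D'" by (metis of_nat_le_iff of_nat_mult)
  have h0: "0 \<le> ?h S1" if "S1 \<in> ksets n s" for S1 using hit_bounds[of s r S1 n B j] that sr by auto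
  have "real ?D' * (\<Sum>S1\<in>Nb. ?h S1) = (\<Sum>S1\<in>Nb. \<Sum>F\<in>{F\<in>{F\<in>ksets n r. S \<subseteq> F}. S1 \<subseteq> F}. ?h S1)"
  proof -
    have "card {F\<in>{F\<in>ksets n r. S \<subseteq> F}. S1 \<subseteq> F} = ?D'" if "S1 \<in> Nb" for S1
    proof -
      have "{F\<in>{F\<in>ksets n r. S \<subseteq> F}. S1 \<subseteq> F} = {F\<in>ksets n r. S \<union> S1 \<subseteq> F}" by auto
      then show ?thesis
        using that fS sr by (simp only: Nb_def) (subst card_ksets_superset, auto simp: ksets_def)
    qed
    then show ?thesis by (simp add: sum_distrib_left)
  qed
  also have "\<dots> = (\<Sum>F\<in>{F\<in>ksets n r. S \<subseteq> F}. \<Sum>S1\<in>{S1\<in>Nb. S1 \<subseteq> F}. ?h S1)"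
    by (rule sum.swap_restrict) (auto simp: Nb_def)
  also have "\<dots> \<le> (\<Sum>F\<in>{F\<in>ksets n r. S \<subseteq> F}. \<Sum>S1\<in>{S1\<in>ksets n s. S1 \<subseteq> F}. ?h S1)"
    using h0 by (intro sum_mono sum_mono2) (auto simp: Nb_def)
  also have "\<dots> = hit n r s B (Suc j) S * (?K * real ?D)"
    using K0 D0 by (simp add: avg_def)
  also have "\<dots> \<le> hit n r s B (Suc j) S * (?K * (real n * real ?D'))"
    using hit_bounds[of s r S n B "Suc j"] Suc.prems sr DD K0 by (intro mult_left_mono) auto
  finally have "real ?D' * (\<Sum>S1\<in>Nb. ?h S1) \<le> real ?D' * (?K * real n * hit n r s B (Suc j) S)"
    by (simp add: mult_ac)
  moreover have "0 < real ?D'" using sr rn by (auto intro!: zero_less_binomial)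
  ultimately have sumle: "(\<Sum>S1\<in>Nb. ?h S1) \<le> ?K * real n * hit n r s B (Suc j) S"
    by (simp only: mult_le_cancel_left_pos)
  have "{S'\<in>B. card (S - S') = Suc j} \<subseteq> (\<Union>S1\<in>Nb. {S'\<in>B. card (S1 - S') = j})"
  proof
    fix S' assume S': "S' \<in> {S'\<in>B. card (S - S') = Suc j}"
    then have S'k: "S' \<subseteq> {1..n}" "card S' = s" "finite S'" using B finite_ksets_elem[of S' n s] by (auto simp: ksets_def)
    have "S - S' \<noteq> {}" using S' by force
    then obtain x where x: "x \<in> S" "x \<notin> S'" by auto
    have "S' - S \<noteq> {}" using S'k fS x card_subset_eq[of S S'] by auto
    then obtain y where y: "y \<in> S'" "y \<notin> S" by auto
    let ?S1 = "insert y (S - {x})"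
    have "0 < card S" using x fS by (auto simp: card_gt_0_iff)
    then have "?S1 \<in> ksets n s" using x y fS S'k by (auto simp: ksets_def)
    moreover have "S \<union> ?S1 = insert y S" by auto
    ultimately have "?S1 \<in> Nb" using fS y by (simp add: Nb_def)
    moreover have "?S1 - S' = (S - S') - {x}" using y by auto
    then have "card (?S1 - S') = j" using S' x fS by simp
    ultimately show "S' \<in> (\<Union>S1\<in>Nb. {S'\<in>B. card (S1 - S') = j})" using S' by blast
  qed
  then have "card {S'\<in>B. card (S - S') = Suc j} \<le> card (\<Union>S1\<in>Nb. {S'\<in>B. card (S1 - S') = j})"
    using fB by (intro card_mono finite_UN_I) (auto simp: Nb_def)
  also have "\<dots> \<le> (\<Sum>S1\<in>Nb. card {S'\<in>B. card (S1 - S') = j})"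
    by (rule card_UN_le) (simp add: Nb_def)
  finally have "real (card {S'\<in>B. card (S - S') = Suc j}) \<le> (\<Sum>S1\<in>Nb. real (card {S'\<in>B. card (S1 - S') = j}))"
    unfolding of_nat_sum[symmetric] of_nat_le_iff .
  also have "\<dots> \<le> (\<Sum>S1\<in>Nb. (?K * real n) ^ j * ?h S1)"
    using Suc.IH by (intro sum_mono) (auto simp: Nb_def)
  also have "\<dots> = (?K * real n) ^ j * (\<Sum>S1\<in>Nb. ?h S1)" by (simp add: sum_distrib_left)
  also have "\<dots> \<le> (?K * real n) ^ j * (?K * real n * hit n r s B (Suc j) S)"
    using sumle by (intro mult_left_mono) auto
  finally show ?case by (simp add: mult_ac)
qed

lemma reach_neighbours_subset:
  assumes "A \<subseteq> ksets n s"
  shows "reach n s (neighbours n s A R) H \<subseteq> reach n s A (R \<union> H)"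
proof
  fix S' assume "S' \<in> reach n s (neighbours n s A R) H"
  then show "S' \<in> reach n s A (R \<union> H)"
  proof (induction rule: reach_induct)
    case (base S')
    then obtain S F where SF: "S \<in> A" "F \<in> R" "S \<subseteq> F" "S' \<subseteq> F" "S' \<in> ksets n s"
      by (auto simp: neighbours_def)
    then have "S \<in> reach n s A (R \<union> H)" using reach_refl[OF assms] by auto
    then show ?case using SF by (auto intro: reach_step)
  next
    case (step S S' F)
    then show ?case by (auto intro: reach_step)
  qed
qed

text \<open>Induction on the rounds: \<open>1 - (1 - p) ^ j\<close> is the density of
  \<open>j\<close> independent rounds together. \<open>bexp_neighbours_le\<close> with weight
  \<open>hit n r s B j\<close> turns the sum over the neighbours into the sum of
  \<open>hit n r s B (Suc j)\<close> over \<open>A\<close>, at the price of a factor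
  \<open>c\<close>.\<close>

lemma bexp_rounds_le:
  assumes sr: "s \<le> r" and D: "D = (n - s) choose (r - s)" "0 < D"
    and p: "0 \<le> p" "p \<le> 1" and k: "p * real D = k"
    and c: "c = k / (2 * real (r choose s) * (1 + k))"
    and A: "A \<subseteq> ksets n s" and B: "B \<subseteq> ksets n s"
  shows "bexp (ksets n r) (1 - (1 - p) ^ j) (\<lambda>H. of_bool (reach n s A H \<inter> B = {})) \<le>
    exp (- (c ^ j * (\<Sum>S\<in>A. hit n r s B j S)))"
  using A
proof (induction j arbitrary: A)
  case 0
  show ?case
  proof (cases "A \<inter> B = {}")
    case True
    then have "(\<Sum>S\<in>A. hit n r s B 0 S) = 0" by (intro sum.neutral) auto
    then show ?thesis by (simp add: bexp_zero)
  next
    case False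
    then show ?thesis using reach_refl[OF 0, of "{}"] by (auto simp: bexp_zero)
  qed
next
  case (Suc j)
  let ?X = "ksets n r" and ?q = "1 - (1 - p) ^ j"
  have q: "0 \<le> ?q" "?q \<le> 1" using p by (auto simp: power_le_one)
  have k0: "0 \<le> k" using p k by auto
  have K1: "1 \<le> real (r choose s)" using sr zero_less_binomial[of s r] by linarith
  \<comment> \<open>Keeps \<open>c ^ j\<close> in the unit interval, so that it may serve as
    \<open>th\<close> in \<open>bexp_neighbours_le\<close>.\<close>
  have c01: "0 \<le> c" "c \<le> 1"
  proof -
    show "0 \<le> c" using c k0 K1 by simp
    have "1 * (1 + k) \<le> 2 * real (r choose s) * (1 + k)" using k0 K1 by (intro mult_right_mono) auto
    then have "k \<le> 2 * real (r choose s) * (1 + k)" by simp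
    moreover have "0 < 2 * real (r choose s) * (1 + k)"
      using k0 K1 by (intro mult_pos_pos) linarith+
    ultimately show "c \<le> 1" unfolding c by (simp only: divide_le_eq_1_pos)
  qed
  have q_eq: "1 - (1 - p) ^ Suc j = p + ?q - p * ?q" by (simp add: algebra_simps)
  have "bexp ?X (1 - (1 - p) ^ Suc j) (\<lambda>H. of_bool (reach n s A H \<inter> B = {})) =
    bexp ?X p (\<lambda>R. bexp ?X ?q (\<lambda>H. of_bool (reach n s A (R \<union> H) \<inter> B = {})))"
    unfolding q_eq
    by (rule bexp_union[symmetric, where f = "\<lambda>H. of_bool (reach n s A H \<inter> B = {})", OF finite_ksets])
  also have "\<dots> \<le> bexp ?X p (\<lambda>R. bexp ?X ?q (\<lambda>H. of_bool (reach n s (neighbours n s A R) H \<inter> B = {})))"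
  proof (intro bexp_mono p q)
    fix R H
    have "reach n s (neighbours n s A R) H \<subseteq> reach n s A (R \<union> H)"
      by (rule reach_neighbours_subset[OF Suc.prems])
    then show "of_bool (reach n s A (R \<union> H) \<inter> B = {}) \<le>
        (of_bool (reach n s (neighbours n s A R) H \<inter> B = {}) :: real)"
      by (auto split: split_of_bool)
  qed
  also have "\<dots> \<le> bexp ?X p (\<lambda>R. exp (- (c ^ j * (\<Sum>S\<in>neighbours n s A R. hit n r s B j S))))"
    by (intro bexp_mono p Suc.IH neighbours_subset)
  also have "\<dots> \<le> exp (- (c ^ j * (k / (2 * real (r choose s) * (1 + k))) * (\<Sum>S\<in>A. avg n r s (hit n r s B j) S)))"
    using c01 Suc.prems by (intro bexp_neighbours_le[OF sr D refl p k] hit_bounds sr) (auto simp: power_le_one)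
  also have "\<dots> = exp (- (c ^ Suc j * (\<Sum>S\<in>A. hit n r s B (Suc j) S)))"
    by (simp add: c mult_ac)
  finally show ?case .
qed

lemma card_meeting_le:
  assumes S: "S \<in> ksets n s" and s: "1 \<le> s" "s \<le> n"
  shows "card {S'\<in>ksets n s. S \<inter> S' \<noteq> {}} \<le> s * n ^ (s - 1)"
proof -
  have fS: "finite S" "card S = s" "S \<subseteq> {1..n}" using finite_ksets_elem[OF S] S by (auto simp: ksets_def)
  have "card {S'\<in>ksets n s. S \<inter> S' \<noteq> {}} \<le> card (\<Union>x\<in>S. {S'\<in>ksets n s. {x} \<subseteq> S'})"
    using fS by (intro card_mono finite_UN_I) auto
  also have "\<dots> \<le> (\<Sum>x\<in>S. card {S'\<in>ksets n s. {x} \<subseteq> S'})"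
    by (rule card_UN_le) (rule fS)
  also have "\<dots> \<le> (\<Sum>x\<in>S. n ^ (s - 1))"
  proof (rule sum_mono)
    fix x assume "x \<in> S"
    then have "card {S'\<in>ksets n s. {x} \<subseteq> S'} = (n - 1) choose (s - 1)"
      using fS s by (subst card_ksets_superset) auto
    also have "\<dots> \<le> (n - 1) ^ (s - 1)"
    proof (cases "s - 1 \<le> n - 1")
      case True
      then show ?thesis by (rule binomial_le_pow)
    qed (simp add: binomial_eq_0)
    also have "\<dots> \<le> n ^ (s - 1)" by (intro power_mono) auto
    finally show "card {S'\<in>ksets n s. {x} \<subseteq> S'} \<le> n ^ (s - 1)" .
  qed
  finally show ?thesis using fS by simp
qed

text \<open>\<open>s\<close> exchanges lead from \<open>S\<close> to any set disjoint from it, and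
  only \<open>O(n ^ (s - 1))\<close> sets meet \<open>S\<close>, so at least half of the guaranteed
  \<open>\<eta> * (n / s) ^ s\<close> sets of \<open>B\<close> are targets. Dividing by the factor
  \<open>(K * n) ^ s\<close> of \<open>card_disjoint_le_hit\<close> gives \<open>h\<close>.\<close>

lemma eventually_hit_ge:
  assumes s: "1 \<le> s" "s < r" and eta: "0 < \<eta>"
  shows "\<exists>h>0. \<forall>\<^sub>F n in sequentially. \<forall>B S. B \<subseteq> ksets n s \<longrightarrow> \<eta> * real (n choose s) \<le> real (card B) \<longrightarrow>
    S \<in> ksets n s \<longrightarrow> h \<le> hit n r s B s S"
proof -
  let ?K = "real (r choose s)"
  define h where "h = \<eta> / (2 * real s ^ s * ?K ^ s)"
  have K0: "0 < ?K" using s by simp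
  have h: "0 < h" using eta s K0 by (simp add: h_def)
  have "\<forall>\<^sub>F n in sequentially. real s * (2 * real s ^ s) / \<eta> \<le> real n"
    by real_asymp
  then have "\<forall>\<^sub>F n in sequentially. \<forall>B S. B \<subseteq> ksets n s \<longrightarrow> \<eta> * real (n choose s) \<le> real (card B) \<longrightarrow>
    S \<in> ksets n s \<longrightarrow> h \<le> hit n r s B s S"
    using eventually_ge_at_top[of r]
  proof eventually_elim
    case (elim n)
    show ?case
    proof (intro allI impI)
      fix B S assume B: "B \<subseteq> ksets n s" "\<eta> * real (n choose s) \<le> real (card B)" and S: "S \<in> ksets n s"
      have fB: "finite B" using B finite_subset finite_ksets by blast
      have fS: "finite S" "card S = s" using finite_ksets_elem[OF S] S by (auto simp: ksets_def)
      have n0: "0 < n" using elim s by simp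
      have eq: "{S'\<in>B. card (S - S') = s} = {S'\<in>B. S \<inter> S' = {}}"
      proof -
        have "card (S - S') = s \<longleftrightarrow> S \<inter> S' = {}" for S'
        proof
          assume "card (S - S') = s"
          then have "S - S' = S" using fS by (intro card_subset_eq) auto
          then show "S \<inter> S' = {}" by auto
        next
          assume "S \<inter> S' = {}"
          then have "S - S' = S" by auto
          then show "card (S - S') = s" using fS by simp
        qed
        then show ?thesis by simp
      qed
      have "card B \<le> card ({S'\<in>B. S \<inter> S' = {}} \<union> {S'\<in>ksets n s. S \<inter> S' \<noteq> {}})"
        using B fB by (intro card_mono) auto
      also have "\<dots> \<le> card {S'\<in>B. S \<inter> S' = {}} + card {S'\<in>ksets n s. S \<inter> S' \<noteq> {}}"
        by (rule card_Un_le)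
      also have "card {S'\<in>ksets n s. S \<inter> S' \<noteq> {}} \<le> s * n ^ (s - 1)"
        using elim s by (intro card_meeting_le S) auto
      finally have "card B \<le> card {S'\<in>B. card (S - S') = s} + s * n ^ (s - 1)"
        unfolding eq by simp
      then have 1: "real (card B) \<le> real (card {S'\<in>B. card (S - S') = s}) + real s * real n ^ (s - 1)"
        by (metis (no_types, lifting) of_nat_add of_nat_le_iff of_nat_mult of_nat_power)
      have "(real n / real s) ^ s \<le> real (n choose s)"
        using binomial_ge_n_over_k_pow_k[of s n, where ?'a = real] elim s by simp
      then have 2: "\<eta> * (real n / real s) ^ s \<le> real (card B)"
        using B(2) eta by (meson mult_left_mono less_imp_le order_trans)
      have "real s * real n ^ (s - 1) \<le> \<eta> / (2 * real s ^ s) * real n * real n ^ (s - 1)"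
        using elim(1) eta s by (intro mult_right_mono) (auto simp: field_simps)
      also have "\<dots> = \<eta> / (2 * real s ^ s) * real n ^ s"
        using s by (simp add: power_eq_if)
      finally have "\<eta> / (2 * real s ^ s) * real n ^ s \<le> real (card {S'\<in>B. card (S - S') = s})"
        using 1 2 by (simp add: power_divide)
      also have "\<dots> \<le> (?K * real n) ^ s * hit n r s B s S"
        using s elim by (intro card_disjoint_le_hit S B(1)) auto
      finally have "\<eta> / (2 * real s ^ s) * real n ^ s \<le> (?K ^ s * hit n r s B s S) * real n ^ s"
        by (simp add: power_mult_distrib mult_ac)
      then have "\<eta> / (2 * real s ^ s) \<le> ?K ^ s * hit n r s B s S"
        using n0 by (simp only: mult_le_cancel_right_pos zero_less_power of_nat_0_less_iff)
      then have "\<eta> / (2 * real s ^ s) / ?K ^ s \<le> hit n r s B s S"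
        using K0 by (subst pos_divide_le_eq) (simp_all add: mult.commute)
      then show "h \<le> hit n r s B s S" by (simp add: h_def)
    qed
  qed
  then show ?thesis using h by blast
qed

lemma eventually_merge:
  assumes s: "1 \<le> s" "s < r" and eta: "0 < \<eta>" and kap: "0 < \<kappa>"
  shows "\<exists>c>0. \<forall>\<^sub>F n in sequentially. \<forall>p A B. \<kappa> / real (n choose (r - s)) \<le> p \<longrightarrow> p \<le> 1 \<longrightarrow>
    A \<subseteq> ksets n s \<longrightarrow> B \<subseteq> ksets n s \<longrightarrow> \<eta> * real (n choose s) \<le> real (card B) \<longrightarrow>
    bexp (ksets n r) p (\<lambda>H. of_bool (reach n s A H \<inter> B = {})) \<le> exp (- (c * real (card A)))"
proof -
  obtain h where h: "0 < h" and hit: "\<forall>\<^sub>F n in sequentially. \<forall>B S. B \<subseteq> ksets n s \<longrightarrow>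
    \<eta> * real (n choose s) \<le> real (card B) \<longrightarrow> S \<in> ksets n s \<longrightarrow> h \<le> hit n r s B s S"
    using eventually_hit_ge[OF s eta] by blast
  \<comment> \<open>Each of the \<open>s\<close> rounds gets density \<open>k / D\<close> with
    \<open>D = (n - s) choose (r - s)\<close>. By Bernoulli's inequality together they use at most
    \<open>s * k / D\<close>; the factor 2 covers the passage from \<open>n choose (r - s)\<close>
    to \<open>D\<close>, which eventually exceeds half of it.\<close>
  define k where "k = \<kappa> / (2 * real s)"
  define c where "c = k / (2 * real (r choose s) * (1 + k))"
  have k0: "0 < k" using kap s by (simp add: k_def)
  have c0: "0 < c" using k0 s by (simp add: c_def)
  have ev: "\<forall>\<^sub>F n in sequentially. real ((n - s) choose (r - s)) / real (n choose (r - s)) > 1 / 2"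
    by (rule order_tendstoD(1)[OF tendsto_choose_ratio_1]) simp
  have "\<forall>\<^sub>F n in sequentially. \<forall>p A B. \<kappa> / real (n choose (r - s)) \<le> p \<longrightarrow> p \<le> 1 \<longrightarrow>
    A \<subseteq> ksets n s \<longrightarrow> B \<subseteq> ksets n s \<longrightarrow> \<eta> * real (n choose s) \<le> real (card B) \<longrightarrow>
    bexp (ksets n r) p (\<lambda>H. of_bool (reach n s A H \<inter> B = {})) \<le> exp (- (c ^ s * h * real (card A)))"
    using hit ev eventually_ge_at_top[of r]
  proof eventually_elim
    case (elim n)
    show ?case
    proof (intro allI impI)
      fix p A B assume p: "\<kappa> / real (n choose (r - s)) \<le> p" "p \<le> 1"
        and A: "A \<subseteq> ksets n s" and B: "B \<subseteq> ksets n s" "\<eta> * real (n choose s) \<le> real (card B)"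
      let ?D = "(n - s) choose (r - s)" and ?M = "n choose (r - s)"
      have D0: "0 < ?D" "0 < ?M" using elim s by auto
      have "\<kappa> / (2 * real ?D) \<le> \<kappa> / real ?M"
        using elim(2) D0 kap by (intro divide_left_mono) (auto simp: field_simps)
      then have kp: "real s * (k / real ?D) \<le> p" using p s by (simp add: k_def)
      have "1 * (k / real ?D) \<le> real s * (k / real ?D)" using s k0 by (intro mult_right_mono) auto
      then have q: "0 \<le> k / real ?D" "k / real ?D \<le> 1" using kp p k0 by auto
      let ?q = "1 - (1 - k / real ?D) ^ s"
      have "1 + real s * (- (k / real ?D)) \<le> (1 + (- (k / real ?D))) ^ s"
        using q by (intro Bernoulli_inequality) auto
      then have "?q \<le> p" using kp by simp
      moreover have "0 \<le> ?q" using q by (simp add: power_le_one)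
      ultimately have "bexp (ksets n r) p (\<lambda>H. of_bool (reach n s A H \<inter> B = {})) \<le>
          bexp (ksets n r) ?q (\<lambda>H. of_bool (reach n s A H \<inter> B = {}))"
      proof (intro bexp_antimono)
        fix H G :: "nat set set" assume "H \<subseteq> G"
        then have "reach n s A H \<subseteq> reach n s A G" by (rule reach_mono)
        then show "of_bool (reach n s A G \<inter> B = {}) \<le> (of_bool (reach n s A H \<inter> B = {}) :: real)"
          by (auto split: split_of_bool)
      qed (use p in auto)
      also have "\<dots> \<le> exp (- (c ^ s * (\<Sum>S\<in>A. hit n r s B s S)))"
        using D0 s q by (intro bexp_rounds_le[where k = k, OF _ refl] A B(1)) (auto simp: c_def)
      also have "\<dots> \<le> exp (- (c ^ s * (\<Sum>S\<in>A. h)))"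
      proof -
        have "h \<le> hit n r s B s S" if "S \<in> A" for S using elim(1) A B that by auto
        then have "c ^ s * (\<Sum>S\<in>A. h) \<le> c ^ s * (\<Sum>S\<in>A. hit n r s B s S)"
          using c0 by (intro mult_left_mono sum_mono) auto
        then show ?thesis by simp
      qed
      finally show "bexp (ksets n r) p (\<lambda>H. of_bool (reach n s A H \<inter> B = {})) \<le>
          exp (- (c ^ s * h * real (card A)))" by (simp add: mult_ac)
    qed
  qed
  then show ?thesis using c0 h by (intro exI[of _ "c ^ s * h"]) auto
qed

section \<open>Concentration of the number of sets in small components\<close>

text \<open>The sign of \<open>exp (c * (x ^ m - 1)) - x\<close> is read off \<open>ln x - c * (x ^ m - 1)\<close>, which increases up to
  the point where \<open>c * m * x ^ m = 1\<close>, decreases from there on, and vanishes at \<open>1\<close>.\<close>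

lemma extinction_root:
  fixes c :: real and m :: nat
  assumes c: "0 < c" and m: "1 \<le> m" and cm: "1 < c * real m"
  shows "\<exists>\<sigma>. 0 < \<sigma> \<and> \<sigma> < 1 \<and> \<sigma> = exp (c * (\<sigma> ^ m - 1)) \<and>
    (\<forall>u. 0 \<le> u \<and> u < \<sigma> \<longrightarrow> u < exp (c * (u ^ m - 1))) \<and>
    (\<forall>t. \<sigma> < t \<and> t < 1 \<longrightarrow> exp (c * (t ^ m - 1)) < t)"
proof -
  define g where "g = (\<lambda>x::real. ln x - c * (x ^ m - 1))"
  define x0 where "x0 = root m (1 / (c * real m))"
  have x0m: "x0 ^ m = 1 / (c * real m)" using m cm by (simp add: x0_def)
  have x0: "0 < x0" "x0 < 1" using m cm by (auto simp: x0_def)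
  have der: "(g has_real_derivative (1 - c * real m * x ^ m) / x) (at x)" if "0 < x" for x
  proof -
    have "(g has_real_derivative (1 / x - c * (real m * x ^ (m - 1)))) (at x)"
      unfolding g_def using that by (auto intro!: derivative_eq_intros simp: field_simps)
    moreover have "1 / x - c * (real m * x ^ (m - 1)) = (1 - c * real m * x ^ m) / x"
      using that m by (simp add: field_simps power_eq_if)
    ultimately show ?thesis by simp
  qed
  have cont: "continuous_on {a..b} g" if "0 < a" for a b
    by (intro continuous_at_imp_continuous_on ballI DERIV_isCont[OF der]) (use that in auto)
  have inc: "g a < g b" if ab: "0 < a" "a < b" "b \<le> x0" for a b
  proof (rule DERIV_pos_imp_increasing_open[OF ab(2)])
    fix x assume x: "a < x" "x < b"
    then have "x ^ m < x0 ^ m" using ab m by (intro power_strict_mono) auto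
    then have "c * real m * x ^ m < 1" using x0m cm by (simp add: field_simps)
    then show "\<exists>y. (g has_real_derivative y) (at x) \<and> 0 < y"
      using x ab der[of x] by (intro exI[of _ "(1 - c * real m * x ^ m) / x"]) auto
  qed (use cont ab in auto)
  have dec: "g b < g a" if ab: "x0 \<le> a" "a < b" for a b
  proof (rule DERIV_neg_imp_decreasing_open[OF ab(2)])
    fix x assume x: "a < x" "x < b"
    then have "x0 ^ m < x ^ m" using ab m x0 by (intro power_strict_mono) auto
    then have "1 < c * real m * x ^ m" using x0m cm by (simp add: field_simps)
    then show "\<exists>y. (g has_real_derivative y) (at x) \<and> y < 0"
      using x ab x0 der[of x] by (intro exI[of _ "(1 - c * real m * x ^ m) / x"]) (auto simp: divide_neg_pos)
  qed (use cont ab x0 in auto)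
  have g1: "g 1 = 0" by (simp add: g_def)
  have pos: "0 < g x" if "x0 \<le> x" "x < 1" for x using dec[of x 1] that g1 by simp
  \<comment> \<open>At \<open>exp (- c)\<close> the value of \<open>g\<close> is
    \<open>- c * exp (- c) ^ m\<close>; this is the left end for the intermediate value
    theorem.\<close>
  have neg: "g (exp (- c)) < 0" by (simp add: g_def algebra_simps c)
  have lt: "exp (- c) < x0" using pos[of "exp (- c)"] neg c by force
  obtain \<sigma> where \<sigma>: "exp (- c) \<le> \<sigma>" "\<sigma> \<le> x0" "g \<sigma> = 0"
    using IVT'[of g "exp (- c)" 0 x0] neg pos[of x0] x0 lt cont[of "exp (- c)" x0] by auto
  have \<sigma>0: "0 < \<sigma>" using \<sigma>(1) by (meson exp_gt_zero less_le_trans)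
  have \<sigma>x: "\<sigma> < x0" using \<sigma> pos[of x0] x0 by (cases "\<sigma> = x0") auto
  have gexp: "x < exp (c * (x ^ m - 1)) \<longleftrightarrow> g x < 0" "exp (c * (x ^ m - 1)) < x \<longleftrightarrow> 0 < g x" if "0 < x" for x
  proof -
    have "x < exp (c * (x ^ m - 1)) \<longleftrightarrow> ln x < ln (exp (c * (x ^ m - 1)))"
      using that by (subst ln_less_cancel_iff) auto
    then show "x < exp (c * (x ^ m - 1)) \<longleftrightarrow> g x < 0" by (simp add: g_def)
    have "exp (c * (x ^ m - 1)) < x \<longleftrightarrow> ln (exp (c * (x ^ m - 1))) < ln x"
      using that by (subst ln_less_cancel_iff) auto
    then show "exp (c * (x ^ m - 1)) < x \<longleftrightarrow> 0 < g x" by (simp add: g_def)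
  qed
  have "\<sigma> = exp (c * (\<sigma> ^ m - 1))" using gexp[OF \<sigma>0] \<sigma>(3) by linarith
  moreover have "u < exp (c * (u ^ m - 1))" if u: "0 \<le> u" "u < \<sigma>" for u
  proof (cases "u = 0")
    case False
    then show ?thesis using gexp(1)[of u] inc[of u \<sigma>] u \<sigma> by auto
  qed simp
  moreover have "exp (c * (t ^ m - 1)) < t" if t: "\<sigma> < t" "t < 1" for t
  proof -
    have "0 < g t"
    proof (cases "t \<le> x0")
      case True
      then show ?thesis using inc[of \<sigma> t] \<sigma>(3) t \<sigma>0 by simp
    next
      case False
      then show ?thesis using pos[of t] t by simp
    qed
    then show ?thesis using gexp(2)[of t] t \<sigma>0 by simp
  qed
  ultimately show ?thesis using \<sigma>0 \<sigma>x x0 by (intro exI[of _ \<sigma>]) auto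
qed

text \<open>\<open>exp (c * (t ^ m - 1)) - t\<close> vanishes at 1 with slope
  \<open>c * m - 1 < 0\<close>, so it is negative just to the right of 1.\<close>

lemma subcritical_base:
  fixes c :: real and m :: nat
  assumes cm: "c * real m < 1"
  shows "\<exists>t>1. exp (c * (t ^ m - 1)) < t"
proof -
  let ?f = "\<lambda>t::real. exp (c * (t ^ m - 1)) - t"
  have "(?f has_real_derivative (c * real m - 1)) (at 1)"
    by (auto intro!: derivative_eq_intros)
  then obtain d where d: "0 < d" "\<And>h. 0 < h \<Longrightarrow> h < d \<Longrightarrow> ?f (1 + h) < ?f 1"
    using DERIV_neg_dec_right[of ?f "c * real m - 1" 1] cm by auto
  have "?f (1 + d / 2) < ?f 1" using d by auto
  then show ?thesis using d(1) by (intro exI[of _ "1 + d / 2"]) simp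
qed

section \<open>One-step bounds at edge density of order
  \<open>1 / (n choose (r - s))\<close>\<close>

lemma tendsto_step_exponents:
  assumes "s < r"
  defines "M \<equiv> \<lambda>n. real (n choose (r - s))" and "D \<equiv> \<lambda>n. real ((n - s) choose (r - s))"
    and "D' \<equiv> \<lambda>n. real ((n - Suc s) choose (r - Suc s))"
  shows "(\<lambda>n. D n / M n) \<longlonglongrightarrow> 1" "(\<lambda>n. sqrt (real n) * D' n / M n) \<longlonglongrightarrow> 0"
    "(\<lambda>n. D' n / M n) \<longlonglongrightarrow> 0"
proof -
  show "(\<lambda>n. D n / M n) \<longlonglongrightarrow> 1" unfolding D_def M_def by (rule tendsto_choose_ratio_1)
  have rs: "r - s = Suc (r - Suc s)" using assms by simp
  have ratio: "(\<lambda>n. (D' n / real n ^ (r - Suc s)) / (M n / real n ^ (r - s))) \<longlonglongrightarrow>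
     (1 / fact (r - Suc s)) / (1 / fact (r - s))"
    using tendsto_divide[OF tendsto_choose_ratio[of "Suc s" "r - Suc s"] tendsto_choose_ratio[of 0 "r - s"]]
    unfolding D'_def M_def by simp
  have a: "(\<lambda>n. (D' n / real n ^ (r - Suc s)) / (M n / real n ^ (r - s)) * f n) \<longlonglongrightarrow>
     (1 / fact (r - Suc s)) / (1 / fact (r - s)) * 0" if "f \<longlonglongrightarrow> 0" for f
    by (intro tendsto_mult ratio that)
  have b: "\<forall>\<^sub>F n in sequentially. (D' n / real n ^ (r - Suc s)) / (M n / real n ^ (r - s)) * (x n / real n) =
      x n * D' n / M n" for x
    using eventually_gt_at_top[of 0] by eventually_elim (simp add: rs)
  have "(\<lambda>n. sqrt (real n) / real n) \<longlonglongrightarrow> 0" by real_asymp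
  from Lim_transform_eventually[OF a[OF this] b] show "(\<lambda>n. sqrt (real n) * D' n / M n) \<longlonglongrightarrow> 0" by simp
  have "(\<lambda>n. 1 / real n) \<longlonglongrightarrow> 0" by real_asymp
  from Lim_transform_eventually[OF a[OF this] b] show "(\<lambda>n. D' n / M n) \<longlonglongrightarrow> 0" by simp
qed

lemma choose_ge_ratio:
  assumes "1 \<le> k" "k \<le> n"
  shows "real n / real k \<le> real (n choose k)"
proof -
  have "1 \<le> real n / real k" using assms by simp
  then have "(real n / real k) ^ 1 \<le> (real n / real k) ^ k"
    using assms by (intro power_increasing) auto
  also have "\<dots> \<le> real (n choose k)"
    by (rule binomial_ge_n_over_k_pow_k[OF assms(2)])
  finally show ?thesis by simp
qed

lemma filterlim_choose_at_top:
  assumes "1 \<le> k"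
  shows "filterlim (\<lambda>n. real (n choose k)) at_top sequentially"
proof (rule filterlim_at_top_mono)
  show "filterlim (\<lambda>n. real n / real k) at_top sequentially" using assms by real_asymp
  show "\<forall>\<^sub>F n in sequentially. real n / real k \<le> real (n choose k)"
    using eventually_ge_at_top[of k] by eventually_elim (rule choose_ge_ratio[OF assms])
qed

lemma tendsto_choose_inverse:
  assumes "s < r"
  shows "(\<lambda>n. c / real (n choose (r - s))) \<longlonglongrightarrow> 0"
  using assms by (intro real_tendsto_divide_at_top[OF tendsto_const] filterlim_choose_at_top) auto

lemma eventually_choose_inverse_less:
  fixes c :: real
  assumes "s < r"
  shows "\<forall>\<^sub>F n in sequentially. c / real (n choose (r - s)) < 1"
  by (rule order_tendstoD(2)[OF tendsto_choose_inverse[OF assms]]) simp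

text \<open>\<open>t \<le> 1\<close> makes the expectation decrease in \<open>p\<close>, which
  reduces to \<open>p = c / (n choose (r - s))\<close>. There the exponent of
  \<open>bexp_newsets_le\<close> tends to \<open>c * (t ^ m - 1)\<close> with
  \<open>m = (r choose s) - 1\<close>, and the errors vanish even with \<open>sqrt n\<close> known
  sets, since \<open>D'\<close> is smaller than \<open>D\<close> by order \<open>n\<close>. The
  strict inequality for \<open>q\<close> absorbs them.\<close>

lemma eventually_step_le:
  assumes sr: "s < r" and c: "0 < c" and t: "0 \<le> t" "t \<le> 1"
    and q: "exp (c * (t ^ ((r choose s) - 1) - 1)) < q"
  shows "\<forall>\<^sub>F n in sequentially. \<forall>p w. c / real (n choose (r - s)) \<le> p \<longrightarrow> p \<le> 1 \<longrightarrow>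
    real w \<le> sqrt (real n) \<longrightarrow> step_le n r s p t q w"
proof -
  define M where "M = (\<lambda>n. real (n choose (r - s)))"
  define D where "D = (\<lambda>n. real ((n - s) choose (r - s)))"
  define D' where "D' = (\<lambda>n. real ((n - Suc s) choose (r - Suc s)))"
  let ?a = "1 - t ^ ((r choose s) - 1)"
  have a: "0 \<le> ?a" using t by (simp add: power_le_one)
  have lims: "(\<lambda>n. D n / M n) \<longlonglongrightarrow> 1" "(\<lambda>n. sqrt (real n) * D' n / M n) \<longlonglongrightarrow> 0"
    "(\<lambda>n. D' n / M n) \<longlonglongrightarrow> 0"
    unfolding M_def D_def D'_def by (rule tendsto_step_exponents[OF sr])+
  have "(\<lambda>n. exp (- (c * ?a * (D n / M n - sqrt (real n) * D' n / M n))) +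
     (c * (sqrt (real n) * D' n / M n) + c\<^sup>2 * (D n / M n) * real (r - s) * (D' n / M n))) \<longlonglongrightarrow>
     exp (- (c * ?a * (1 - 0))) + (c * 0 + c\<^sup>2 * 1 * real (r - s) * 0)"
    by (intro lims tendsto_intros)
  moreover have "exp (- (c * ?a * (1 - 0))) + (c * 0 + c\<^sup>2 * 1 * real (r - s) * 0) < q"
    using q by (simp add: algebra_simps)
  ultimately have "\<forall>\<^sub>F n in sequentially. exp (- (c * ?a * (D n / M n - sqrt (real n) * D' n / M n))) +
     (c * (sqrt (real n) * D' n / M n) + c\<^sup>2 * (D n / M n) * real (r - s) * (D' n / M n)) < q"
    by (rule order_tendstoD(2))
  then show ?thesis
    using eventually_ge_at_top[of r]
  proof eventually_elim
    case (elim n)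
    show ?case
    proof (intro allI impI)
      fix p w assume p: "c / real (n choose (r - s)) \<le> p" "p \<le> 1" and w: "real w \<le> sqrt (real n)"
      have M0: "0 < M n" using elim by (simp add: M_def)
      have D0: "0 \<le> D n" "0 \<le> D' n" by (simp_all add: D_def D'_def)
      let ?p = "c / M n"
      have p0: "0 \<le> ?p" "?p \<le> p" using p c M0 by (auto simp: M_def)
      show "step_le n r s p t q w"
        unfolding step_le_def
      proof (intro allI impI)
        fix E A S assume S: "S \<in> A" "A \<inter> E = {}" "A \<union> E \<subseteq> ksets n s" "card (A \<union> E) \<le> w"
        let ?W = "A \<union> E"
        have W: "real (card ?W) \<le> sqrt (real n)" using S w by linarith
        have "bexp (through n r E S) p (\<lambda>R. t ^ card (newsets n s ?W R)) \<le>
          bexp (through n r E S) ?p (\<lambda>R. t ^ card (newsets n s ?W R))"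
          using p0 p t by (intro bexp_antimono power_decreasing card_mono newsets_mono) auto
        also have "\<dots> \<le> exp (- (?p * ?a * (D n - real (card ?W) * D' n))) +
            (?p * real (card ?W) * D' n + ?p\<^sup>2 * D n * real (r - s) * D' n)"
          unfolding D_def D'_def using S p0 p t sr by (intro bexp_newsets_le) auto
        also have "\<dots> \<le> exp (- (?p * ?a * (D n - sqrt (real n) * D' n))) +
            (?p * sqrt (real n) * D' n + ?p\<^sup>2 * D n * real (r - s) * D' n)"
          using W D0 p0 a
          by (intro add_mono order_refl mult_right_mono mult_left_mono iffD2[OF exp_le_cancel_iff]
              le_imp_neg_le diff_mono mult_nonneg_nonneg)
        also have "\<dots> = exp (- (c * ?a * (D n / M n - sqrt (real n) * D' n / M n))) +
          (c * (sqrt (real n) * D' n / M n) + c\<^sup>2 * (D n / M n) * real (r - s) * (D' n / M n))"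
        proof -
          have "?p * ?a * (D n - sqrt (real n) * D' n) = c * ?a * (D n / M n - sqrt (real n) * D' n / M n)"
            by (simp add: diff_divide_distrib right_diff_distrib mult_ac)
          then show ?thesis by (simp add: power2_eq_square mult_ac)
        qed
        also have "\<dots> < q" by (rule elim(1))
        finally show "bexp (through n r E S) p (\<lambda>R. t ^ card (newsets n s ?W R)) \<le> q" by simp
      qed
    qed
  qed
qed

lemma eventually_step_ge:
  assumes sr: "s < r" and c: "0 < c" and u: "0 \<le> u" "u \<le> 1"
    and q: "u < exp (c * (u ^ ((r choose s) - 1) - 1))"
  shows "\<forall>\<^sub>F n in sequentially. \<forall>E A S. S \<in> A \<longrightarrow> A \<inter> E = {} \<longrightarrow> A \<union> E \<subseteq> ksets n s \<longrightarrow>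
    u \<le> bexp (through n r E S) (c / real (n choose (r - s))) (\<lambda>R. u ^ card (newsets n s (A \<union> E) R))"
proof -
  define M where "M = (\<lambda>n. real (n choose (r - s)))"
  define D where "D = (\<lambda>n. real ((n - s) choose (r - s)))"
  let ?a = "1 - u ^ ((r choose s) - 1)"
  have a: "0 \<le> ?a" "?a \<le> 1" using u by (auto simp: power_le_one)
  have lims: "(\<lambda>n. D n / M n) \<longlonglongrightarrow> 1" "(\<lambda>n. c / M n) \<longlonglongrightarrow> 0"
    unfolding M_def D_def by (rule tendsto_step_exponents[OF sr] tendsto_choose_inverse[OF sr])+
  \<comment> \<open>The exponent is \<open>- y * D / (1 - y)\<close> with
    \<open>y = c / M * ?a\<close>, as supplied by \<open>1 - y \<ge> exp (- (y / (1 - y)))\<close>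
    below.\<close>
  have "(\<lambda>n. exp (- (c * ?a * (D n / M n)) / (1 - c / M n * ?a))) \<longlonglongrightarrow>
     exp (- (c * ?a * 1) / (1 - 0 * ?a))"
    by (intro lims tendsto_intros) simp
  moreover have "u < exp (- (c * ?a * 1) / (1 - 0 * ?a))" using q by (simp add: algebra_simps)
  ultimately have "\<forall>\<^sub>F n in sequentially. u < exp (- (c * ?a * (D n / M n)) / (1 - c / M n * ?a))"
    by (rule order_tendstoD(1))
  moreover have "\<forall>\<^sub>F n in sequentially. c / M n < 1 / 2"
    by (rule order_tendstoD(2)[OF lims(2)]) simp
  ultimately show ?thesis
    using eventually_ge_at_top[of r]
  proof eventually_elim
    case (elim n)
    have M0: "0 < M n" using elim by (simp add: M_def)
    define y where "y = c / M n * ?a"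
    have p: "0 \<le> c / M n" "c / M n \<le> 1" using c M0 elim by auto
    have "y \<le> c / M n * 1" unfolding y_def using p a by (intro mult_left_mono) auto
    then have "y < 1" using elim(2) by linarith
    moreover have "0 \<le> y" unfolding y_def using p a by (intro mult_nonneg_nonneg)
    ultimately have y: "0 \<le> y" "y < 1" by auto
    have "1 + y / (1 - y) \<le> exp (y / (1 - y))" by (rule exp_ge_add_one_self)
    then have "1 / (1 - y) \<le> exp (y / (1 - y))" using y by (simp add: field_simps)
    then have "exp (- (y / (1 - y))) \<le> 1 - y" using y by (simp add: exp_minus field_simps)
    then have "exp (- (y / (1 - y))) ^ ((n - s) choose (r - s)) \<le> (1 - y) ^ ((n - s) choose (r - s))"
      by (intro power_mono) auto
    moreover have "exp (- (y / (1 - y))) ^ ((n - s) choose (r - s)) =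
        exp (- (c * ?a * (D n / M n)) / (1 - c / M n * ?a))"
      by (simp add: exp_of_nat_mult[symmetric] y_def D_def mult_ac)
    ultimately have *: "u \<le> (1 - y) ^ ((n - s) choose (r - s))" using elim(1) by linarith
    show ?case
    proof (intro allI impI)
      fix E A S assume S: "S \<in> A" "A \<inter> E = {}" "A \<union> E \<subseteq> ksets n s"
      have "(1 - y) ^ ((n - s) choose (r - s)) \<le>
         bexp (through n r E S) (c / M n) (\<lambda>R. u ^ card (newsets n s (A \<union> E) R))"
        unfolding y_def using S sr p u by (intro bexp_newsets_ge) auto
      then show "u \<le> bexp (through n r E S) (c / real (n choose (r - s))) (\<lambda>R. u ^ card (newsets n s (A \<union> E) R))"
        using * unfolding M_def by linarith
    qed
  qed
qed

definition small_count :: "nat \<Rightarrow> nat \<Rightarrow> nat \<Rightarrow> nat set set \<Rightarrow> nat" where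
  "small_count n s k H = card {S\<in>ksets n s. card (reach n s {S} H) < k}"

text \<open>The second moment is taken about \<open>\<sigma> * (n choose s)\<close> and not about
  the mean, so an upper bound for pairs and the lower bound \<open>lo\<close> for single sets
  suffice. For a pair, the exploration starts from both sets at once: two components below
  \<open>k\<close> have fewer than \<open>2 * k\<close> sets together, which has probability at most
  \<open>t ^ 2\<close>. The diagonal contributes \<open>1 / (n choose s)\<close>.\<close>

lemma small_count_deviation:
  assumes p: "0 \<le> p" "p \<le> 1" and t: "0 \<le> t" "t \<le> 1" and d: "0 < d" and n: "s \<le> n" and sg: "0 \<le> \<sigma>"
    and step: "step_le n r s p t t w" and kw: "2 * k \<le> w"
    and lo: "\<And>S. S \<in> ksets n s \<Longrightarrow> lo \<le> bexp (ksets n r) p (\<lambda>H. of_bool (card (reach n s {S} H) < k))"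
  shows "bexp (ksets n r) p (\<lambda>H. of_bool (d * real (n choose s) < \<bar>real (small_count n s k H) - \<sigma> * real (n choose s)\<bar>)) \<le>
    (t\<^sup>2 + 1 / real (n choose s) - 2 * \<sigma> * lo + \<sigma>\<^sup>2) / d\<^sup>2"
proof -
  let ?X = "ksets n r" and ?N = "ksets n s"
  let ?M = "real (n choose s)"
  have M0: "0 < ?M" using n by simp
  let ?I = "\<lambda>H S. of_bool (card (reach n s {S} H) < k) :: real"
  have Y: "real (small_count n s k H) = (\<Sum>S\<in>?N. ?I H S)" for H
    by (simp add: small_count_def Int_def)
  have pair: "bexp ?X p (\<lambda>H. ?I H S * ?I H S') \<le> t\<^sup>2 + of_bool (S = S')" if S: "S \<in> ?N" "S' \<in> ?N" for S S'
  proof (cases "S = S'")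
    case True
    have "bexp ?X p (\<lambda>H. ?I H S * ?I H S') \<le> 1" using p by (intro bexp_le_const) auto
    then show ?thesis using True by (simp add: add_increasing)
  next
    case False
    have "bexp ?X p (\<lambda>H. ?I H S * ?I H S') \<le> bexp ?X p (\<lambda>H. of_bool (card ({} \<union> reach n s {S, S'} H) < 2 * k))"
    proof (intro bexp_mono p)
      fix H
      have "reach n s {S, S'} H = reach n s {S} H \<union> reach n s {S'} H" by (auto simp: reach_def)
      then have "card (reach n s {S, S'} H) \<le> card (reach n s {S} H) + card (reach n s {S'} H)"
        using card_Un_le by metis
      then show "?I H S * ?I H S' \<le> of_bool (card ({} \<union> reach n s {S, S'} H) < 2 * k)"
        by (auto split: split_of_bool)
    qed
    also have "\<dots> \<le> t ^ card {S, S'}"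
      using explore_survival[OF p t step kw, of "{S, S'}" "{}"] S by simp
    finally show ?thesis using False by (simp add: power2_eq_square)
  qed
  let ?Y = "\<lambda>H. \<Sum>S\<in>?N. ?I H S"
  have N: "real (card ?N) = ?M" by (simp add: card_ksets)
  have e2: "bexp ?X p (\<lambda>H. ?Y H * ?Y H) \<le> ?M\<^sup>2 * t\<^sup>2 + ?M"
  proof -
    have "bexp ?X p (\<lambda>H. ?Y H * ?Y H) = (\<Sum>S\<in>?N. \<Sum>S'\<in>?N. bexp ?X p (\<lambda>H. ?I H S * ?I H S'))"
      unfolding sum_product bexp_sum ..
    also have "\<dots> \<le> (\<Sum>S\<in>?N. \<Sum>S'\<in>?N. t\<^sup>2 + of_bool (S = S'))"
      by (intro sum_mono pair)
    also have "\<dots> = (\<Sum>S\<in>?N. ?M * t\<^sup>2 + 1)"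
      by (intro sum.cong refl) (simp add: sum.distrib N of_bool_def)
    also have "\<dots> = ?M\<^sup>2 * t\<^sup>2 + ?M" by (simp add: N power2_eq_square algebra_simps)
    finally show ?thesis .
  qed
  have e1: "?M * lo \<le> bexp ?X p ?Y"
  proof -
    have "?M * lo = (\<Sum>S\<in>?N. lo)" by (simp add: N)
    also have "\<dots> \<le> (\<Sum>S\<in>?N. bexp ?X p (\<lambda>H. ?I H S))" by (intro sum_mono lo)
    finally show ?thesis unfolding bexp_sum .
  qed
  have "bexp ?X p (\<lambda>H. of_bool (d * ?M < \<bar>real (small_count n s k H) - \<sigma> * ?M\<bar>)) \<le>
    bexp ?X p (\<lambda>H. (1 / (d * ?M)\<^sup>2) * (?Y H * ?Y H + ((- 2 * \<sigma> * ?M) * ?Y H + (\<sigma> * ?M)\<^sup>2)))"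
  proof (intro bexp_mono p)
    fix H
    have eq: "?Y H * ?Y H + ((- 2 * \<sigma> * ?M) * ?Y H + (\<sigma> * ?M)\<^sup>2) = (?Y H - \<sigma> * ?M)\<^sup>2"
      by (simp add: power2_eq_square algebra_simps)
    show "of_bool (d * ?M < \<bar>real (small_count n s k H) - \<sigma> * ?M\<bar>) \<le>
      (1 / (d * ?M)\<^sup>2) * (?Y H * ?Y H + ((- 2 * \<sigma> * ?M) * ?Y H + (\<sigma> * ?M)\<^sup>2))"
    proof (cases "d * ?M < \<bar>?Y H - \<sigma> * ?M\<bar>")
      case True
      then have "(d * ?M)\<^sup>2 \<le> (?Y H - \<sigma> * ?M)\<^sup>2"
        using d M0 power_mono[of "d * ?M" "\<bar>?Y H - \<sigma> * ?M\<bar>" 2] by simp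
      then show ?thesis unfolding eq Y using d M0 by simp
    next
      case False
      then show ?thesis unfolding eq Y by simp
    qed
  qed
  also have "\<dots> = (1 / (d * ?M)\<^sup>2) * (bexp ?X p (\<lambda>H. ?Y H * ?Y H) + ((- 2 * \<sigma> * ?M) * bexp ?X p ?Y + (\<sigma> * ?M)\<^sup>2))"
    unfolding bexp_cmult bexp_add by (simp add: bexp_const)
  also have "\<dots> \<le> (1 / (d * ?M)\<^sup>2) * ((?M\<^sup>2 * t\<^sup>2 + ?M) + ((- 2 * \<sigma> * ?M) * (?M * lo) + (\<sigma> * ?M)\<^sup>2))"
    using e1 e2 sg M0 by (intro mult_left_mono add_mono mult_left_mono_neg) auto
  also have "\<dots> = (t\<^sup>2 + 1 / ?M - 2 * \<sigma> * lo + \<sigma>\<^sup>2) / d\<^sup>2"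
    using M0 d by (simp add: field_simps power2_eq_square)
  finally show ?thesis .
qed

lemma eventually_small_count:
  assumes s: "1 \<le> s" "s < r" and c: "0 < c" and m: "m = (r choose s) - 1"
    and sg: "0 < \<sigma>" "\<sigma> < 1"
    and below: "\<And>u. 0 \<le> u \<Longrightarrow> u < \<sigma> \<Longrightarrow> u < exp (c * (u ^ m - 1))"
    and above: "\<And>t. \<sigma> < t \<Longrightarrow> t < 1 \<Longrightarrow> exp (c * (t ^ m - 1)) < t"
    and d: "0 < d" and e: "0 < e"
  shows "\<exists>k0. \<forall>k\<ge>k0. \<forall>\<^sub>F n in sequentially. bexp (ksets n r) (c / real (n choose (r - s)))
    (\<lambda>H. of_bool (d * real (n choose s) < \<bar>real (small_count n s k H) - \<sigma> * real (n choose s)\<bar>)) \<le> e"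
proof -
  \<comment> \<open>With \<open>t = \<sigma> + z\<close> and \<open>u = \<sigma> - z\<close> the
    numerator in \<open>small_count_deviation\<close> is
    \<open>z * z + 6 * \<sigma> * z + 1 / (n choose s)\<close>, at most \<open>8 * z\<close> for
    large \<open>n\<close>; hence the bound \<open>e * d\<^sup>2 / 8\<close>. The halves keep
    \<open>u\<close> positive and \<open>t\<close> below 1.\<close>
  define z where "z = min (min (\<sigma> / 2) ((1 - \<sigma>) / 2)) (e * d\<^sup>2 / 8)"
  have z: "0 < z" "z \<le> \<sigma> / 2" "z \<le> (1 - \<sigma>) / 2" "8 * z \<le> e * d\<^sup>2"
    using sg e d by (auto simp: z_def min_def)
  define t where "t = \<sigma> + z" define u where "u = \<sigma> - z"
  have t: "\<sigma> < t" "t < 1" and u: "0 < u" "u < \<sigma>" using z sg by (auto simp: t_def u_def)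
  \<comment> \<open>Midpoint between the one-step ratio at \<open>t\<close> and 1, leaving strict
    room on both sides.\<close>
  define l where "l = (exp (c * (t ^ m - 1)) / t + 1) / 2"
  have t0: "0 < t" using t sg by simp
  have "0 < (x + 1) / 2 \<and> (x + 1) / 2 < 1 \<and> x < (x + 1) / 2" if "0 < x" "x < 1" for x :: real
    using that by auto
  from this[of "exp (c * (t ^ m - 1)) / t"] have l: "0 < l" "l < 1" "exp (c * (t ^ m - 1)) / t < l"
    using above[OF t] t0 by (simp_all only: l_def) auto
  then have lt: "exp (c * (t ^ m - 1)) < l * t" using t0 by (simp add: divide_less_eq)
  obtain k0 where k0: "l ^ k0 < z" using real_arch_pow_inv[OF z(1) l(2)] by auto
  show ?thesis
  proof (intro exI[of _ k0] allI impI)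
    fix k assume k: "k0 \<le> k"
    have "l ^ k \<le> l ^ k0" using k l by (intro power_decreasing) auto
    then have lk: "l ^ k \<le> z" using k0 by simp
    have "0 < l ^ k" using l by simp
    \<comment> \<open>More than \<open>w\<close> known sets with at most \<open>k\<close> explored
      leave more than \<open>a\<close> active ones, and there \<open>(u / t) ^ a < l ^ k\<close>
      yields \<open>cap\<close>. The \<open>2 * k\<close> in \<open>w\<close> is for the pairs in
      \<open>small_count_deviation\<close>.\<close>
    then obtain a where a: "(u / t) ^ a < l ^ k" using real_arch_pow_inv[of "l ^ k" "u / t"] t u t0 by auto
    define w where "w = 2 * k + a"
    have cap: "u ^ b \<le> t ^ b * l ^ k" if "w < b + k" for b
    proof -
      have "(u / t) ^ b \<le> (u / t) ^ a" using that u t t0 by (intro power_decreasing) (auto simp: w_def)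
      then have "u ^ b / t ^ b \<le> l ^ k" using a by (simp add: power_divide)
      then show ?thesis using t0 by (simp add: divide_le_eq mult.commute)
    qed
    have "\<forall>\<^sub>F n in sequentially. real w \<le> sqrt (real n)" by real_asymp
    moreover note eventually_choose_inverse_less[OF s(2), of c]
    moreover have "\<forall>\<^sub>F n in sequentially. 1 / z \<le> real (n choose s)"
      using filterlim_choose_at_top[OF s(1)] by (simp add: filterlim_at_top)
    moreover have "\<forall>\<^sub>F n in sequentially. \<forall>p w. c / real (n choose (r - s)) \<le> p \<longrightarrow> p \<le> 1 \<longrightarrow>
        real w \<le> sqrt (real n) \<longrightarrow> step_le n r s p t (l * t) w"
      using lt t t0 unfolding m by (intro eventually_step_le s c) auto
    moreover have "\<forall>\<^sub>F n in sequentially. \<forall>p w. c / real (n choose (r - s)) \<le> p \<longrightarrow> p \<le> 1 \<longrightarrow>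
        real w \<le> sqrt (real n) \<longrightarrow> step_le n r s p t t w"
      using above[OF t] t t0 unfolding m by (intro eventually_step_le s c) auto
    moreover have "\<forall>\<^sub>F n in sequentially. \<forall>E A S. S \<in> A \<longrightarrow> A \<inter> E = {} \<longrightarrow> A \<union> E \<subseteq> ksets n s \<longrightarrow>
        u \<le> bexp (through n r E S) (c / real (n choose (r - s))) (\<lambda>R. u ^ card (newsets n s (A \<union> E) R))"
      using below[of u] u sg unfolding m by (intro eventually_step_ge s c) auto
    ultimately show "\<forall>\<^sub>F n in sequentially. bexp (ksets n r) (c / real (n choose (r - s)))
      (\<lambda>H. of_bool (d * real (n choose s) < \<bar>real (small_count n s k H) - \<sigma> * real (n choose s)\<bar>)) \<le> e"
      using eventually_ge_at_top[of r]
    proof eventually_elim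
      case (elim n)
      let ?p = "c / real (n choose (r - s))"
      have p: "0 \<le> ?p" "?p \<le> 1" using c elim by auto
      have steps: "step_le n r s ?p t (l * t) w" "step_le n r s ?p t t w"
        using elim p by blast+
      have lo: "u - z \<le> bexp (ksets n r) ?p (\<lambda>H. of_bool (card (reach n s {S} H) < k))" if "S \<in> ksets n s" for S
      proof -
        have "u ^ card {S} - t ^ card {S} * l ^ (k - card ({} :: nat set set)) \<le>
          bexp (unexplored n r {}) ?p (\<lambda>H. of_bool (card ({} \<union> reach n s {S} H) < k))"
          using that u t l sg cap elim(6)
          by (intro explore_extinction[OF p _ _ _ _ _ steps(1)]) auto
        moreover have "t * l ^ k \<le> 1 * z" using t t0 lk l by (intro mult_mono) auto
        ultimately show ?thesis by simp
      qed
      have "bexp (ksets n r) ?p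
        (\<lambda>H. of_bool (d * real (n choose s) < \<bar>real (small_count n s k H) - \<sigma> * real (n choose s)\<bar>)) \<le>
        (t\<^sup>2 + 1 / real (n choose s) - 2 * \<sigma> * (u - z) + \<sigma>\<^sup>2) / d\<^sup>2"
        using t t0 sg d s elim(7) lo by (intro small_count_deviation[OF p _ _ _ _ _ steps(2)]) (auto simp: w_def)
      also have "\<dots> \<le> 8 * z / d\<^sup>2"
      proof (rule divide_right_mono)
        have "0 < real (n choose s)" using elim(7) s by simp
        then have "1 / real (n choose s) \<le> z" using elim(3) z(1) by (simp add: field_simps)
        moreover have "z * z \<le> 1 * z" using z sg by (intro mult_right_mono) auto
        moreover have "\<sigma> * z \<le> 1 * z" using z sg by (intro mult_right_mono) auto
        moreover have "t\<^sup>2 - 2 * \<sigma> * (u - z) + \<sigma>\<^sup>2 = z * z + 6 * (\<sigma> * z)"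
          by (simp add: t_def u_def power2_eq_square algebra_simps)
        ultimately show "t\<^sup>2 + 1 / real (n choose s) - 2 * \<sigma> * (u - z) + \<sigma>\<^sup>2 \<le> 8 * z" using z by linarith
      qed simp
      also have "\<dots> \<le> e" using z(4) d by (simp add: divide_le_eq)
      finally show ?case .
    qed
  qed
qed

section \<open>The giant component\<close>

text \<open>Each part is smaller than \<open>x\<close>, so while parts are removed one by one the
  size of the union cannot jump from at least \<open>2 * x\<close> to below
  \<open>x\<close>.\<close>

lemma greedy_union:
  fixes x :: real
  assumes "finite \<P>" "\<And>P. P \<in> \<P> \<Longrightarrow> finite P \<and> real (card P) < x" "0 < x" "x \<le> real (card (\<Union>\<P>))"
  shows "\<exists>\<D>\<subseteq>\<P>. x \<le> real (card (\<Union>\<D>)) \<and> real (card (\<Union>\<D>)) < 2 * x"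
  using assms
proof (induction \<P>)
  case (insert P \<P>)
  show ?case
  proof (cases "real (card (\<Union>(insert P \<P>))) < 2 * x")
    case True
    then show ?thesis using insert.prems by (intro exI[of _ "insert P \<P>"]) auto
  next
    case False
    have "card (\<Union>(insert P \<P>)) \<le> card P + card (\<Union>\<P>)" using card_Un_le[of P "\<Union>\<P>"] by simp
    then have "real (card (\<Union>(insert P \<P>))) \<le> real (card P) + real (card (\<Union>\<P>))" by linarith
    moreover have "real (card P) < x" using insert.prems by auto
    ultimately have "x \<le> real (card (\<Union>\<P>))" using False by linarith
    then have "\<exists>\<D>\<subseteq>\<P>. x \<le> real (card (\<Union>\<D>)) \<and> real (card (\<Union>\<D>)) < 2 * x"
      using insert.prems by (intro insert.IH) auto
    then show ?thesis by blast
  qed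
qed auto

lemma reach_singleton_eq:
  assumes "S' \<in> reach n s {S} H"
  shows "reach n s {S'} H = reach n s {S} H"
proof -
  have *: "s_connected n s H S S'" using assms by (simp add: reach_def)
  then show ?thesis
    using s_connected_trans[OF *] s_connected_trans[OF s_connected_sym[OF *]] by (auto simp: reach_def)
qed

lemma reach_self: "S \<in> ksets n s \<Longrightarrow> S \<in> reach n s {S} H"
  using reach_refl[of "{S}" n s H] by auto

definition big_sets :: "nat \<Rightarrow> nat \<Rightarrow> nat \<Rightarrow> nat set set \<Rightarrow> nat set set" where
  "big_sets n s k H = {S\<in>ksets n s. k \<le> card (reach n s {S} H)}"

definition big_components :: "nat \<Rightarrow> nat \<Rightarrow> nat \<Rightarrow> nat set set \<Rightarrow> nat set set set" where
  "big_components n s k H = (\<lambda>S. reach n s {S} H) ` big_sets n s k H"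

lemma finite_big_sets [simp]: "finite (big_sets n s k H)"
  by (simp add: big_sets_def)

lemma finite_big_components [simp]: "finite (big_components n s k H)"
  by (simp add: big_components_def)

lemma reach_subset_big_sets:
  assumes "S \<in> big_sets n s k H"
  shows "reach n s {S} H \<subseteq> big_sets n s k H"
  using assms reach_subset[of n s "{S}" H] by (auto simp: big_sets_def reach_singleton_eq)

lemma big_sets_eq: "card (big_sets n s k H) = (n choose s) - small_count n s k H"
  "small_count n s k H \<le> n choose s"
proof -
  have "ksets n s = big_sets n s k H \<union> {S\<in>ksets n s. card (reach n s {S} H) < k}"
    by (auto simp: big_sets_def)
  moreover have "big_sets n s k H \<inter> {S\<in>ksets n s. card (reach n s {S} H) < k} = {}"
    by (auto simp: big_sets_def)
  ultimately have "card (ksets n s) = card (big_sets n s k H) + small_count n s k H"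
    unfolding small_count_def by (metis (no_types, lifting) card_Un_disjoint finite_Un finite_ksets)
  then show "card (big_sets n s k H) = (n choose s) - small_count n s k H" "small_count n s k H \<le> n choose s"
    by (auto simp: card_ksets)
qed

lemma card_big_components: "card (big_components n s k H) * k \<le> n choose s"
proof -
  let ?C = "big_components n s k H"
  have "pairwise disjnt ?C"
  proof (rule pairwiseI)
    fix C C' assume C: "C \<in> ?C" "C' \<in> ?C" "C \<noteq> C'"
    then obtain S S' where "C = reach n s {S} H" "C' = reach n s {S'} H"
      by (auto simp: big_components_def)
    then show "disjnt C C'" using C(3) reach_singleton_eq by (metis disjnt_iff)
  qed
  then have "card (\<Union>?C) = (\<Sum>C\<in>?C. card C)"
    by (rule card_Union_disjoint) (auto simp: big_components_def)
  also have "\<dots> \<ge> (\<Sum>C\<in>?C. k)"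
    by (rule sum_mono) (auto simp: big_components_def big_sets_def)
  finally have "card ?C * k \<le> card (\<Union>?C)" by simp
  also have "\<dots> \<le> card (ksets n s)"
    by (intro card_mono) (auto simp: big_components_def dest: subsetD[OF reach_subset])
  finally show ?thesis by (simp add: card_ksets)
qed

text \<open>A set \<open>T\<close> of big sets that is closed under connection in
  \<open>H0 \<union> H1\<close> is a union of big \<open>H0\<close>-components, so by
  \<open>conn\<close> either \<open>T\<close> or its complement is below \<open>x\<close>. If some
  class has at least \<open>x\<close> big sets, it therefore misses fewer than \<open>x\<close>.
  Otherwise some classes unite to a size between \<open>x\<close> and \<open>2 * x\<close>, and the
  factor 3 leaves at least \<open>x\<close> outside, a contradiction.\<close>

lemma giant_of_connecting:
  fixes x :: real
  assumes x: "0 < x" "3 * x \<le> real (card (big_sets n s k H0))"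
    and conn: "\<And>\<T>. \<T> \<subseteq> big_components n s k H0 \<Longrightarrow> x \<le> real (card (\<Union>\<T>)) \<Longrightarrow>
      x \<le> real (card (\<Union>(big_components n s k H0 - \<T>))) \<Longrightarrow>
      reach n s (\<Union>\<T>) H1 \<inter> \<Union>(big_components n s k H0 - \<T>) \<noteq> {}"
  shows "\<exists>S\<in>ksets n s. real (card (big_sets n s k H0)) - x \<le> real (card (reach n s {S} (H0 \<union> H1)))"
proof -
  let ?B = "big_sets n s k H0" and ?C = "big_components n s k H0" and ?H = "H0 \<union> H1"
  have Bk: "?B \<subseteq> ksets n s" by (auto simp: big_sets_def)
  have split: "real (card T) < x \<or> real (card (?B - T)) < x"
    if T: "T \<subseteq> ?B" and cl: "\<And>S. S \<in> T \<Longrightarrow> reach n s {S} ?H \<inter> ?B \<subseteq> T" for T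
  proof (rule ccontr)
    assume big: "\<not> (real (card T) < x \<or> real (card (?B - T)) < x)"
    define \<T> where "\<T> = {C\<in>?C. C \<subseteq> T}"
    have in_T: "reach n s {S} H0 \<subseteq> T" if "S \<in> T" for S
      using reach_subset_big_sets[of S n s k H0] reach_mono[of H0 ?H n s "{S}"] T cl[OF that] that by blast
    have U1: "\<Union>\<T> = T"
    proof
      show "T \<subseteq> \<Union>\<T>"
      proof
        fix S assume S: "S \<in> T"
        then have "reach n s {S} H0 \<in> \<T>" using in_T T by (auto simp: \<T>_def big_components_def)
        then show "S \<in> \<Union>\<T>" using reach_self[of S n s H0] S T Bk by blast
      qed
    qed (auto simp: \<T>_def)
    have U2: "\<Union>(?C - \<T>) = ?B - T"
    proof
      show "\<Union>(?C - \<T>) \<subseteq> ?B - T"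
      proof
        fix S' assume "S' \<in> \<Union>(?C - \<T>)"
        then obtain S where S: "S \<in> ?B" "S' \<in> reach n s {S} H0" "\<not> reach n s {S} H0 \<subseteq> T"
          by (auto simp: \<T>_def big_components_def)
        then have "S' \<notin> T" using in_T[of S'] reach_singleton_eq[OF S(2)] by auto
        moreover have "S' \<in> ?B" using reach_subset_big_sets[OF S(1)] S(2) by auto
        ultimately show "S' \<in> ?B - T" by simp
      qed
      show "?B - T \<subseteq> \<Union>(?C - \<T>)"
      proof
        fix S assume S: "S \<in> ?B - T"
        then have "S \<in> reach n s {S} H0" using Bk reach_self by blast
        moreover from this S have "reach n s {S} H0 \<in> ?C - \<T>"
          by (auto simp: \<T>_def big_components_def)
        ultimately show "S \<in> \<Union>(?C - \<T>)" by blast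
      qed
    qed
    have "reach n s (\<Union>\<T>) H1 \<inter> \<Union>(?C - \<T>) \<noteq> {}"
    proof (rule conn)
      show "\<T> \<subseteq> ?C" by (auto simp: \<T>_def)
    qed (use big in \<open>auto simp only: U1 U2 not_less\<close>)
    then obtain S' where S': "S' \<in> reach n s T H1" "S' \<in> ?B - T" by (auto simp: U1 U2)
    then obtain S where S: "S \<in> T" "S' \<in> reach n s {S} H1" by (auto simp: reach_UN[of n s T])
    then have "S' \<in> reach n s {S} ?H" using reach_mono[of H1 ?H n s "{S}"] by auto
    then show False using cl[OF S(1)] S' by auto
  qed
  let ?P = "\<lambda>S. reach n s {S} ?H \<inter> ?B"
  have cl: "reach n s {S'} ?H \<inter> ?B \<subseteq> ?P S" if "S' \<in> ?P S" for S S'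
    using that reach_singleton_eq[of S' n s S ?H] by auto
  show ?thesis
  proof (cases "\<exists>S\<in>?B. x \<le> real (card (?P S))")
    case True
    then obtain S where S: "S \<in> ?B" "x \<le> real (card (?P S))" by auto
    have "real (card (?B - ?P S)) < x" using split[of "?P S"] cl[of _ S] S by auto
    moreover have "card ?B \<le> card (?P S) + card (?B - ?P S)"
      using card_Un_le[of "?P S" "?B - ?P S"] by (simp add: Un_absorb1 Int_Un_distrib2)
    moreover have "card (?P S) \<le> card (reach n s {S} ?H)" by (intro card_mono) auto
    ultimately have "real (card ?B) - x \<le> real (card (reach n s {S} ?H))" by linarith
    then show ?thesis using S Bk by auto
  next
    case False
    have "S \<in> ?P S" if "S \<in> ?B" for S
      using reach_self[of S n s ?H] Bk that by auto
    then have U: "\<Union>(?P ` ?B) = ?B" by (intro equalityI subsetI) auto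
    have "\<exists>\<D>\<subseteq>?P ` ?B. x \<le> real (card (\<Union>\<D>)) \<and> real (card (\<Union>\<D>)) < 2 * x"
    proof (rule greedy_union)
      show "x \<le> real (card (\<Union>(?P ` ?B)))" unfolding U using x by linarith
    qed (use False x in \<open>auto simp: not_le\<close>)
    then obtain \<D> where D: "\<D> \<subseteq> ?P ` ?B" "x \<le> real (card (\<Union>\<D>))" "real (card (\<Union>\<D>)) < 2 * x" by auto
    have sub: "\<Union>\<D> \<subseteq> ?B" using D(1) by auto
    have "real (card (?B - \<Union>\<D>)) < x"
      using split[OF sub] cl D by (smt (verit, best) UnionE UnionI imageE subset_iff)
    moreover have "card ?B = card (\<Union>\<D>) + card (?B - \<Union>\<D>)"
      using sub by (metis card_Diff_subset card_mono finite_big_sets finite_subset le_add_diff_inverse)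
    ultimately show ?thesis using D(3) x by linarith
  qed
qed

lemma bexp_no_giant_le:
  fixes x :: real
  assumes p: "0 \<le> p" "p \<le> 1" and x: "0 < x" "3 * x \<le> real (card (big_sets n s k H0))" and c: "0 \<le> c"
    and merge: "\<And>A B. A \<subseteq> ksets n s \<Longrightarrow> B \<subseteq> ksets n s \<Longrightarrow> x \<le> real (card B) \<Longrightarrow>
      bexp (ksets n r) p (\<lambda>H. of_bool (reach n s A H \<inter> B = {})) \<le> exp (- (c * real (card A)))"
  shows "bexp (ksets n r) p (\<lambda>H1. of_bool (\<not> (\<exists>S\<in>ksets n s.
      real (card (big_sets n s k H0)) - x \<le> real (card (reach n s {S} (H0 \<union> H1)))))) \<le>
    2 ^ card (big_components n s k H0) * exp (- (c * x))"
proof -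
  let ?C = "big_components n s k H0"
  define \<X> where "\<X> = {\<T>. \<T> \<subseteq> ?C \<and> x \<le> real (card (\<Union>\<T>)) \<and> x \<le> real (card (\<Union>(?C - \<T>)))}"
  have X: "\<X> \<subseteq> Pow ?C" by (auto simp: \<X>_def)
  then have finX: "finite \<X>" by (rule finite_subset) simp
  have sub: "\<Union>\<T> \<subseteq> ksets n s" if "\<T> \<subseteq> ?C" for \<T>
    using that by (auto simp: big_components_def dest!: subsetD[OF reach_subset])
  have "bexp (ksets n r) p (\<lambda>H1. of_bool (\<not> (\<exists>S\<in>ksets n s.
      real (card (big_sets n s k H0)) - x \<le> real (card (reach n s {S} (H0 \<union> H1)))))) \<le>
    bexp (ksets n r) p (\<lambda>H1. \<Sum>\<T>\<in>\<X>. of_bool (reach n s (\<Union>\<T>) H1 \<inter> \<Union>(?C - \<T>) = {}))"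
  proof (rule bexp_mono[OF p])
    fix H1
    show "of_bool (\<not> (\<exists>S\<in>ksets n s.
        real (card (big_sets n s k H0)) - x \<le> real (card (reach n s {S} (H0 \<union> H1))))) \<le>
      (\<Sum>\<T>\<in>\<X>. of_bool (reach n s (\<Union>\<T>) H1 \<inter> \<Union>(?C - \<T>) = {}) :: real)"
    proof (cases "\<exists>\<T>\<in>\<X>. reach n s (\<Union>\<T>) H1 \<inter> \<Union>(?C - \<T>) = {}")
      case True
      then obtain \<T> where T: "\<T> \<in> \<X>" "reach n s (\<Union>\<T>) H1 \<inter> \<Union>(?C - \<T>) = {}" by auto
      have "1 \<le> (\<Sum>\<T>\<in>\<X>. of_bool (reach n s (\<Union>\<T>) H1 \<inter> \<Union>(?C - \<T>) = {}) :: real)"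
        using member_le_sum[of \<T> \<X> "\<lambda>\<T>. of_bool (reach n s (\<Union>\<T>) H1 \<inter> \<Union>(?C - \<T>) = {}) :: real"] T finX
        by simp
      then show ?thesis by (simp only: of_bool_def split: if_split) auto
    next
      case False
      then have "\<exists>S\<in>ksets n s. real (card (big_sets n s k H0)) - x \<le> real (card (reach n s {S} (H0 \<union> H1)))"
        using x by (intro giant_of_connecting) (auto simp: \<X>_def)
      then have "of_bool (\<not> (\<exists>S\<in>ksets n s.
        real (card (big_sets n s k H0)) - x \<le> real (card (reach n s {S} (H0 \<union> H1))))) = (0::real)" by simp
      also have "\<dots> \<le> (\<Sum>\<T>\<in>\<X>. of_bool (reach n s (\<Union>\<T>) H1 \<inter> \<Union>(?C - \<T>) = {}))"
        by (intro sum_nonneg) auto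
      finally show ?thesis .
    qed
  qed
  also have "\<dots> = (\<Sum>\<T>\<in>\<X>. bexp (ksets n r) p (\<lambda>H1. of_bool (reach n s (\<Union>\<T>) H1 \<inter> \<Union>(?C - \<T>) = {})))"
    by (rule bexp_sum)
  also have "\<dots> \<le> (\<Sum>\<T>\<in>\<X>. exp (- (c * x)))"
  proof (rule sum_mono)
    fix \<T> assume T: "\<T> \<in> \<X>"
    have "bexp (ksets n r) p (\<lambda>H1. of_bool (reach n s (\<Union>\<T>) H1 \<inter> \<Union>(?C - \<T>) = {})) \<le>
        exp (- (c * real (card (\<Union>\<T>))))"
      using T by (intro merge sub) (auto simp: \<X>_def)
    also have "\<dots> \<le> exp (- (c * x))" using T c by (auto simp: \<X>_def intro: mult_left_mono)
    finally show "bexp (ksets n r) p (\<lambda>H1. of_bool (reach n s (\<Union>\<T>) H1 \<inter> \<Union>(?C - \<T>) = {})) \<le> exp (- (c * x))" .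
  qed
  also have "\<dots> = real (card \<X>) * exp (- (c * x))" by simp
  also have "\<dots> \<le> 2 ^ card ?C * exp (- (c * x))"
  proof -
    have "card \<X> \<le> card (Pow ?C)" using X by (intro card_mono) auto
    then have "real (card \<X>) \<le> 2 ^ card ?C" by (simp add: card_Pow)
    then show ?thesis by (intro mult_right_mono) auto
  qed
  finally show ?thesis .
qed

text \<open>Lowering \<open>c\<close> frees density for sprinkling while the root moves up by less
  than \<open>d\<close>. At \<open>\<sigma> + d\<close> the inequality
  \<open>exp (c * (t ^ m - 1)) < t\<close> is strict and survives a small decrease of
  \<open>c\<close>; a new root \<open>\<sigma>0\<close> at or above that point would contradict
  it.\<close>

lemma root_perturb:
  fixes c :: real and m :: nat
  assumes c: "0 < c" and m: "1 \<le> m" and cm: "1 < c * real m" and sg: "0 < \<sigma>" and d: "0 < d" "\<sigma> + d < 1"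
    and above: "\<And>t. \<sigma> < t \<Longrightarrow> t < 1 \<Longrightarrow> exp (c * (t ^ m - 1)) < t"
  shows "\<exists>c0 \<sigma>0. 0 < c0 \<and> c0 < c \<and> 1 < c0 * real m \<and> 0 < \<sigma>0 \<and> \<sigma>0 < \<sigma> + d \<and>
    (\<forall>u. 0 \<le> u \<and> u < \<sigma>0 \<longrightarrow> u < exp (c0 * (u ^ m - 1))) \<and>
    (\<forall>t. \<sigma>0 < t \<and> t < 1 \<longrightarrow> exp (c0 * (t ^ m - 1)) < t)"
proof -
  let ?t = "\<sigma> + d"
  have lim: "((\<lambda>c0. exp (c0 * (?t ^ m - 1))) \<longlongrightarrow> exp (c * (?t ^ m - 1))) (at_left c)"
    "((\<lambda>c0. c0 * real m) \<longlongrightarrow> c * real m) (at_left c)" "((\<lambda>c0. c0) \<longlongrightarrow> c) (at_left c)"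
    by (intro tendsto_intros)+
  have ab: "exp (c * (?t ^ m - 1)) < ?t" using above[of ?t] d by simp
  have left: "\<forall>\<^sub>F c0 in at_left c. c0 < c" by (simp add: eventually_at_filter)
  have "\<forall>\<^sub>F c0 in at_left c. exp (c0 * (?t ^ m - 1)) < ?t \<and> 1 < c0 * real m \<and> 0 < c0 \<and> c0 < c"
    using order_tendstoD(2)[OF lim(1) ab] order_tendstoD(1)[OF lim(2) cm]
      order_tendstoD(1)[OF lim(3) c] left
    by eventually_elim auto
  then obtain c0 where c0: "exp (c0 * (?t ^ m - 1)) < ?t" "1 < c0 * real m" "0 < c0" "c0 < c"
    using eventually_happens by (force simp: trivial_limit_at_left_real)
  obtain \<sigma>0 where \<sigma>0: "0 < \<sigma>0" "\<sigma>0 < 1" "\<sigma>0 = exp (c0 * (\<sigma>0 ^ m - 1))"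
    "\<forall>u. 0 \<le> u \<and> u < \<sigma>0 \<longrightarrow> u < exp (c0 * (u ^ m - 1))"
    "\<forall>t. \<sigma>0 < t \<and> t < 1 \<longrightarrow> exp (c0 * (t ^ m - 1)) < t"
    using extinction_root[OF c0(3) m c0(2)] by blast
  have "\<sigma>0 < ?t"
  proof (rule ccontr)
    assume "\<not> \<sigma>0 < ?t"
    then consider "?t = \<sigma>0" | "?t < \<sigma>0" by linarith
    then show False
    proof cases
      case 1
      then show ?thesis using c0(1) \<sigma>0(3) by simp
    next
      case 2
      then have "?t < exp (c0 * (?t ^ m - 1))" using \<sigma>0(4) sg d by auto
      then show ?thesis using c0(1) by simp
    qed
  qed
  then show ?thesis using c0 \<sigma>0 by blast
qed

lemma eventually_giant:
  assumes s: "1 \<le> s" "s < r" and c: "0 < c" and m: "m = (r choose s) - 1" and cm: "1 < c * real m"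
    and sg: "0 < \<sigma>" "\<sigma> < 1"
    and above: "\<And>t. \<sigma> < t \<Longrightarrow> t < 1 \<Longrightarrow> exp (c * (t ^ m - 1)) < t"
    and del: "0 < \<delta>" and e: "0 < e"
  shows "\<forall>\<^sub>F n in sequentially. bexp (ksets n r) (c / real (n choose (r - s)))
    (\<lambda>H. of_bool (\<not> (\<exists>S\<in>ksets n s. (1 - \<sigma> - \<delta>) * real (n choose s) \<le> real (card (reach n s {S} H))))) \<le> e"
proof -
  \<comment> \<open>In units of \<open>n choose s\<close>: small sets of \<open>H0\<close> take at
    most \<open>\<sigma> + 2 * d\<close> (one \<open>d\<close> for \<open>\<sigma>0\<close>, one for
    the deviation), and merging loses another \<open>d\<close>. So
    \<open>3 * d \<le> \<delta>\<close> gives the size, and \<open>5 * d \<le> 1 - \<sigma>\<close>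
    the factor 3 in \<open>giant_of_connecting\<close>.\<close>
  define d where "d = min \<delta> (1 - \<sigma>) / 8"
  have d: "0 < d" "8 * d \<le> \<delta>" "8 * d \<le> 1 - \<sigma>" using del sg by (auto simp: d_def)
  have m1: "1 \<le> m" using cm c by (cases m) auto
  have "\<sigma> + d < 1" using d sg by linarith
  from root_perturb[OF c m1 cm sg(1) d(1) this above]
  obtain c0 \<sigma>0 where c0: "0 < c0" "c0 < c" "1 < c0 * real m" and \<sigma>0: "0 < \<sigma>0" "\<sigma>0 < \<sigma> + d"
    and below0: "\<And>u. 0 \<le> u \<Longrightarrow> u < \<sigma>0 \<Longrightarrow> u < exp (c0 * (u ^ m - 1))"
    and above0: "\<And>t. \<sigma>0 < t \<Longrightarrow> t < 1 \<Longrightarrow> exp (c0 * (t ^ m - 1)) < t" by auto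
  have "\<sigma>0 < 1" "0 < c - c0" "0 < e / 2" using \<sigma>0 d c0 e by linarith+
  obtain b where b: "0 < b" and merge: "\<forall>\<^sub>F n in sequentially. \<forall>p A B. (c - c0) / real (n choose (r - s)) \<le> p \<longrightarrow> p \<le> 1 \<longrightarrow>
    A \<subseteq> ksets n s \<longrightarrow> B \<subseteq> ksets n s \<longrightarrow> d * real (n choose s) \<le> real (card B) \<longrightarrow>
    bexp (ksets n r) p (\<lambda>H. of_bool (reach n s A H \<inter> B = {})) \<le> exp (- (b * real (card A)))"
    using eventually_merge[OF s d(1) \<open>0 < c - c0\<close>] by blast
  obtain k0 where k0: "\<And>k. k0 \<le> k \<Longrightarrow> \<forall>\<^sub>F n in sequentially. bexp (ksets n r) (c0 / real (n choose (r - s)))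
    (\<lambda>H. of_bool (d * real (n choose s) < \<bar>real (small_count n s k H) - \<sigma>0 * real (n choose s)\<bar>)) \<le> e / 2"
    using eventually_small_count[OF s c0(1) m \<sigma>0(1) \<open>\<sigma>0 < 1\<close> below0 above0 d(1) \<open>0 < e / 2\<close>] by blast
  \<comment> \<open>With \<open>N = n choose s\<close>, this makes the number
    \<open>2 ^ (N / k)\<close> of divisions at most \<open>exp (b * d * N / 2)\<close>, which uses
    up half of the exponent \<open>b * d * N\<close> of the failure probability.\<close>
  obtain k1 :: nat where k1: "2 * ln 2 / (b * d) \<le> real k1" using real_arch_simple by blast
  define k where "k = Suc (max k0 k1)"
  have "2 * ln 2 / (b * d) \<le> real k" using k1 by (simp add: k_def)
  then have kb: "2 * ln 2 \<le> real k * (b * d)" using b d by (simp add: pos_divide_le_eq)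
  have "filterlim (\<lambda>n. b * d / 2 * real (n choose s)) at_top sequentially"
    using b d by (intro filterlim_tendsto_pos_mult_at_top[OF tendsto_const _ filterlim_choose_at_top[OF s(1)]]) auto
  then have "((\<lambda>n. exp (- (b * d / 2 * real (n choose s)))) \<longlongrightarrow> 0) sequentially"
    by (intro filterlim_compose[OF exp_at_bot] filterlim_compose[OF filterlim_uminus_at_bot_at_top])
  then have ex: "\<forall>\<^sub>F n in sequentially. exp (- (b * d / 2 * real (n choose s))) < e / 2"
    by (rule order_tendstoD(2)) (use e in auto)
  have k: "k0 \<le> k" by (simp add: k_def)
  show ?thesis
    using merge k0[OF k] ex eventually_choose_inverse_less[OF s(2), of c] eventually_ge_at_top[of r]
  proof eventually_elim
    case (elim n)
    let ?M = "real (n choose (r - s))" and ?N = "real (n choose s)" and ?X = "ksets n r"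
    define p0 where "p0 = c0 / ?M" define p1 where "p1 = (c - c0) / ?M" define p where "p = c / ?M"
    have M0: "0 < ?M" "0 < ?N" using elim(5) s by auto
    have p01: "p0 + p1 = p" by (simp add: p0_def p1_def p_def add_divide_distrib[symmetric])
    have nn: "0 \<le> p0" "0 \<le> p1" "p < 1" using c0 elim(4) M0 by (auto simp: p0_def p1_def p_def)
    then have P: "0 \<le> p0" "p0 \<le> 1" "0 \<le> p1" "p1 \<le> 1" using p01 by auto
    define NG where "NG = (\<lambda>H. \<not> (\<exists>S\<in>ksets n s. (1 - \<sigma> - \<delta>) * ?N \<le> real (card (reach n s {S} H))))"
    define dev where "dev = (\<lambda>H. d * ?N < \<bar>real (small_count n s k H) - \<sigma>0 * ?N\<bar>)"
    have NG_anti: "NG H" if "NG G" "H \<subseteq> G" for H G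
    proof -
      have "card (reach n s {S} H) \<le> card (reach n s {S} G)" for S
        using that(2) by (intro card_mono reach_mono finite_reach)
      then show ?thesis using that(1) unfolding NG_def by (meson of_nat_le_iff order_trans)
    qed
    \<comment> \<open>The two rounds together have a density slightly below
      \<open>p0 + p1 = p\<close>; having no giant is a decreasing property, so this only increases
      its probability.\<close>
    have "bexp ?X p (\<lambda>H. of_bool (NG H)) \<le> bexp ?X (p0 + p1 - p0 * p1) (\<lambda>H. of_bool (NG H))"
    proof (rule bexp_antimono)
      have "p0 * p1 \<le> p0 * 1" using P by (intro mult_left_mono) auto
      then show "0 \<le> p0 + p1 - p0 * p1" using P by linarith
      show "p0 + p1 - p0 * p1 \<le> p" using P p01 by simp
    qed (use nn NG_anti in \<open>auto split: split_of_bool\<close>)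
    also have "\<dots> = bexp ?X p0 (\<lambda>H0. bexp ?X p1 (\<lambda>H1. of_bool (NG (H0 \<union> H1))))"
      by (rule bexp_union[symmetric, where f = "\<lambda>H. of_bool (NG H)", OF finite_ksets])
    also have "\<dots> \<le> bexp ?X p0 (\<lambda>H0. of_bool (dev H0) + exp (- (b * d / 2 * ?N)))"
    proof (rule bexp_mono[OF P(1,2)])
      fix H0
      show "bexp ?X p1 (\<lambda>H1. of_bool (NG (H0 \<union> H1))) \<le> of_bool (dev H0) + exp (- (b * d / 2 * ?N))"
      proof (cases "dev H0")
        case True
        have "bexp ?X p1 (\<lambda>H1. of_bool (NG (H0 \<union> H1))) \<le> 1" using P by (intro bexp_le_const) auto
        then show ?thesis using True by (simp add: add_increasing2)
      next
        case False
        let ?b = "real (card (big_sets n s k H0))"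
        have "real (small_count n s k H0) \<le> (\<sigma>0 + d) * ?N"
          using False by (simp add: dev_def algebra_simps)
        also have "\<dots> \<le> (\<sigma> + 2 * d) * ?N" using \<sigma>0 M0 by (intro mult_right_mono) auto
        finally have bN: "(1 - \<sigma> - 2 * d) * ?N \<le> ?b"
          using big_sets_eq[of n s k H0] by (simp add: of_nat_diff algebra_simps)
        have "(1 - \<sigma> - \<delta>) * ?N \<le> (1 - \<sigma> - 3 * d) * ?N" using d M0 by (intro mult_right_mono) auto
        also have "\<dots> = (1 - \<sigma> - 2 * d) * ?N - d * ?N" by (simp add: algebra_simps)
        finally have g: "(1 - \<sigma> - \<delta>) * ?N \<le> ?b - d * ?N" using bN by linarith
        have "3 * (d * ?N) \<le> (1 - \<sigma> - 2 * d) * ?N"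
          using d M0 by (subst mult.assoc[symmetric], intro mult_right_mono) auto
        then have x: "0 < d * ?N" "3 * (d * ?N) \<le> ?b" using mult_pos_pos[OF d(1) M0(2)] bN by linarith+
        have "bexp ?X p1 (\<lambda>H1. of_bool (NG (H0 \<union> H1))) \<le>
          bexp ?X p1 (\<lambda>H1. of_bool (\<not> (\<exists>S\<in>ksets n s. ?b - d * ?N \<le> real (card (reach n s {S} (H0 \<union> H1))))))"
        proof (rule bexp_mono[OF P(3,4)])
          fix H1
          have "NG (H0 \<union> H1) \<Longrightarrow> \<not> (\<exists>S\<in>ksets n s. ?b - d * ?N \<le> real (card (reach n s {S} (H0 \<union> H1))))"
            using g unfolding NG_def by (meson order_trans)
          then show "of_bool (NG (H0 \<union> H1)) \<le>
              (of_bool (\<not> (\<exists>S\<in>ksets n s. ?b - d * ?N \<le> real (card (reach n s {S} (H0 \<union> H1))))) :: real)"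
            by (simp only: of_bool_def split: if_split) auto
        qed
        also have "\<dots> \<le> 2 ^ card (big_components n s k H0) * exp (- (b * (d * ?N)))"
          using b elim(1) P by (intro bexp_no_giant_le[OF P(3,4) x]) (auto simp: p1_def)
        also have "\<dots> \<le> exp (b * d / 2 * ?N) * exp (- (b * (d * ?N)))"
        proof (rule mult_right_mono)
          let ?q = "real (card (big_components n s k H0))"
          have "?q * real k \<le> ?N"
            using card_big_components[of n s k H0] by (metis of_nat_le_iff of_nat_mult)
          then have "(?q * real k) * (b * d) \<le> ?N * (b * d)" using b d by (intro mult_right_mono) auto
          moreover have "?q * (2 * ln 2) \<le> ?q * (real k * (b * d))" using kb by (intro mult_left_mono) auto
          ultimately have "?q * ln 2 \<le> b * d / 2 * ?N" by (simp add: mult_ac)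
          then have "exp (?q * ln 2) \<le> exp (b * d / 2 * ?N)" by simp
          then show "2 ^ card (big_components n s k H0) \<le> exp (b * d / 2 * ?N)"
            by (simp add: exp_of_nat_mult)
        qed simp
        also have "\<dots> = exp (- (b * d / 2 * ?N))" by (simp add: exp_add[symmetric])
        finally show ?thesis using False by simp
      qed
    qed
    also have "\<dots> = bexp ?X p0 (\<lambda>H0. of_bool (dev H0)) + exp (- (b * d / 2 * ?N))"
      by (simp add: bexp_add bexp_const)
    also have "\<dots> \<le> e" using elim(2,3) by (simp add: p0_def dev_def)
    finally show ?case by (simp add: p_def NG_def)
  qed
qed

section \<open>The phase transition\<close>

lemma prob_hg_tendsto_1:
  assumes p: "\<forall>\<^sub>F n in sequentially. 0 \<le> p n \<and> p n \<le> 1"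
    and le: "\<And>e. 0 < e \<Longrightarrow> \<forall>\<^sub>F n in sequentially. bexp (ksets n r) (p n) (\<lambda>H. of_bool (\<not> P n H)) \<le> e"
  shows "(\<lambda>n. prob_hg n r (p n) (P n)) \<longlonglongrightarrow> 1"
proof (rule tendstoI)
  fix e :: real assume e: "0 < e"
  then have "0 < e / 2" by simp
  from le[OF this] p show "\<forall>\<^sub>F n in sequentially. dist (prob_hg n r (p n) (P n)) 1 < e"
  proof eventually_elim
    case (elim n)
    have "0 \<le> bexp (ksets n r) (p n) (\<lambda>H. of_bool (\<not> P n H))" using elim by (intro bexp_nonneg) auto
    then show ?case using elim(1) e unfolding prob_hg_bexp by (simp add: bexp_compl dist_real_def)
  qed
qed

section \<open>Union bounds and logarithmic thresholds\<close>

lemma bexp_Bex_le: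
  assumes "finite I" "0 \<le> p" "p \<le> 1"
  shows "bexp X p (\<lambda>H. of_bool (\<exists>i\<in>I. P i H)) \<le> (\<Sum>i\<in>I. bexp X p (\<lambda>H. of_bool (P i H)))"
proof -
  have "bexp X p (\<lambda>H. of_bool (\<exists>i\<in>I. P i H)) \<le> bexp X p (\<lambda>H. \<Sum>i\<in>I. of_bool (P i H))"
  proof (intro bexp_mono assms(2,3))
    fix H
    show "of_bool (\<exists>i\<in>I. P i H) \<le> (\<Sum>i\<in>I. of_bool (P i H) :: real)"
    proof (cases "\<exists>i\<in>I. P i H")
      case True
      then obtain i where "i \<in> I" "P i H" by auto
      then have "1 \<le> (\<Sum>i\<in>I. of_bool (P i H) :: real)"
        using member_le_sum[of i I "\<lambda>i. of_bool (P i H) :: real"] assms(1) by simp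
      then show ?thesis by (simp only: of_bool_def split: if_split) auto
    qed (auto intro: sum_nonneg)
  qed
  then show ?thesis by (simp only: bexp_sum)
qed

text \<open>The exponent \<open>Suc s\<close> leaves \<open>O(1 / n)\<close> after a union bound
  over the at most \<open>n ^ s\<close> s-sets.\<close>

lemma power_log_le:
  fixes l :: real
  assumes "0 < l" "l < 1"
  shows "\<exists>A>0. \<forall>n k. 1 \<le> n \<longrightarrow> A * ln (real n) \<le> real k \<longrightarrow> l ^ k \<le> 1 / real n ^ Suc s"
proof (intro exI conjI allI impI)
  let ?A = "real (Suc s) / (- ln l)"
  have l: "ln l < 0" using assms by simp
  then show "0 < ?A" by (intro divide_pos_pos) auto
  fix n k :: nat assume n: "1 \<le> n" and k: "?A * ln (real n) \<le> real k"
  have "real k * ln l \<le> (?A * ln (real n)) * ln l" using k l by (intro mult_right_mono_neg) auto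
  also have "\<dots> = - (real (Suc s) * ln (real n))" using l by (simp add: field_simps)
  finally have "exp (real k * ln l) \<le> exp (- (real (Suc s) * ln (real n)))" by simp
  moreover have "exp (real k * ln l) = l ^ k" using assms by (simp add: exp_of_nat_mult)
  moreover have "exp (real (Suc s) * ln (real n)) = real n ^ Suc s" using n by (subst exp_of_nat_mult) simp
  ultimately show "l ^ k \<le> 1 / real n ^ Suc s" by (simp add: exp_minus inverse_eq_divide)
qed

text \<open>Turns a threshold \<open>A * ln n\<close> into an integer; the constant
  \<open>A + 1\<close> absorbs the rounding once \<open>ln n \<ge> 1\<close>.\<close>

lemma nat_ceiling_bounds:
  fixes A L :: real
  assumes "0 \<le> A" "1 \<le> L"
  shows "A * L \<le> real (nat \<lceil>A * L\<rceil>)" "real (nat \<lceil>A * L\<rceil>) \<le> (A + 1) * L"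
proof -
  have "0 \<le> A * L" using assms by simp
  then have "real (nat \<lceil>A * L\<rceil>) = of_int \<lceil>A * L\<rceil>" by simp
  then show "A * L \<le> real (nat \<lceil>A * L\<rceil>)" "real (nat \<lceil>A * L\<rceil>) \<le> (A + 1) * L"
    using assms of_int_ceiling_le_add_one[of "A * L"] by (simp_all only: le_of_int_ceiling) (simp add: algebra_simps)
qed

lemma s_components_reach: "s_components n s H = (\<lambda>S. reach n s {S} H) ` ksets n s"
  by (simp add: s_components_def s_component_reach)

lemma subcritical_phase:
  assumes s: "1 \<le> s" "s < r" and c: "0 < c" and m: "m = (r choose s) - 1" and cm: "c * real m < 1"
    and p: "\<forall>\<^sub>F n in sequentially. 0 \<le> p n \<and> p n \<le> c / real (n choose (r - s))"
  shows "\<exists>C. (\<lambda>n. prob_hg n r (p n) (\<lambda>H. \<forall>K\<in>s_components n s H. real (card K) \<le> C * ln (real n))) \<longlonglongrightarrow> 1"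
proof -
  obtain t where t: "1 < t" "exp (c * (t ^ m - 1)) < t" using subcritical_base[OF cm] by auto
  define l where "l = exp (c * (t ^ m - 1)) / t"
  have l: "0 < l" "l < 1" "l * t = exp (c * (t ^ m - 1))" using t by (auto simp: l_def)
  obtain A where A: "0 < A" "\<And>n k. 1 \<le> n \<Longrightarrow> A * ln (real n) \<le> real k \<Longrightarrow> l ^ k \<le> 1 / real n ^ Suc s"
    using power_log_le[OF l(1,2), of s] by blast
  from p eventually_choose_inverse_less[OF s(2), of c] have p1: "\<forall>\<^sub>F n in sequentially. 0 \<le> p n \<and> p n \<le> 1" by eventually_elim auto
  show ?thesis
  proof (intro exI[of _ "A + 1"] prob_hg_tendsto_1[OF p1])
    fix e :: real assume e: "0 < e"
    have "\<forall>\<^sub>F n in sequentially. t / real n < e"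
      by (rule order_tendstoD(2)[of _ 0]) (real_asymp, rule e)
    moreover have "\<forall>\<^sub>F n in sequentially. 1 \<le> ln (real n)" by real_asymp
    ultimately show "\<forall>\<^sub>F n in sequentially. bexp (ksets n r) (p n)
      (\<lambda>H. of_bool (\<not> (\<forall>K\<in>s_components n s H. real (card K) \<le> (A + 1) * ln (real n)))) \<le> e"
      using p p1 eventually_ge_at_top[of r]
    proof eventually_elim
      case (elim n)
      define k where "k = nat \<lceil>A * ln (real n)\<rceil>"
      have k: "A * ln (real n) \<le> real k" "real k \<le> (A + 1) * ln (real n)"
        unfolding k_def using A(1) elim(2) by (intro nat_ceiling_bounds; simp)+
      have P: "0 \<le> p n" "p n \<le> 1" and n: "1 \<le> n" using elim s by auto
      have step: "bexp (through n r E S) (p n) (\<lambda>R. t ^ card (newsets n s (A \<union> E) R)) \<le> l * t"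
        if "S \<in> A" "A \<inter> E = {}" "A \<union> E \<subseteq> ksets n s" for E A S
      proof -
        let ?D = "(n - s) choose (r - s)"
        have "bexp (through n r E S) (p n) (\<lambda>R. t ^ card (newsets n s (A \<union> E) R)) \<le>
            exp (p n * real ?D * (t ^ m - 1))"
          unfolding m using that P t s by (intro bexp_newsets_le_upper) auto
        also have "\<dots> \<le> exp (c * (t ^ m - 1))"
        proof -
          have "p n * real ?D \<le> c / real (n choose (r - s)) * real (n choose (r - s))"
            using elim(3) c by (intro mult_mono) (auto simp: binomial_right_mono)
          also have "\<dots> = c" using elim(5) by simp
          finally show ?thesis using t by (simp add: mult_right_mono)
        qed
        finally show ?thesis using l by simp
      qed
      have one: "bexp (ksets n r) (p n) (\<lambda>H. of_bool (k \<le> card (reach n s {S} H))) \<le> t / real n ^ Suc s"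
        if S: "S \<in> ksets n s" for S
      proof -
        have "bexp (unexplored n r {}) (p n) (\<lambda>H. of_bool (k \<le> card ({} \<union> reach n s {S} H))) \<le>
            t ^ card {S} * l ^ (k - card ({} :: nat set set))"
          using S t l step by (intro explore_subcritical[OF P]) auto
        also have "\<dots> = t * l ^ k" by simp
        also have "\<dots> \<le> t * (1 / real n ^ Suc s)"
          using A(2)[OF n k(1)] t by (intro mult_left_mono) auto
        finally show ?thesis by simp
      qed
      have "bexp (ksets n r) (p n)
          (\<lambda>H. of_bool (\<not> (\<forall>K\<in>s_components n s H. real (card K) \<le> (A + 1) * ln (real n)))) \<le>
        bexp (ksets n r) (p n) (\<lambda>H. of_bool (\<exists>S\<in>ksets n s. k \<le> card (reach n s {S} H)))"
      proof (intro bexp_mono P)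
        fix H
        have "\<exists>S\<in>ksets n s. k \<le> card (reach n s {S} H)"
          if "\<not> (\<forall>K\<in>s_components n s H. real (card K) \<le> (A + 1) * ln (real n))"
          using that k(2) unfolding s_components_reach by fastforce
        then show "of_bool (\<not> (\<forall>K\<in>s_components n s H. real (card K) \<le> (A + 1) * ln (real n))) \<le>
            (of_bool (\<exists>S\<in>ksets n s. k \<le> card (reach n s {S} H)) :: real)"
          by (simp only: of_bool_def split: if_split) auto
      qed
      also have "\<dots> \<le> (\<Sum>S\<in>ksets n s. bexp (ksets n r) (p n) (\<lambda>H. of_bool (k \<le> card (reach n s {S} H))))"
        by (intro bexp_Bex_le P finite_ksets)
      also have "\<dots> \<le> (\<Sum>S\<in>ksets n s. t / real n ^ Suc s)" by (intro sum_mono one)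
      also have "\<dots> = real (n choose s) * (t / real n ^ Suc s)" by (simp add: card_ksets)
      also have "\<dots> \<le> real n ^ s * (t / real n ^ Suc s)"
        using binomial_le_pow[of s n] elim(5) s t by (intro mult_right_mono) (auto simp flip: of_nat_power)
      also have "\<dots> = t / real n" using n by simp
      also have "\<dots> \<le> e" using elim(1) by simp
      finally show ?case .
    qed
  qed
qed

definition one_giant :: "nat \<Rightarrow> nat \<Rightarrow> real \<Rightarrow> real \<Rightarrow> nat set set \<Rightarrow> bool" where
  "one_giant n s g b H \<longleftrightarrow> (\<exists>K\<in>s_components n s H. g \<le> real (card K) \<and>
    (\<forall>K'\<in>s_components n s H. K' \<noteq> K \<longrightarrow> real (card K') \<le> b))"

text \<open>The deterministic part: in a component of \<open>H0 \<union> H1\<close> with at least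
  \<open>k\<close> sets, \<open>grow\<close> finds an \<open>H0\<close>-component with at least
  \<open>k'\<close>, and \<open>attach\<close> joins that one to the component of \<open>SG\<close>.
  So every other component has fewer than \<open>k\<close> sets.\<close>

lemma giant_unique_of_events:
  assumes SG: "SG \<in> ksets n s" "g \<le> real (card (reach n s {SG} H0))"
    and grow: "\<And>S. S \<in> ksets n s \<Longrightarrow> k \<le> card (reach n s {S} (H0 \<union> H1)) \<Longrightarrow>
      \<exists>S'\<in>reach n s {S} (H0 \<union> H1). k' \<le> card (reach n s {S'} H0)"
    and attach: "\<And>S. S \<in> ksets n s \<Longrightarrow> k' \<le> card (reach n s {S} H0) \<Longrightarrow>
      reach n s (reach n s {S} H0) H1 \<inter> reach n s {SG} H0 \<noteq> {}"
    and k: "real k \<le> b"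
  shows "one_giant n s g b (H0 \<union> H1)"
  unfolding one_giant_def
proof (intro bexI conjI ballI impI)
  let ?H = "H0 \<union> H1"
  let ?K = "reach n s {SG} ?H"
  show "?K \<in> s_components n s ?H" using SG by (auto simp: s_components_reach)
  have "card (reach n s {SG} H0) \<le> card ?K" by (intro card_mono finite_reach reach_mono) auto
  then show "g \<le> real (card ?K)" using SG(2) by linarith
  fix K' assume K': "K' \<in> s_components n s ?H" "K' \<noteq> ?K"
  then obtain S where S: "S \<in> ksets n s" "K' = reach n s {S} ?H" by (auto simp: s_components_reach)
  have "card K' < k"
  proof (rule ccontr)
    assume "\<not> card K' < k"
    then obtain S' where S': "S' \<in> reach n s {S} ?H" "k' \<le> card (reach n s {S'} H0)"
      using grow[OF S(1)] S(2) by auto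
    have "S' \<in> ksets n s" using S'(1) reach_subset by blast
    from attach[OF this S'(2)] obtain S1 S2 where
      *: "S1 \<in> reach n s {S'} H0" "S2 \<in> reach n s {S1} H1" "S2 \<in> reach n s {SG} H0"
      by (auto simp: reach_UN[of n s "reach n s {S'} H0"])
    then have "S1 \<in> reach n s {S'} ?H" "S2 \<in> reach n s {S1} ?H" "S2 \<in> reach n s {SG} ?H"
      using reach_mono[of H0 ?H n s] reach_mono[of H1 ?H n s] by blast+
    then have "?K = reach n s {S} ?H" using S'(1) by (metis reach_singleton_eq)
    then show False using K' S by simp
  qed
  then show "real (card K') \<le> b" using k by linarith
qed

lemma supercritical_phase:
  assumes s: "1 \<le> s" "s < r" and c: "0 < c" and m: "m = (r choose s) - 1" and cm: "1 < c * real m"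
  shows "\<exists>C c1. 0 < c1 \<and> (\<forall>p. (\<forall>\<^sub>F n in sequentially. c / real (n choose (r - s)) \<le> p n \<and> p n \<le> 1) \<longrightarrow>
    (\<forall>e>0. \<forall>\<^sub>F n in sequentially. bexp (ksets n r) (p n) (\<lambda>H. of_bool
      (\<not> one_giant n s (c1 * real (n choose s)) (C * ln (real n)) H)) \<le> e))"
proof -
  have m1: "1 \<le> m" using cm c by (cases m) auto
  \<comment> \<open>Midway between the threshold \<open>1 / m\<close> and \<open>c\<close>:
    \<open>H0\<close> alone is supercritical, and \<open>c - c0\<close> remains for
    sprinkling.\<close>
  define c0 where "c0 = (c + 1 / real m) / 2"
  have "1 / real m < c" using cm m1 by (simp add: field_simps)
  then have c0: "0 < c0" "c0 < c" "1 < c0 * real m" using c m1 cm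
    by (auto simp: c0_def add_pos_pos field_simps)
  obtain \<sigma> where \<sigma>: "0 < \<sigma>" "\<sigma> < 1"
    and above: "\<And>t. \<sigma> < t \<Longrightarrow> t < 1 \<Longrightarrow> exp (c0 * (t ^ m - 1)) < t"
    using extinction_root[OF c0(1) m1 c0(3)] by blast
  define \<delta> where "\<delta> = (1 - \<sigma>) / 2"
  define t where "t = (\<sigma> + 1) / 2"
  have \<delta>: "0 < \<delta>" "1 - \<sigma> - \<delta> = \<delta>" and t: "\<sigma> < t" "t < 1" "0 < t" using \<sigma> by (auto simp: \<delta>_def t_def field_simps)
  obtain l where l: "exp (c0 * (t ^ m - 1)) / t < l" "l < 1"
    using dense[of "exp (c0 * (t ^ m - 1)) / t" 1] above[OF t(1,2)] t by auto
  have "0 < exp (c0 * (t ^ m - 1)) / t" using t by simp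
  then have l0: "0 < l" using l(1) by linarith
  have lt: "exp (c0 * (t ^ m - 1)) < l * t" using l(1) t by (simp add: divide_less_eq)
  have cc: "0 < c - c0" using c0 by simp
  obtain b where b: "0 < b" and merge: "\<forall>\<^sub>F n in sequentially. \<forall>p A B. (c - c0) / real (n choose (r - s)) \<le> p \<longrightarrow> p \<le> 1 \<longrightarrow>
    A \<subseteq> ksets n s \<longrightarrow> B \<subseteq> ksets n s \<longrightarrow> \<delta> * real (n choose s) \<le> real (card B) \<longrightarrow>
    bexp (ksets n r) p (\<lambda>H. of_bool (reach n s A H \<inter> B = {})) \<le> exp (- (b * real (card A)))"
    using eventually_merge[OF s \<delta>(1) cc] by blast
  have eb: "0 < exp (- b)" "exp (- b) < 1" using b by auto
  \<comment> \<open>Three logarithmic thresholds, one for each exponential rate: \<open>A1\<close>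
    for component sizes in the union, \<open>A2\<close> for the number of active sets,
    \<open>A3\<close> for the \<open>H0\<close>-components to be attached.\<close>
  obtain A1 where A1: "0 < A1" "\<And>n k. 1 \<le> n \<Longrightarrow> A1 * ln (real n) \<le> real k \<Longrightarrow> l ^ k \<le> 1 / real n ^ Suc s"
    using power_log_le[OF l0 l(2), of s] by blast
  obtain A2 where A2: "0 < A2" "\<And>n k. 1 \<le> n \<Longrightarrow> A2 * ln (real n) \<le> real k \<Longrightarrow> t ^ k \<le> 1 / real n ^ Suc s"
    using power_log_le[OF t(3,2), of s] by blast
  obtain A3 where A3: "0 < A3" "\<And>n k. 1 \<le> n \<Longrightarrow> A3 * ln (real n) \<le> real k \<Longrightarrow> exp (- b) ^ k \<le> 1 / real n ^ Suc s"
    using power_log_le[OF eb, of s] by blast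
  show ?thesis
  proof (rule exI[of _ "A1 + 1"], rule exI[of _ \<delta>], intro conjI allI impI)
    show "0 < \<delta>" by (rule \<delta>(1))
    fix p :: "nat \<Rightarrow> real" and e :: real
    assume p: "\<forall>\<^sub>F n in sequentially. c / real (n choose (r - s)) \<le> p n \<and> p n \<le> 1" and e: "0 < e"
    have "\<forall>\<^sub>F n in sequentially. 3 / real n < e / 2"
      by (rule order_tendstoD(2)[of _ 0]) (real_asymp, use e in simp)
    moreover have "\<forall>\<^sub>F n in sequentially. 1 \<le> ln (real n)" by real_asymp
    moreover note eventually_choose_inverse_less[OF s(2), of c0]
    moreover have "\<forall>\<^sub>F n in sequentially. (A1 + 1) * ln (real n) + (A2 + 1) * ln (real n) * ((A3 + 1) * ln (real n)) +
        (A2 + 1) * ln (real n) + 1 \<le> sqrt (real n)"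
      using A1(1) A2(1) A3(1) by real_asymp
    moreover have "\<forall>\<^sub>F n in sequentially. \<forall>p w. c0 / real (n choose (r - s)) \<le> p \<longrightarrow> p \<le> 1 \<longrightarrow>
        real w \<le> sqrt (real n) \<longrightarrow> step_le n r s p t (l * t) w"
      using lt t unfolding m by (intro eventually_step_le s c0) auto
    moreover have "\<forall>\<^sub>F n in sequentially. \<forall>p w. c0 / real (n choose (r - s)) \<le> p \<longrightarrow> p \<le> 1 \<longrightarrow>
        real w \<le> sqrt (real n) \<longrightarrow> step_le n r s p t t w"
      using above[OF t(1,2)] t unfolding m by (intro eventually_step_le s c0) auto
    moreover have "\<forall>\<^sub>F n in sequentially. bexp (ksets n r) (c0 / real (n choose (r - s)))
      (\<lambda>H. of_bool (\<not> (\<exists>S\<in>ksets n s. (1 - \<sigma> - \<delta>) * real (n choose s) \<le> real (card (reach n s {S} H))))) \<le> e / 2"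
      using e above by (intro eventually_giant[OF s c0(1) m c0(3) \<sigma> _ \<delta>(1)]) auto
    ultimately show "\<forall>\<^sub>F n in sequentially. bexp (ksets n r) (p n) (\<lambda>H. of_bool
      (\<not> one_giant n s (\<delta> * real (n choose s)) ((A1 + 1) * ln (real n)) H)) \<le> e"
      using merge p eventually_ge_at_top[of r]
    proof eventually_elim
      case (elim n)
      let ?X = "ksets n r" and ?M = "real (n choose (r - s))" and ?N = "real (n choose s)" and ?L = "ln (real n)"
      have M0: "0 < ?M" and n1: "1 \<le> n" and sn: "s \<le> n" using elim(10) s by auto
      define p0 where "p0 = c0 / ?M"
      \<comment> \<open>The exact solution of \<open>p0 + p1 - p0 * p1 = p n\<close>. Unlike the
        property in \<open>eventually_giant\<close>, \<open>one_giant\<close> is not monotone in the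
        edges, so the density cannot be lowered and has to be met exactly.\<close>
      define p1 where "p1 = (p n - p0) / (1 - p0)"
      have p0: "0 \<le> p0" "p0 \<le> 1" "p0 < 1" using c0 elim(3) by (auto simp: p0_def)
      have "p0 \<le> c / ?M" using c0 M0 by (auto simp: p0_def divide_right_mono)
      then have p0p: "p0 \<le> p n" "p n \<le> 1" using elim(9) by auto
      have p1: "0 \<le> p1" "p1 \<le> 1" using p0 p0p by (auto simp: p1_def divide_simps)
      have pu: "p0 + p1 - p0 * p1 = p n"
      proof -
        have "p0 + p1 - p0 * p1 = p0 + p1 * (1 - p0)" by (simp add: algebra_simps)
        then show ?thesis using p0(3) by (simp add: p1_def)
      qed
      have p1_ge: "(c - c0) / ?M \<le> p1"
      proof -
        have "(c - c0) / ?M \<le> p n - p0" using elim(9) by (simp add: p0_def diff_divide_distrib)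
        also have "p n - p0 \<le> p1"
          using p0 p0p by (simp add: p1_def le_divide_eq mult_left_le)
        finally show ?thesis .
      qed
      define ceil where "ceil = (\<lambda>A. nat \<lceil>A * ?L\<rceil>)"
      have ceil: "A * ?L \<le> real (ceil A)" "real (ceil A) \<le> (A + 1) * ?L" if "0 < A" for A
        unfolding ceil_def using that elim(2) by (intro nat_ceiling_bounds; simp)+
      define k where "k = ceil A1" define a where "a = ceil A2" define k' where "k' = ceil A3"
      note ck = ceil[OF A1(1), folded k_def] and ca = ceil[OF A2(1), folded a_def] and ck' = ceil[OF A3(1), folded k'_def]
      \<comment> \<open>Of order the square of \<open>ln n\<close>, hence below the
        \<open>sqrt n\<close> up to which the one-step bounds hold.\<close>
      define w where "w = k + a * k' + a + 1"
      have w: "real w \<le> sqrt (real n)"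
      proof -
        have "real a * real k' \<le> ((A2 + 1) * ?L) * ((A3 + 1) * ?L)"
          using ca ck' by (intro mult_mono) auto
        then show ?thesis using elim(4) ck(2) ca(2) by (simp add: w_def)
      qed
      have step0: "step_le n r s p0 t t w" using elim(6) p0 w by (auto simp: p0_def)
      have step: "step_le n r s (p n) t (l * t) w" using elim(5) p0p w by (auto simp: p0_def)
      define giant where "giant = (\<lambda>H0 S. S \<in> ksets n s \<and> \<delta> * ?N \<le> real (card (reach n s {S} H0)))"
      \<comment> \<open>The giant is chosen from \<open>H0\<close> alone, so it is a fixed target
        for the independent \<open>H1\<close> in the bound for \<open>B3\<close>.\<close>
      define SG where "SG = (\<lambda>H0. SOME S. giant H0 S)"
      have SG: "giant H0 (SG H0)" if "\<exists>S. giant H0 S" for H0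
        unfolding SG_def using that by (rule someI_ex)
      \<comment> \<open>The three failures: \<open>H0\<close> has no giant; \<open>S\<close> lies in
        a large component of the union made of small \<open>H0\<close>-components only; the large
        \<open>H0\<close>-component of \<open>S\<close> is not attached by
        \<open>H1\<close>.\<close>
      define B1 where "B1 = (\<lambda>H0. \<not> (\<exists>S. giant H0 S))"
      define B2 where "B2 = (\<lambda>S H0 H1. k \<le> card (reach n s {S} (H0 \<union> H1)) \<and>
        (\<forall>S'\<in>reach n s {S} (H0 \<union> H1). card (reach n s {S'} H0) < k'))"
      define B3 where "B3 = (\<lambda>S H0 H1. (\<exists>S. giant H0 S) \<and> k' \<le> card (reach n s {S} H0) \<and>
        reach n s (reach n s {S} H0) H1 \<inter> reach n s {SG H0} H0 = {})"
      let ?good = "one_giant n s (\<delta> * ?N) ((A1 + 1) * ?L)"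
      have det: "?good (H0 \<union> H1)"
        if nB: "\<not> B1 H0" "\<And>S. S \<in> ksets n s \<Longrightarrow> \<not> B2 S H0 H1 \<and> \<not> B3 S H0 H1" for H0 H1
      proof (rule giant_unique_of_events)
        have g: "giant H0 (SG H0)" using nB(1) SG by (auto simp: B1_def)
        then show "SG H0 \<in> ksets n s" "\<delta> * ?N \<le> real (card (reach n s {SG H0} H0))" by (auto simp: giant_def)
        show "\<exists>S'\<in>reach n s {S} (H0 \<union> H1). k' \<le> card (reach n s {S'} H0)"
          if S: "S \<in> ksets n s" "k \<le> card (reach n s {S} (H0 \<union> H1))" for S
          using nB(2)[OF S(1)] S(2) unfolding B2_def by (auto simp: not_less)
        show "reach n s (reach n s {S} H0) H1 \<inter> reach n s {SG H0} H0 \<noteq> {}"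
          if S: "S \<in> ksets n s" "k' \<le> card (reach n s {S} H0)" for S
          using nB(2)[OF S(1)] S(2) g unfolding B3_def by blast
        show "real k \<le> (A1 + 1) * ?L" by (rule ck(2))
      qed
      have e2: "bexp ?X p0 (\<lambda>H0. bexp ?X p1 (\<lambda>H1. of_bool (B2 S H0 H1))) \<le> 2 / real n ^ Suc s"
        if S: "S \<in> ksets n s" for S
      proof -
        have "bexp (unexplored n r {}) p0 (\<lambda>H0. bexp (unexplored n r {}) p1 (\<lambda>H1.
            of_bool (k \<le> card ({} \<union> reach n s {S} (H0 \<union> H1)) \<and>
              (\<forall>S\<in>reach n s {S} (H0 \<union> H1). card (reach n s {S} H0) < k')))) \<le>
          t ^ card {S} * l ^ (k - card ({} :: nat set set)) + t ^ a"
          using S t l l0 step by (intro explore_two_layers[OF p0(1,2) p1 _ _ _ _ step0]) (auto simp: pu w_def)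
        also have "\<dots> \<le> 1 * (1 / real n ^ Suc s) + 1 / real n ^ Suc s"
          using A1(2)[OF n1 ck(1)] A2(2)[OF n1 ca(1)] t l0 by (intro add_mono mult_mono) auto
        finally show ?thesis by (simp add: B2_def)
      qed
      have e3: "bexp ?X p0 (\<lambda>H0. bexp ?X p1 (\<lambda>H1. of_bool (B3 S H0 H1))) \<le> 1 / real n ^ Suc s" for S
      proof (rule bexp_le_const[OF finite_ksets p0(1,2)])
        fix H0
        show "bexp ?X p1 (\<lambda>H1. of_bool (B3 S H0 H1)) \<le> 1 / real n ^ Suc s"
        proof (cases "(\<exists>S. giant H0 S) \<and> k' \<le> card (reach n s {S} H0)")
          case True
          have "bexp ?X p1 (\<lambda>H1. of_bool (reach n s (reach n s {S} H0) H1 \<inter> reach n s {SG H0} H0 = {})) \<le>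
            exp (- (b * real (card (reach n s {S} H0))))"
            using elim(8) p1_ge p1 reach_subset SG[of H0] True by (auto simp: giant_def)
          also have "\<dots> \<le> exp (- (b * real k'))" using True b by simp
          also have "\<dots> = exp (- b) ^ k'" by (simp add: exp_of_nat_mult[symmetric] mult.commute)
          also have "\<dots> \<le> 1 / real n ^ Suc s" by (rule A3(2)[OF n1 ck'(1)])
          finally show ?thesis using True by (simp add: B3_def)
        next
          case False
          then have "B3 S H0 H1 = False" for H1 by (auto simp: B3_def)
          then show ?thesis by (simp add: bexp_const)
        qed
      qed
      have "bexp ?X (p n) (\<lambda>H. of_bool (\<not> ?good H)) =
        bexp ?X p0 (\<lambda>H0. bexp ?X p1 (\<lambda>H1. of_bool (\<not> ?good (H0 \<union> H1))))"
        unfolding pu[symmetric]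
        by (rule bexp_union[symmetric, where f = "\<lambda>H. of_bool (\<not> ?good H)", OF finite_ksets])
      also have "\<dots> \<le> bexp ?X p0 (\<lambda>H0. bexp ?X p1 (\<lambda>H1. of_bool (B1 H0) +
          (\<Sum>S\<in>ksets n s. of_bool (B2 S H0 H1) + of_bool (B3 S H0 H1))))"
      proof (intro bexp_mono p0(1,2) p1)
        fix H0 H1
        let ?f = "\<lambda>S. of_bool (B2 S H0 H1) + of_bool (B3 S H0 H1) :: real"
        have nn: "0 \<le> (\<Sum>S\<in>ksets n s. ?f S)" by (intro sum_nonneg) auto
        show "of_bool (\<not> ?good (H0 \<union> H1)) \<le> of_bool (B1 H0) + (\<Sum>S\<in>ksets n s. ?f S)"
        proof (cases "?good (H0 \<union> H1) \<or> B1 H0")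
          case True
          then show ?thesis using nn by auto
        next
          case False
          then obtain S where S: "S \<in> ksets n s" "B2 S H0 H1 \<or> B3 S H0 H1" using det by blast
          then have "1 \<le> ?f S" by auto
          also have "?f S \<le> (\<Sum>S\<in>ksets n s. ?f S)" using S(1) by (intro member_le_sum) auto
          finally show ?thesis using False by simp
        qed
      qed
      also have "\<dots> = bexp ?X p0 (\<lambda>H0. of_bool (B1 H0)) +
        (\<Sum>S\<in>ksets n s. bexp ?X p0 (\<lambda>H0. bexp ?X p1 (\<lambda>H1. of_bool (B2 S H0 H1))) +
          bexp ?X p0 (\<lambda>H0. bexp ?X p1 (\<lambda>H1. of_bool (B3 S H0 H1))))"
        by (simp only: bexp_add bexp_sum bexp_const finite_ksets)
      also have "\<dots> \<le> e / 2 + (\<Sum>S\<in>ksets n s. 2 / real n ^ Suc s + 1 / real n ^ Suc s)"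
      proof (intro add_mono sum_mono e2 e3)
        have "B1 H0 \<longleftrightarrow> \<not> (\<exists>S\<in>ksets n s. (1 - \<sigma> - \<delta>) * ?N \<le> real (card (reach n s {S} H0)))" for H0
          by (auto simp: B1_def giant_def \<delta>(2))
        then show "bexp ?X p0 (\<lambda>H0. of_bool (B1 H0)) \<le> e / 2" using elim(7) by (simp only: p0_def)
      qed
      also have "(\<Sum>S\<in>ksets n s. 2 / real n ^ Suc s + 1 / real n ^ Suc s) = ?N * (3 / real n ^ Suc s)"
        by (simp add: card_ksets add_divide_distrib[symmetric])
      also have "\<dots> \<le> real n ^ s * (3 / real n ^ Suc s)"
        using binomial_le_pow[OF sn] by (intro mult_right_mono) (auto simp flip: of_nat_power)
      also have "\<dots> = 3 / real n" using n1 by simp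
      also have "e / 2 + 3 / real n \<le> e" using elim(1) by simp
      finally show ?case by simp
    qed
  qed
qed

text \<open>The component from \<open>eventually_giant\<close> exceeds \<open>C * ln n\<close>, so
  it is the exceptional one of \<open>supercritical_phase\<close>. Its size is bounded from above by
  counting: it lies among the sets whose components have at least \<open>k\<close> members, and
  \<open>eventually_small_count\<close> says how many of these there are.\<close>

lemma giant_component_size:
  assumes s: "1 \<le> s" "s < r" and c: "0 < c" and m: "m = (r choose s) - 1" and cm: "1 < c * real m"
  shows "\<exists>z. 0 < z \<and> z < 1 \<and> 1 - z = exp (c * ((1 - z) ^ m - 1)) \<and>
    (\<exists>C. \<forall>\<delta>>0. (\<lambda>n. prob_hg n r (c / real (n choose (r - s)))
      (\<lambda>H. \<exists>K\<in>s_components n s H. \<bar>real (card K) - z * real (n choose s)\<bar> \<le> \<delta> * real (n choose s) \<and>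
        (\<forall>K'\<in>s_components n s H. K' \<noteq> K \<longrightarrow> real (card K') \<le> C * ln (real n)))) \<longlonglongrightarrow> 1)"
proof -
  have m1: "1 \<le> m" using cm c by (cases m) auto
  obtain \<sigma> where \<sigma>: "0 < \<sigma>" "\<sigma> < 1" "\<sigma> = exp (c * (\<sigma> ^ m - 1))"
    and below: "\<And>u. 0 \<le> u \<Longrightarrow> u < \<sigma> \<Longrightarrow> u < exp (c * (u ^ m - 1))"
    and above: "\<And>t. \<sigma> < t \<Longrightarrow> t < 1 \<Longrightarrow> exp (c * (t ^ m - 1)) < t"
    using extinction_root[OF c m1 cm] by blast
  obtain C c1 where c1: "0 < c1"
    and super: "\<And>p e. \<forall>\<^sub>F n in sequentially. c / real (n choose (r - s)) \<le> p n \<and> p n \<le> 1 \<Longrightarrow> 0 < e \<Longrightarrow>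
      \<forall>\<^sub>F n in sequentially. bexp (ksets n r) (p n) (\<lambda>H. of_bool
      (\<not> one_giant n s (c1 * real (n choose s)) (C * ln (real n)) H)) \<le> e"
    using supercritical_phase[OF s c m cm] by blast
  from eventually_choose_inverse_less[OF s(2), of c] have p: "\<forall>\<^sub>F n in sequentially. 0 \<le> c / real (n choose (r - s)) \<and> c / real (n choose (r - s)) \<le> 1"
    by eventually_elim (use c in auto)
  show ?thesis
  proof (rule exI[of _ "1 - \<sigma>"], intro conjI)
    show "0 < 1 - \<sigma>" "1 - \<sigma> < 1" "1 - (1 - \<sigma>) = exp (c * ((1 - (1 - \<sigma>)) ^ m - 1))"
      using \<sigma> by auto
    show "\<exists>C. \<forall>\<delta>>0. (\<lambda>n. prob_hg n r (c / real (n choose (r - s)))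
      (\<lambda>H. \<exists>K\<in>s_components n s H. \<bar>real (card K) - (1 - \<sigma>) * real (n choose s)\<bar> \<le> \<delta> * real (n choose s) \<and>
        (\<forall>K'\<in>s_components n s H. K' \<noteq> K \<longrightarrow> real (card K') \<le> C * ln (real n)))) \<longlonglongrightarrow> 1"
    proof (rule exI[of _ C], intro allI impI prob_hg_tendsto_1[OF p])
    fix \<delta> e :: real assume \<delta>: "0 < \<delta>" and e: "0 < e"
    \<comment> \<open>The cap \<open>(1 - \<sigma>) / 2\<close> keeps
      \<open>(1 - \<sigma> - d) * (n choose s)\<close> at least linear in \<open>n\<close>, thus
      eventually above both \<open>C * ln n\<close> and \<open>k\<close>.\<close>
    define d where "d = min \<delta> ((1 - \<sigma>) / 2)"
    have d: "0 < d" "d \<le> \<delta>" "d \<le> (1 - \<sigma>) / 2"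
      unfolding d_def using \<delta> \<sigma> by (simp_all only: min.cobounded1 min.cobounded2) simp
    have e3: "0 < e / 3" using e by simp
    obtain k where k: "\<forall>\<^sub>F n in sequentially. bexp (ksets n r) (c / real (n choose (r - s)))
      (\<lambda>H. of_bool (d * real (n choose s) < \<bar>real (small_count n s k H) - \<sigma> * real (n choose s)\<bar>)) \<le> e / 3"
      using eventually_small_count[OF s c m \<sigma>(1,2) below above d(1) e3] by blast
    have giant: "\<forall>\<^sub>F n in sequentially. bexp (ksets n r) (c / real (n choose (r - s)))
      (\<lambda>H. of_bool (\<not> (\<exists>S\<in>ksets n s. (1 - \<sigma> - d) * real (n choose s) \<le> real (card (reach n s {S} H))))) \<le> e / 3"
      by (rule eventually_giant[OF s c m cm \<sigma>(1,2) above d(1) e3])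
    have p': "\<forall>\<^sub>F n in sequentially. c / real (n choose (r - s)) \<le> c / real (n choose (r - s)) \<and>
        c / real (n choose (r - s)) \<le> 1"
      using p by eventually_elim auto
    have "\<forall>\<^sub>F n in sequentially. C * ln (real n) < (1 - \<sigma>) / 2 * (real n / real s) \<and> real k < (1 - \<sigma>) / 2 * (real n / real s)"
      using \<sigma> s by (intro eventually_conj; real_asymp)
    with k giant super[OF p' e3] p eventually_ge_at_top[of r]
    show "\<forall>\<^sub>F n in sequentially. bexp (ksets n r) (c / real (n choose (r - s)))
      (\<lambda>H. of_bool (\<not> (\<exists>K\<in>s_components n s H. \<bar>real (card K) - (1 - \<sigma>) * real (n choose s)\<bar> \<le> \<delta> * real (n choose s) \<and>
        (\<forall>K'\<in>s_components n s H. K' \<noteq> K \<longrightarrow> real (card K') \<le> C * ln (real n))))) \<le> e"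
    proof eventually_elim
      case (elim n)
      let ?X = "ksets n r" and ?N = "real (n choose s)" and ?p = "c / real (n choose (r - s))"
      define B1 where "B1 = (\<lambda>H. d * ?N < \<bar>real (small_count n s k H) - \<sigma> * ?N\<bar>)"
      define B2 where "B2 = (\<lambda>H. \<not> (\<exists>S\<in>ksets n s. (1 - \<sigma> - d) * ?N \<le> real (card (reach n s {S} H))))"
      define B3 where "B3 = (\<lambda>H. \<not> one_giant n s (c1 * ?N) (C * ln (real n)) H)"
      define good where "good = (\<lambda>H. \<exists>K\<in>s_components n s H. \<bar>real (card K) - (1 - \<sigma>) * ?N\<bar> \<le> \<delta> * ?N \<and>
        (\<forall>K'\<in>s_components n s H. K' \<noteq> K \<longrightarrow> real (card K') \<le> C * ln (real n)))"
      have sn: "s \<le> n" using elim(5) s by simp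
      have "real n / real s \<le> ?N" by (rule choose_ge_ratio[OF s(1) sn])
      then have "(1 - \<sigma>) / 2 * (real n / real s) \<le> (1 - \<sigma>) / 2 * ?N" using \<sigma> by (intro mult_left_mono) auto
      moreover have "(1 - \<sigma>) / 2 * ?N \<le> (1 - \<sigma> - d) * ?N" using d by (intro mult_right_mono) auto
      ultimately have big: "C * ln (real n) < (1 - \<sigma> - d) * ?N" "real k < (1 - \<sigma> - d) * ?N"
        using elim(6) by linarith+
      have det: "good H" if not: "\<not> B1 H" "\<not> B2 H" "\<not> B3 H" for H
      proof -
        obtain S where S: "S \<in> ksets n s" "(1 - \<sigma> - d) * ?N \<le> real (card (reach n s {S} H))"
          using not(2) by (auto simp: B2_def)
        obtain K where K: "K \<in> s_components n s H"
          "\<forall>K'\<in>s_components n s H. K' \<noteq> K \<longrightarrow> real (card K') \<le> C * ln (real n)"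
          using not(3) by (auto simp: B3_def one_giant_def)
        have "reach n s {S} H \<in> s_components n s H" using S(1) by (auto simp: s_components_reach)
        then have KS: "K = reach n s {S} H" using K(2) S(2) big(1) by fastforce
        have "S \<in> big_sets n s k H" using S big(2) by (simp add: big_sets_def)
        then have "card K \<le> card (big_sets n s k H)"
          unfolding KS by (intro card_mono finite_big_sets reach_subset_big_sets)
        then have "real (card K) \<le> ?N - real (small_count n s k H)"
          using big_sets_eq[of n s k H] by (simp add: of_nat_diff[symmetric] del: of_nat_diff)
        moreover have "\<sigma> * ?N - d * ?N \<le> real (small_count n s k H)" using not(1) by (simp add: B1_def)
        moreover have "(1 - \<sigma> - d) * ?N = (1 - \<sigma>) * ?N - d * ?N" "(1 - \<sigma>) * ?N = ?N - \<sigma> * ?N"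
          by (simp_all add: algebra_simps)
        moreover have "d * ?N \<le> \<delta> * ?N" using d by (intro mult_right_mono) auto
        ultimately have "\<bar>real (card K) - (1 - \<sigma>) * ?N\<bar> \<le> \<delta> * ?N" using S(2)[folded KS] by linarith
        then show ?thesis using K unfolding good_def by blast
      qed
      have P: "0 \<le> ?p" "?p \<le> 1" using elim(4) by auto
      have "bexp ?X ?p (\<lambda>H. of_bool (\<not> good H)) \<le>
        bexp ?X ?p (\<lambda>H. of_bool (B1 H) + (of_bool (B2 H) + of_bool (B3 H)))"
      proof (intro bexp_mono P)
        fix H
        show "of_bool (\<not> good H) \<le> of_bool (B1 H) + (of_bool (B2 H) + of_bool (B3 H) :: real)"
          using det[of H] by (cases "B1 H"; cases "B2 H"; cases "B3 H") auto
      qed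
      also have "\<dots> \<le> e / 3 + (e / 3 + e / 3)"
        unfolding bexp_add B1_def B2_def B3_def by (intro add_mono elim(1-3))
      finally show ?case by (simp add: good_def)
    qed
    qed
  qed
qed

theorem theorem1:
  fixes r s :: nat
  assumes "r \<ge> 2" and "1 \<le> s" and "s \<le> r - 1"
  shows "\<exists>\<epsilon>0>0. \<forall>\<epsilon>::real. 0 < \<epsilon> \<and> \<epsilon> < \<epsilon>0 \<longrightarrow>
    ( \<comment> \<open>subcritical phase\<close>
      (\<forall>p :: nat \<Rightarrow> real.
         (\<forall>\<^sub>F n in sequentially. 0 \<le> p n \<and>
            p n < (1 - \<epsilon>) / ((real (r choose s) - 1) * real (n choose (r - s)))) \<longrightarrow>
         (\<exists>C::real. (\<lambda>n. prob_hg n r (p n)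
              (\<lambda>H. \<forall>K\<in>s_components n s H. real (card K) \<le> C * ln (real n)))
            \<longlonglongrightarrow> 1))
    \<and> \<comment> \<open>supercritical phase\<close>
      (\<forall>p :: nat \<Rightarrow> real.
         (\<forall>\<^sub>F n in sequentially. p n \<le> 1 \<and>
            p n > (1 + \<epsilon>) / ((real (r choose s) - 1) * real (n choose (r - s)))) \<longrightarrow>
         (\<exists>C c1::real. c1 > 0 \<and> (\<lambda>n. prob_hg n r (p n)
              (\<lambda>H. \<exists>K\<in>s_components n s H. c1 * real (n choose s) \<le> real (card K) \<and>
                   (\<forall>K'\<in>s_components n s H. K' \<noteq> K \<longrightarrow> real (card K') \<le> C * ln (real n))))
            \<longlonglongrightarrow> 1))
    \<and> \<comment> \<open>size of the giant component when p = c / binom(n, r-s)\<close>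
      (let c = (1 + \<epsilon>) / (real (r choose s) - 1) in
       \<exists>z::real. 0 < z \<and> z < 1 \<and> 1 - z = exp (c * ((1 - z) ^ ((r choose s) - 1) - 1)) \<and>
         (\<exists>C::real. \<forall>\<delta>>0. (\<lambda>n. prob_hg n r (c / real (n choose (r - s)))
              (\<lambda>H. \<exists>K\<in>s_components n s H.
                   \<bar>real (card K) - z * real (n choose s)\<bar> \<le> \<delta> * real (n choose s) \<and>
                   (\<forall>K'\<in>s_components n s H. K' \<noteq> K \<longrightarrow> real (card K') \<le> C * ln (real n))))
            \<longlonglongrightarrow> 1)))"
proof -
  have s: "1 \<le> s" "s < r" using assms by auto
  define m where "m = (r choose s) - 1"
  have "1 < real r / real s" using s by simp
  also have "\<dots> \<le> real (r choose s)" using s by (intro choose_ge_ratio) auto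
  finally have rm: "real (r choose s) - 1 = real m" and m1: "0 < real m"
    by (auto simp: m_def of_nat_diff)
  let ?M = "\<lambda>n. real (n choose (r - s))"
  show ?thesis
    unfolding rm Let_def
  \<comment> \<open>\<open>\<epsilon>0 = 1\<close> keeps \<open>1 - \<epsilon>\<close> positive, as
    \<open>subcritical_phase\<close> requires of its constant.\<close>
  proof (rule exI[of _ 1], intro conjI zero_less_one allI impI)
    fix \<epsilon> :: real and p :: "nat \<Rightarrow> real"
    assume eps: "0 < \<epsilon> \<and> \<epsilon> < 1"
      and p: "\<forall>\<^sub>F n in sequentially. 0 \<le> p n \<and> p n < (1 - \<epsilon>) / (real m * ?M n)"
    have "\<forall>\<^sub>F n in sequentially. 0 \<le> p n \<and> p n \<le> (1 - \<epsilon>) / real m / ?M n"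
      using p by eventually_elim simp
    moreover have "0 < (1 - \<epsilon>) / real m" "(1 - \<epsilon>) / real m * real m < 1" using eps m1 by auto
    ultimately show "\<exists>C::real. (\<lambda>n. prob_hg n r (p n)
        (\<lambda>H. \<forall>K\<in>s_components n s H. real (card K) \<le> C * ln (real n))) \<longlonglongrightarrow> 1"
      by (intro subcritical_phase[OF s _ m_def])
  next
    fix \<epsilon> :: real and p :: "nat \<Rightarrow> real"
    assume eps: "0 < \<epsilon> \<and> \<epsilon> < 1"
      and p: "\<forall>\<^sub>F n in sequentially. p n \<le> 1 \<and> p n > (1 + \<epsilon>) / (real m * ?M n)"
    have c: "0 < (1 + \<epsilon>) / real m" "1 < (1 + \<epsilon>) / real m * real m" using eps m1 by auto
    have p': "\<forall>\<^sub>F n in sequentially. (1 + \<epsilon>) / real m / ?M n \<le> p n \<and> p n \<le> 1"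
      using p by eventually_elim simp
    have "0 \<le> (1 + \<epsilon>) / real m / ?M n" for n using eps by simp
    then have p01: "\<forall>\<^sub>F n in sequentially. 0 \<le> p n \<and> p n \<le> 1"
      using p' by (auto elim!: eventually_mono intro: order_trans)
    obtain C c1 where c1: "0 < c1" and super: "\<And>e. 0 < e \<Longrightarrow> \<forall>\<^sub>F n in sequentially. bexp (ksets n r) (p n)
        (\<lambda>H. of_bool (\<not> one_giant n s (c1 * real (n choose s)) (C * ln (real n)) H)) \<le> e"
      using supercritical_phase[OF s c(1) m_def c(2)] p' by blast
    show "\<exists>C c1::real. c1 > 0 \<and> (\<lambda>n. prob_hg n r (p n)
        (\<lambda>H. \<exists>K\<in>s_components n s H. c1 * real (n choose s) \<le> real (card K) \<and>
           (\<forall>K'\<in>s_components n s H. K' \<noteq> K \<longrightarrow> real (card K') \<le> C * ln (real n)))) \<longlonglongrightarrow> 1"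
      by (rule exI[of _ C], rule exI[of _ c1])
        (intro conjI c1 prob_hg_tendsto_1[OF p01] super[unfolded one_giant_def])
  next
    fix \<epsilon> :: real
    assume "0 < \<epsilon> \<and> \<epsilon> < 1"
    then show "\<exists>z::real. 0 < z \<and> z < 1 \<and>
        1 - z = exp ((1 + \<epsilon>) / real m * ((1 - z) ^ ((r choose s) - 1) - 1)) \<and>
        (\<exists>C::real. \<forall>\<delta>>0. (\<lambda>n. prob_hg n r ((1 + \<epsilon>) / real m / ?M n)
          (\<lambda>H. \<exists>K\<in>s_components n s H.
             \<bar>real (card K) - z * real (n choose s)\<bar> \<le> \<delta> * real (n choose s) \<and>
             (\<forall>K'\<in>s_components n s H. K' \<noteq> K \<longrightarrow> real (card K') \<le> C * ln (real n)))) \<longlonglongrightarrow> 1)"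
      using m1 unfolding m_def[symmetric] by (intro giant_component_size s m_def) auto
  qed
qed

end
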